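(* Let $G$ be a finite group. Then the coset poset $\mathfrak{C}(G)$ is shellable if and only if $G$ is supersolvable and all Sylow subgroups of $G$ are elementary abelian.
   Context: All posets, simplicial complexes and groups are finite. The coset poset $\mathfrak{C}(G)$ is the set of all cosets $Hx$ ($x\in G$) of proper subgroups $H\subsetneq G$, ordered by inclusion. The order complex $|P|$ of a poset $P$ is the simplicial complex with vertex set $P$ whose faces are the chains of $P$ (including the empty chain). A shelling of a simplicial complex $\Delta$ (not assumed pure) is an ordering $F_1,\dots,F_n$ of its facets (maximal faces) such that for every $k\ge 2$ the complex $F_k\cap\bigl(\bigcup_{i=1}^{k-1}F_i\bigr)$ is a nonempty union of facets (codimension-one faces) of $F_k$; here each $F_i$ is identified with the simplex consisting of all its faces, and the empty set counts as a face (so it is the unique facet of a single vertex). $\Delta$ is shellable if it has a shelling, and a poset $P$ is shellable if $|P|$ is. A group is supersolvable if it has a chief series in which every factor has prime order. *)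

theory Defs
  imports "HOL-Algebra.Coset" "HOL-Computational_Algebra.Primes"
begin

definition coset_poset :: "('a, 'b) monoid_scheme \<Rightarrow> 'a set gorder" where
  "coset_poset G =
    \<lparr>carrier = \<Union> {rcosets\<^bsub>G\<^esub> H | H. subgroup H G \<and> H \<noteq> carrier G}, eq = (=), le = (\<subseteq>)\<rparr>"

lemma partial_order_coset_poset: "partial_order (coset_poset G)"
  by unfold_locales (auto simp: coset_poset_def)

text \<open>A simplicial complex is represented by its set of faces, the empty face included.\<close>

definition order_complex :: "('a, 'b) gorder_scheme \<Rightarrow> 'a set set" where
  "order_complex P = {C. C \<subseteq> carrier P \<and> Complete_Partial_Order.chain (le P) C}"

definition facets :: "'a set set \<Rightarrow> 'a set set" where
  "facets \<Delta> = {F \<in> \<Delta>. \<forall>F' \<in> \<Delta>. F \<subseteq> F' \<longrightarrow> F' = F}"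

text \<open>
  The simplex on a vertex set \<open>F\<close> is the complex \<open>Pow F\<close>; its facets are the sets \<open>F - {v}\<close> with
  \<open>v \<in> F\<close>. In particular \<open>{}\<close> is the only facet of the simplex on a single vertex, and the simplex
  \<open>Pow {}\<close> has no codimension-one face.
\<close>

definition codim1_faces :: "'a set \<Rightarrow> 'a set set" where
  "codim1_faces F = {F - {v} | v. v \<in> F}"

definition shelling :: "'a set set \<Rightarrow> 'a set list \<Rightarrow> bool" where
  "shelling \<Delta> Fs \<longleftrightarrow> distinct Fs \<and> set Fs = facets \<Delta> \<and>
    (\<forall>k. 0 < k \<and> k < length Fs \<longrightarrow>
      (\<exists>S. S \<noteq> {} \<and> S \<subseteq> codim1_faces (Fs ! k) \<and>
        Pow (Fs ! k) \<inter> (\<Union>i<k. Pow (Fs ! i)) = (\<Union>E\<in>S. Pow E)))"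

definition shellable :: "'a set set \<Rightarrow> bool" where
  "shellable \<Delta> \<longleftrightarrow> (\<exists>Fs. shelling \<Delta> Fs)"

definition shellable_poset :: "('a, 'b) gorder_scheme \<Rightarrow> bool" where
  "shellable_poset P \<longleftrightarrow> shellable (order_complex P)"

text \<open>
  A chief series \<open>{1} = N\<^sub>0 \<subset> \<dots> \<subset> N\<^sub>r = G\<close> consists of normal subgroups of the whole
  group \<open>G\<close> and cannot be refined by further normal subgroups of \<open>G\<close>.
\<close>

definition chief_series :: "('a, 'b) monoid_scheme \<Rightarrow> 'a set list \<Rightarrow> bool" where
  "chief_series G Ns \<longleftrightarrow> Ns \<noteq> [] \<and> hd Ns = {\<one>\<^bsub>G\<^esub>} \<and> last Ns = carrier G \<and>
    (\<forall>N \<in> set Ns. N \<lhd> G) \<and>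
    (\<forall>i. Suc i < length Ns \<longrightarrow>
      Ns ! i \<subset> Ns ! Suc i \<and> \<not> (\<exists>M. M \<lhd> G \<and> Ns ! i \<subset> M \<and> M \<subset> Ns ! Suc i))"

definition supersolvable :: "('a, 'b) monoid_scheme \<Rightarrow> bool" where
  "supersolvable G \<longleftrightarrow> (\<exists>Ns. chief_series G Ns \<and>
    (\<forall>i. Suc i < length Ns \<longrightarrow>
      prime (order ((G\<lparr>carrier := Ns ! Suc i\<rparr>) Mod (Ns ! i)))))"

definition sylow_subgroup :: "nat \<Rightarrow> 'a set \<Rightarrow> ('a, 'b) monoid_scheme \<Rightarrow> bool" where
  "sylow_subgroup p S G \<longleftrightarrow>
    prime p \<and> subgroup S G \<and> card S = p ^ multiplicity p (order G)"

text \<open>The trivial group counts as elementary abelian.\<close>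

definition elementary_abelian :: "('a, 'b) monoid_scheme \<Rightarrow> bool" where
  "elementary_abelian G \<longleftrightarrow> comm_group G \<and>
    (\<exists>p::nat. prime p \<and> (\<forall>x \<in> carrier G. x [^]\<^bsub>G\<^esub> p = \<one>\<^bsub>G\<^esub>))"

end

(*
  Call a finite group complemented if it is supersolvable with elementary abelian Sylow subgroups.

  If G is complemented, Gaschuetz's theorem yields a normal series N_0 < ... < N_d with factors of
  prime order and a complement M_i of each factor N_(i+1)/N_i in G.  A cover Hx > Ky of cosets has a
  type i, the unique factor that is met by H but not by K.  It is labelled -(i+1) if Ky is the
  intersection of Hx with M_i and d-i otherwise, and the lexicographic order of the label words, read
  from the top, is a shelling.

  Conversely, links of shellable complexes are shellable, so by induction all proper subgroups of G are
  complemented.  The facets with at least s vertices, taken in the order of the shelling, again satisfy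
  the shelling condition; hence they form a connected complex if s >= 2, and a complex without
  non-trivial cocycles (with values in any group) if s >= 3.  The second property says that a map on G
  that is a homomorphism on every subgroup occurring in long chains is a homomorphism, which fails for
  minimal non-abelian groups and disposes of p-groups.  In the remaining case a transfer argument gives
  a proper normal subgroup, hence a complemented minimal normal subgroup V, which is elementary
  abelian.  If V is not of prime order, only subgroups H with VH < G occur in long chains; then G acts
  on V through an abelian group, every element acts by a power map, and V has prime order after all.
*)

theory Submission
  imports Defs "HOL-Library.List_Lexorder" "HOL-Algebra.Group_Action" "HOL-Algebra.Sylow"
    "HOL-Algebra.Generated_Groups" "HOL-Algebra.Multiplicative_Group"
    "HOL-Algebra.Zassenhaus"
begin

text \<open>Write Omega(n) for the number of prime factors of n with multiplicity. The converse
  direction lives on facets of different lengths. If V is an elementary abelian minimal normal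
  subgroup of rank n \<ge> 2 with complement K, chains below a coset of a proper supplement of V
  have at most Omega(|K|) + 1 members, whereas every maximal subgroup above V carries chains of
  Omega(|K|) + n members. The threshold s = Omega(|K|) + 2 separates the two. Homology is avoided: a
  1-cocycle with values in an arbitrary group is integrated facet by facet. Its arguments are
  quotients of coset representatives, so a map that is multiplicative on stabilizers yields a
  potential on the cosets, and global multiplicativity is read off from the potential at singletons.
  In the direct implication the two kinds of labels have opposite signs, and 0 is reserved for the
  step to the missing bottom. A maximal chain is therefore rising down to the bottom exactly if
  every cover is cut out by a complement and the types descend from the top.\<close>

section \<open>Shellings by rank functions\<close>

text \<open>
  Facets with equal keys may come in any order, since the hypothesis covers both of them.
\<close>

lemma shellableI:
  fixes key :: "'a set \<Rightarrow> 'k::linorder"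
  assumes fin: "finite (facets \<Delta>)"
    and step: "\<And>F F'. F \<in> facets \<Delta> \<Longrightarrow> F' \<in> facets \<Delta> \<Longrightarrow> F \<noteq> F' \<Longrightarrow> key F' \<le> key F \<Longrightarrow>
      \<exists>v\<in>F. \<exists>F''\<in>facets \<Delta>. key F'' < key F \<and> F' \<inter> F \<subseteq> F - {v} \<and> F - {v} \<subseteq> F''"
  shows "shellable \<Delta>"
proof -
  obtain xs where xs: "set xs = facets \<Delta>" "distinct xs"
    using finite_distinct_list[OF fin] by blast
  define Fs where "Fs = sort_key key xs"
  have Fs: "set Fs = facets \<Delta>" "distinct Fs" "sorted (map key Fs)"
    using xs by (auto simp: Fs_def)
  have mono: "key (Fs ! i) \<le> key (Fs ! j)" if "i \<le> j" "j < length Fs" for i j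
    using sorted_nth_mono[OF Fs(3), of i j] that by simp
  have "\<exists>S. S \<noteq> {} \<and> S \<subseteq> codim1_faces (Fs ! k) \<and>
      Pow (Fs ! k) \<inter> (\<Union>i<k. Pow (Fs ! i)) = (\<Union>E\<in>S. Pow E)" if k: "0 < k" "k < length Fs" for k
  proof -
    \<comment> \<open>All codimension-one faces of the new facet that lie in an earlier one. They
      generate the intersection as soon as each pairwise intersection is contained in one of
      them.\<close>
    let ?S = "{E \<in> codim1_faces (Fs ! k). \<exists>j<k. E \<subseteq> Fs ! j}"
    have cov: "\<exists>E\<in>?S. Fs ! i \<inter> Fs ! k \<subseteq> E" if "i < k" for i
    proof -
      have ki: "Fs ! k \<noteq> Fs ! i" "Fs ! k \<in> facets \<Delta>" "Fs ! i \<in> facets \<Delta>"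
        using that k nth_eq_iff_index_eq[OF Fs(2), of k i] nth_mem[of k Fs] nth_mem[of i Fs] Fs(1)
        by auto
      have "key (Fs ! i) \<le> key (Fs ! k)" using mono[of i k] that k by simp
      then obtain v F'' where v: "v \<in> Fs ! k" "F'' \<in> facets \<Delta>" "key F'' < key (Fs ! k)"
        "Fs ! i \<inter> Fs ! k \<subseteq> Fs ! k - {v}" "Fs ! k - {v} \<subseteq> F''"
        using step[OF ki(2,3,1)] by blast
      then obtain j where j: "j < length Fs" "F'' = Fs ! j"
        using Fs(1) by (metis in_set_conv_nth)
      have "j < k"
      proof (rule ccontr)
        assume "\<not> j < k"
        then show False using mono[of k j] j v(3) by auto
      qed
      then show ?thesis using v j by (auto simp: codim1_faces_def)
    qed
    show ?thesis
    proof (intro exI[of _ ?S] conjI)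
      show "?S \<noteq> {}" using cov[OF k(1)] by blast
      show "Pow (Fs ! k) \<inter> (\<Union>i<k. Pow (Fs ! i)) = (\<Union>E\<in>?S. Pow E)"
      proof (intro equalityI subsetI)
        fix X assume "X \<in> Pow (Fs ! k) \<inter> (\<Union>i<k. Pow (Fs ! i))"
        then obtain i where "i < k" "X \<subseteq> Fs ! i \<inter> Fs ! k" by auto
        then show "X \<in> (\<Union>E\<in>?S. Pow E)" using cov by (meson PowI UN_iff order_trans)
      next
        fix X assume "X \<in> (\<Union>E\<in>?S. Pow E)"
        then show "X \<in> Pow (Fs ! k) \<inter> (\<Union>i<k. Pow (Fs ! i))"
          by (fastforce simp: codim1_faces_def)
      qed
    qed auto
  qed
  then have "shelling \<Delta> Fs" using Fs by (auto simp: shelling_def)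
  then show ?thesis by (auto simp: shellable_def)
qed

text \<open>The rank of a facet is its position in the shelling. A rank function survives the
  removal of facets and the passage to a link without renumbering, which a list does not.\<close>

lemma shellableD:
  assumes "shellable \<Delta>"
  obtains r :: "'a set \<Rightarrow> nat" where "finite (facets \<Delta>)" "inj_on r (facets \<Delta>)"
    "\<And>F F'. F \<in> facets \<Delta> \<Longrightarrow> F' \<in> facets \<Delta> \<Longrightarrow> r F' < r F \<Longrightarrow>
      \<exists>v\<in>F. \<exists>F''\<in>facets \<Delta>. r F'' < r F \<and> F' \<inter> F \<subseteq> F - {v} \<and> F - {v} \<subseteq> F''"
proof -
  obtain Fs where Fs: "distinct Fs" "set Fs = facets \<Delta>"
    and S: "\<And>k. 0 < k \<Longrightarrow> k < length Fs \<Longrightarrow> \<exists>S. S \<noteq> {} \<and> S \<subseteq> codim1_faces (Fs ! k) \<and>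
        Pow (Fs ! k) \<inter> (\<Union>i<k. Pow (Fs ! i)) = (\<Union>E\<in>S. Pow E)"
    using assms by (auto simp: shellable_def shelling_def)
  define r where "r = (\<lambda>F. THE i. i < length Fs \<and> Fs ! i = F)"
  have r_nth: "r (Fs ! i) = i" if "i < length Fs" for i
    unfolding r_def using that Fs(1) by (intro the_equality) (auto simp: nth_eq_iff_index_eq)
  have nth_r: "r F < length Fs \<and> Fs ! r F = F" if "F \<in> facets \<Delta>" for F
    using that Fs(2) r_nth by (metis in_set_conv_nth)
  show thesis
  proof
    show "finite (facets \<Delta>)" using Fs(2) by (metis List.finite_set)
    show "inj_on r (facets \<Delta>)" using nth_r by (metis inj_onI)
    fix F F' assume F: "F \<in> facets \<Delta>" "F' \<in> facets \<Delta>" "r F' < r F"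
    then obtain S where S': "S \<subseteq> codim1_faces F"
        "Pow F \<inter> (\<Union>i<r F. Pow (Fs ! i)) = (\<Union>E\<in>S. Pow E)"
      using S[of "r F"] nth_r[OF F(1)] by auto
    have "F' \<inter> F \<in> Pow F \<inter> (\<Union>i<r F. Pow (Fs ! i))" using F(3) nth_r[OF F(2)] by auto
    then obtain E where E: "E \<in> S" "F' \<inter> F \<subseteq> E" using S'(2) by auto
    then obtain v where v: "v \<in> F" "E = F - {v}" using S'(1) by (auto simp: codim1_faces_def)
    have "E \<in> (\<Union>E\<in>S. Pow E)" using E by auto
    then have "E \<in> (\<Union>i<r F. Pow (Fs ! i))" using S'(2) by blast
    then obtain j where "j < r F" "E \<subseteq> Fs ! j" by auto
    moreover then have "j < length Fs" using nth_r[OF F(1)] by auto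
    ultimately show "\<exists>v\<in>F. \<exists>F''\<in>facets \<Delta>. r F'' < r F \<and> F' \<inter> F \<subseteq> F - {v} \<and> F - {v} \<subseteq> F''"
      using v E Fs(2) r_nth by (intro bexI[of _ v] bexI[of _ "Fs ! j"]) auto
  qed
qed

text \<open>Label words are read from the highest rank down, so the largest differing index
  \<open>m\<close> is the first position at which the words differ.\<close>

lemma map_rev_upt_less:
  fixes f g :: "nat \<Rightarrow> int"
  assumes "m < n" "\<And>j. m < j \<Longrightarrow> j < n \<Longrightarrow> f j = g j" "f m < g m"
  shows "map f (rev [0..<n]) < map g (rev [0..<n])"
proof -
  have "[0..<n] = [0..<m] @ m # [Suc m..<n]"
    using assms(1) by (metis less_imp_le_nat upt_add_eq_append[of 0 m "n - m"] upt_conv_Cons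
        le_add_diff_inverse zero_le)
  then have *: "rev [0..<n] = rev [Suc m..<n] @ m # rev [0..<m]" by simp
  have eq: "map f (rev [Suc m..<n]) = map g (rev [Suc m..<n])" using assms(2) by auto
  show ?thesis unfolding * map_append eq list_less_def
    by (rule lexord_append_leftI) (simp add: assms(3))
qed

section \<open>Posets with a lexicographic shelling\<close>

text \<open>
  A variant of a dual EL-labelling: chains are read from the top \<open>U\<close>, labels along an interval have
  exactly one rising chain and this chain is lexicographically first. No bottom element is adjoined; the
  step from a minimal element to it would carry the label \<open>0\<close>, which explains the assumptions
  \<open>descent_bot\<close> and \<open>rising_bot\<close>.
\<close>

locale labelled_poset =
  fixes P :: "'a set set" and U :: "'a set" and rk :: "'a set \<Rightarrow> nat"
    and lab :: "'a set \<Rightarrow> 'a set \<Rightarrow> int" and covers :: "'a set \<Rightarrow> 'a set \<Rightarrow> bool"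
  defines "covers A B \<equiv> A \<in> P \<and> B \<in> insert U P \<and> A \<subset> B \<and> rk B = Suc (rk A)"
  assumes finite_P: "finite P"
    and below_top: "A \<in> P \<Longrightarrow> A \<subset> U"
    and rk_less: "A \<in> P \<Longrightarrow> B \<in> insert U P \<Longrightarrow> A \<subset> B \<Longrightarrow> rk A < rk B"
    and rk_gap: "A \<in> P \<Longrightarrow> B \<in> insert U P \<Longrightarrow> A \<subset> B \<Longrightarrow> Suc (rk A) < rk B \<Longrightarrow>
      \<exists>C\<in>P. A \<subset> C \<and> C \<subset> B"
    and rk_pos: "B \<in> insert U P \<Longrightarrow> 0 < rk B \<Longrightarrow> \<exists>A\<in>P. A \<subset> B"
    and descent: "covers B A \<Longrightarrow> covers C B \<Longrightarrow> lab B C \<le> lab A B \<Longrightarrow>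
      \<exists>B'. covers B' A \<and> C \<subset> B' \<and> lab A B' < lab A B"
    and descent_bot: "covers B A \<Longrightarrow> rk B = 0 \<Longrightarrow> 0 \<le> lab A B \<Longrightarrow>
      \<exists>B'. covers B' A \<and> lab A B' < lab A B"
    and rising: "b < m \<Longrightarrow> (\<And>k. b \<le> k \<Longrightarrow> k \<le> m \<Longrightarrow> covers (c k) (c (Suc k))) \<Longrightarrow>
      (\<And>j. b \<le> j \<Longrightarrow> j < m \<Longrightarrow> lab (c (Suc (Suc j))) (c (Suc j)) < lab (c (Suc j)) (c j)) \<Longrightarrow>
      covers B' (c (Suc m)) \<Longrightarrow> c b \<subset> B' \<Longrightarrow> B' \<noteq> c m \<Longrightarrow>
      lab (c (Suc m)) (c m) < lab (c (Suc m)) B'"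
    and rising_bot: "(\<And>k. k \<le> m \<Longrightarrow> covers (c k) (c (Suc k))) \<Longrightarrow> rk (c 0) = 0 \<Longrightarrow>
      (\<And>j. j < m \<Longrightarrow> lab (c (Suc (Suc j))) (c (Suc j)) < lab (c (Suc j)) (c j)) \<Longrightarrow>
      lab (c (Suc 0)) (c 0) < 0 \<Longrightarrow>
      covers B' (c (Suc m)) \<Longrightarrow> B' \<noteq> c m \<Longrightarrow> lab (c (Suc m)) (c m) < lab (c (Suc m)) B'"
begin

abbreviation "chain_complex \<equiv> {C. C \<subseteq> P \<and> Complete_Partial_Order.chain (\<subseteq>) C}"

text \<open>The top \<open>U\<close> is no vertex, but it is included here at rank
  \<open>rk U\<close> so that the step below it also has a label.\<close>

definition flag :: "'a set set \<Rightarrow> nat \<Rightarrow> 'a set" where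
  "flag F k = (THE c. c \<in> insert U F \<and> rk c = k)"

lemma chain_complexD: "C \<in> chain_complex \<Longrightarrow> A \<in> insert U C \<Longrightarrow> B \<in> insert U C \<Longrightarrow> A \<subseteq> B \<or> B \<subseteq> A"
  using below_top by (simp add: chain_def) blast

lemma chain_rk_le:
  assumes "C \<in> chain_complex" "A \<in> insert U C" "B \<in> insert U C" "rk A \<le> rk B" shows "A \<subseteq> B"
proof (rule ccontr)
  assume "\<not> A \<subseteq> B"
  then have "B \<subset> A" using chain_complexD[OF assms(1-3)] by auto
  moreover have "B \<in> P" using \<open>B \<subset> A\<close> assms below_top by (cases "B = U") auto
  ultimately show False using rk_less[of B A] assms by auto
qed

lemma chain_rk_inj:
  assumes "C \<in> chain_complex" "A \<in> insert U C" "B \<in> insert U C" "rk A = rk B" shows "A = B"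
  using chain_rk_le[OF assms(1-3)] chain_rk_le[OF assms(1,3,2)] assms(4) by auto

lemma flag_eq:
  assumes "C \<in> chain_complex" "A \<in> insert U C" shows "flag C (rk A) = A"
  unfolding flag_def using assms chain_rk_inj by (intro the_equality) blast+

lemma facets_insert:
  assumes "F \<in> facets chain_complex" "A \<in> P" "\<And>B. B \<in> F \<Longrightarrow> A \<subseteq> B \<or> B \<subseteq> A" shows "A \<in> F"
proof -
  have "insert A F \<in> chain_complex" using assms by (auto simp: facets_def chain_def)
  then have "insert A F = F" using assms(1) unfolding facets_def by blast
  then show ?thesis by auto
qed

text \<open>A missing rank k could be filled. Below the lowest member above k, and above the highest
  member below k if there is one, \<open>rk_gap\<close> or \<open>rk_pos\<close> supplies an element
  comparable with the whole chain, against maximality. In particular the complex is pure.\<close>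

lemma facet_rank_ex:
  assumes F: "F \<in> facets chain_complex" and k: "k \<le> rk U" shows "\<exists>c\<in>insert U F. rk c = k"
proof (rule ccontr)
  assume none: "\<not> ?thesis"
  have Fc: "F \<in> chain_complex" using F by (auto simp: facets_def)
  then have FP: "F \<subseteq> P" and finF: "finite F" using finite_P finite_subset by auto
  let ?up = "{c \<in> insert U F. k < rk c}" and ?lo = "{c \<in> F. rk c < k}"
  have fin: "finite ?up" "finite ?lo" using finF by auto
  have "U \<in> ?up" using none k by fastforce
  then have "Min (rk ` ?up) \<in> rk ` ?up" using fin by (intro Min_in) auto
  then obtain B where Beq: "Min (rk ` ?up) = rk B" and B: "B \<in> ?up" by (rule imageE)
  have Bmin: "rk B \<le> rk c" if "c \<in> ?up" for c
    unfolding Beq[symmetric] using fin that by (intro Min_le) auto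
  have Binsert: "B \<in> insert U P" using B FP by auto
  have lo_le: "c \<subseteq> B" if "c \<in> ?lo" for c
    using chain_rk_le[OF Fc, of c B] that B by auto
  have up_ge: "B \<subseteq> c" if "c \<in> ?up" for c
    using chain_rk_le[OF Fc, of B c] that B Bmin by auto
  have split: "c \<in> ?lo \<or> c \<in> ?up" if "c \<in> F" for c using that none by fastforce
  have "\<exists>C\<in>P. C \<subset> B \<and> (\<forall>c\<in>?lo. c \<subset> C)"
  proof (cases "?lo = {}")
    case True
    then show ?thesis using rk_pos[OF Binsert] B by auto
  next
    case False
    then have "Max (rk ` ?lo) \<in> rk ` ?lo" using fin by (intro Max_in) auto
    then obtain A where Aeq: "Max (rk ` ?lo) = rk A" and A: "A \<in> ?lo" by (rule imageE)
    have Amax: "rk c \<le> rk A" if "c \<in> ?lo" for c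
      unfolding Aeq[symmetric] using fin that by (intro Max_ge) auto
    have "A \<noteq> B" using A B by auto
    then have "A \<subset> B" using lo_le[OF A] by auto
    moreover have "Suc (rk A) < rk B" using A B by auto
    ultimately obtain C where "C \<in> P" "A \<subset> C" "C \<subset> B"
      using rk_gap[of A B] A FP Binsert by auto
    moreover have "c \<subseteq> A" if "c \<in> ?lo" for c
      using chain_rk_le[OF Fc, of c A] that A Amax by auto
    ultimately show ?thesis by blast
  qed
  then obtain C where C: "C \<in> P" "C \<subset> B" "\<And>c. c \<in> ?lo \<Longrightarrow> c \<subset> C" by auto
  have "C \<in> F"
  proof (rule facets_insert[OF F C(1)])
    fix c assume "c \<in> F"
    then consider "c \<in> ?lo" | "c \<in> ?up" using split by blast
    then show "C \<subseteq> c \<or> c \<subseteq> C"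
    proof cases
      case 1 then show ?thesis using C(3) by auto
    next
      case 2 then show ?thesis using up_ge C(2) by blast
    qed
  qed
  then show False using split[of C] C up_ge[of C] by blast
qed

lemma flag_props:
  assumes F: "F \<in> facets chain_complex"
  shows "flag F (rk U) = U" "\<And>k. k < rk U \<Longrightarrow> flag F k \<in> F" "\<And>k. k \<le> rk U \<Longrightarrow> rk (flag F k) = k"
    "\<And>k. k < rk U \<Longrightarrow> covers (flag F k) (flag F (Suc k))" "flag F ` {..<rk U} = F"
proof -
  have Fc: "F \<in> chain_complex" using F by (auto simp: facets_def)
  have flag: "flag F k \<in> insert U F \<and> rk (flag F k) = k" if k: "k \<le> rk U" for k
  proof -
    obtain c where "c \<in> insert U F" "rk c = k" using facet_rank_ex[OF F k] by blast
    then show ?thesis using flag_eq[OF Fc, of c] by simp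
  qed
  show 1: "flag F (rk U) = U" using flag_eq[OF Fc, of U] by auto
  show 2: "flag F k \<in> F" if "k < rk U" for k using flag[of k] that by auto
  show 3: "rk (flag F k) = k" if "k \<le> rk U" for k using flag[of k] that by auto
  show "covers (flag F k) (flag F (Suc k))" if k: "k < rk U" for k
  proof -
    have "flag F k \<subseteq> flag F (Suc k)" using chain_rk_le[OF Fc] flag[of k] flag[of "Suc k"] k by auto
    moreover have "flag F k \<noteq> flag F (Suc k)" using flag[of k] flag[of "Suc k"] k
      by (metis Suc_leI less_imp_le_nat n_not_Suc_n)
    ultimately show ?thesis using 2[OF k] Fc 3 k flag[of "Suc k"] by (auto simp: covers_def)
  qed
  show "flag F ` {..<rk U} = F"
  proof (rule equalityI[rotated], rule subsetI)
    fix A assume A: "A \<in> F"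
    then have "A \<in> P" using Fc by auto
    then have "rk A < rk U" using rk_less[of A U] below_top by auto
    then show "A \<in> flag F ` {..<rk U}" using flag_eq[OF Fc, of A] A by (metis imageI insertCI lessThan_iff)
  qed (use 2 in auto)
qed

text \<open>One element of each rank below \<open>rk U\<close> leaves no room: a further member of
  the chain would share its rank with an element already present.\<close>

lemma facet_of_flag:
  assumes top: "g (rk U) = U" and cov: "\<And>k. k < rk U \<Longrightarrow> covers (g k) (g (Suc k))"
    and rk: "\<And>k. k \<le> rk U \<Longrightarrow> rk (g k) = k"
  shows "g ` {..<rk U} \<in> facets chain_complex" "\<And>k. k \<le> rk U \<Longrightarrow> flag (g ` {..<rk U}) k = g k"
proof -
  let ?F = "g ` {..<rk U}"
  have mono: "g i \<subseteq> g j" if "i \<le> j" "j \<le> rk U" for i j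
    using that
  proof (induction j rule: dec_induct)
    case (step n) then show ?case using cov[of n] by (auto simp: covers_def)
  qed auto
  have ch: "?F \<in> chain_complex"
  proof (intro CollectI conjI chainI)
    show "?F \<subseteq> P" using cov by (auto simp: covers_def)
    fix x y assume "x \<in> ?F" "y \<in> ?F"
    then obtain i j where "x = g i" "y = g j" "i < rk U" "j < rk U" by auto
    then show "x \<subseteq> y \<or> y \<subseteq> x" using mono[of i j] mono[of j i] by (cases "i \<le> j") auto
  qed
  have "F' \<subseteq> ?F" if F': "F' \<in> chain_complex" "?F \<subseteq> F'" for F'
  proof
    fix x assume x: "x \<in> F'"
    have "x \<in> P" using F'(1) x by blast
    then have "rk x < rk U" using rk_less[of x U] below_top[of x] by simp
    then have *: "g (rk x) \<in> ?F" "rk (g (rk x)) = rk x" using rk[of "rk x"] by simp_all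
    have xg: "x = g (rk x)"
      by (rule chain_rk_inj[OF F'(1) insertI2[OF x] insertI2[OF subsetD[OF F'(2) *(1)]] *(2)[symmetric]])
    show "x \<in> ?F" by (subst xg) (rule *(1))
  qed
  then have "F' = ?F" if "F' \<in> chain_complex" "?F \<subseteq> F'" for F'
    using that by (intro equalityI)
  with ch show "?F \<in> facets chain_complex" unfolding facets_def by simp
  fix k assume k: "k \<le> rk U"
  then have "g k \<in> insert U ?F" using top by (cases "k = rk U") auto
  then show "flag ?F k = g k" using flag_eq[OF ch, of "g k"] rk[OF k] by auto
qed

text \<open>Let \<open>m\<close> be the highest rank where F and F' differ and \<open>b\<close> the
  next lower rank where they agree. A descent of F at a rank above \<open>b\<close> and up to
  \<open>m\<close> admits an exchange that gives a smaller word and removes a vertex outside F'.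
  Without a descent F is rising from \<open>b\<close> to \<open>Suc m\<close>, hence
  lexicographically first there, which contradicts the order of the keys.\<close>

theorem shellable_chain_complex: "shellable chain_complex"
proof (rule shellableI)
  let ?key = "\<lambda>F. map (\<lambda>j. lab (flag F (Suc j)) (flag F j)) (rev [0..<rk U])"
  show "finite (facets chain_complex)"
    by (rule finite_subset[of _ "Pow P"]) (auto simp: facets_def finite_P)
  fix F F' assume F: "F \<in> facets chain_complex" and F': "F' \<in> facets chain_complex" and ne: "F \<noteq> F'"
    and le: "?key F' \<le> ?key F"
  let ?n = "rk U"
  note f = flag_props[OF F] and f' = flag_props[OF F']
  let ?D = "{k. k < ?n \<and> flag F k \<noteq> flag F' k}"
  have "?D \<noteq> {}"
  proof
    assume "?D = {}"
    then have "flag F ` {..<?n} = flag F' ` {..<?n}" by (intro image_cong) auto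
    then show False using f(5) f'(5) ne by simp
  qed
  define m where "m = Max ?D"
  have "m \<in> ?D" using Max_in[of ?D] \<open>?D \<noteq> {}\<close> by (simp add: m_def)
  then have m: "m < ?n" "flag F m \<noteq> flag F' m" by auto
  have above: "flag F k = flag F' k" if "m < k" "k \<le> ?n" for k
  proof (rule ccontr)
    assume "flag F k \<noteq> flag F' k"
    then have "k \<in> ?D" using that f(1) f'(1) by (cases "k = ?n") auto
    then have "k \<le> m" unfolding m_def by (intro Max_ge) auto
    then show False using that by simp
  qed
  have notin: "flag F k \<notin> F'" if "k < ?n" "flag F k \<noteq> flag F' k" for k
    using that flag_eq[of F' "flag F k"] F' f(3)[of k] by (auto simp: facets_def)
  \<comment> \<open>Exchange of the member of rank \<open>j\<close>: the labels of all steps above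
    it are unchanged, so the word first changes at position \<open>j\<close>, whatever happens to
    the label of the step below.\<close>
  have smaller: "\<exists>v\<in>F. \<exists>F''\<in>facets chain_complex. ?key F'' < ?key F \<and> F' \<inter> F \<subseteq> F - {v} \<and> F - {v} \<subseteq> F''"
    if j: "j < ?n" "flag F j \<noteq> flag F' j"
      and B': "covers B' (flag F (Suc j))" "lab (flag F (Suc j)) B' < lab (flag F (Suc j)) (flag F j)"
        "\<And>i. j = Suc i \<Longrightarrow> flag F i \<subset> B'" for j B'
  proof -
    define g where "g = (flag F)(j := B')"
    have rkB': "rk B' = j" using B'(1) f(3)[of "Suc j"] j(1) by (auto simp: covers_def)
    have gP: "g k \<in> P" if "k < ?n" for k
      using that B'(1) f(4)[of k] by (auto simp: g_def covers_def)
    have rkg: "rk (g k) = k" if "k \<le> ?n" for k using that rkB' f(3) by (auto simp: g_def)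
    have gtop: "g ?n = U" using f(1) j(1) by (auto simp: g_def)
    have cov: "covers (g k) (g (Suc k))" if "k < ?n" for k
    proof -
      have "g k \<subset> g (Suc k)"
        using that B' f(4)[of k] by (auto simp: g_def covers_def)
      moreover have "g (Suc k) \<in> insert U P" using gP[of "Suc k"] gtop that
        by (cases "Suc k = ?n") auto
      ultimately show ?thesis using gP[OF that] rkg[of k] rkg[of "Suc k"] that
        by (auto simp: covers_def)
    qed
    note fg = facet_of_flag[of g, OF gtop cov rkg]
    let ?F'' = "g ` {..<?n}"
    have F'': "?F'' \<in> facets chain_complex" using fg(1) by simp
    have flF: "flag ?F'' k = g k" if "k \<le> ?n" for k using fg(2) that by simp
    have "?key ?F'' < ?key F"
    proof (rule map_rev_upt_less[of j])
      fix i assume "j < i" "i < ?n"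
      then show "lab (flag ?F'' (Suc i)) (flag ?F'' i) = lab (flag F (Suc i)) (flag F i)"
        using flF by (auto simp: g_def)
    next
      show "lab (flag ?F'' (Suc j)) (flag ?F'' j) < lab (flag F (Suc j)) (flag F j)"
        using flF[of j] flF[of "Suc j"] j(1) B'(2) by (auto simp: g_def)
    qed (rule j(1))
    moreover have "F - {flag F j} \<subseteq> ?F''"
    proof
      fix x assume "x \<in> F - {flag F j}"
      then obtain k where "x = flag F k" "k < ?n" "k \<noteq> j" using f(5)[symmetric] by blast
      then show "x \<in> ?F''" by (auto simp: g_def)
    qed
    ultimately show ?thesis using F'' notin[OF j] f(2)[OF j(1)]
      by (intro bexI[of _ "flag F j"] bexI[of _ ?F'']) auto
  qed
  have not_less: False if "lab (flag F (Suc m)) (flag F m) < lab (flag F' (Suc m)) (flag F' m)"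
  proof -
    have "?key F < ?key F'"
      by (rule map_rev_upt_less[of m]) (use m above that in auto)
    then show False using le by simp
  qed
  have cov': "covers (flag F' m) (flag F (Suc m))" using f'(4)[of m] above[of "Suc m"] m(1) by auto
  show "\<exists>v\<in>F. \<exists>F''\<in>facets chain_complex. ?key F'' < ?key F \<and> F' \<inter> F \<subseteq> F - {v} \<and> F - {v} \<subseteq> F''"
  proof (cases "\<exists>b<m. flag F b = flag F' b")
    case True
    let ?B = "{b. b < m \<and> flag F b = flag F' b}"
    define b where "b = Max ?B"
    have "b \<in> ?B" using Max_in[of ?B] True by (auto simp: b_def)
    then have b: "b < m" "flag F b = flag F' b" by auto
    have diff: "flag F j \<noteq> flag F' j" if "b < j" "j \<le> m" for j
    proof
      assume eq: "flag F j = flag F' j"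
      then have "j \<in> ?B" using that m(2) by (cases "j = m") auto
      then have "j \<le> b" unfolding b_def by (intro Max_ge) auto
      then show False using that by simp
    qed
    show ?thesis
    proof (cases "\<exists>j. b \<le> j \<and> j < m \<and>
        lab (flag F (Suc j)) (flag F j) \<le> lab (flag F (Suc (Suc j))) (flag F (Suc j))")
      case True
      then obtain j where j: "b \<le> j" "j < m"
        "lab (flag F (Suc j)) (flag F j) \<le> lab (flag F (Suc (Suc j))) (flag F (Suc j))" by auto
      then obtain B' where "covers B' (flag F (Suc (Suc j)))" "flag F j \<subset> B'"
        "lab (flag F (Suc (Suc j))) B' < lab (flag F (Suc (Suc j))) (flag F (Suc j))"
        using descent[OF f(4)[of "Suc j"] f(4)[of j]] m(1) by auto
      then show ?thesis using smaller[of "Suc j" B'] diff[of "Suc j"] j m(1) by auto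
    next
      case False
      have sub: "flag F b \<subset> flag F' m"
      proof -
        have F'c: "F' \<in> chain_complex" using F' by (auto simp: facets_def)
        have "flag F' b \<in> insert U F'" "flag F' m \<in> insert U F'" using f'(2) b m by auto
        then have "flag F' b \<subseteq> flag F' m"
          using chain_rk_le[OF F'c] f'(3)[of b] f'(3)[of m] b m by auto
        moreover have "flag F' b \<noteq> flag F' m" using f'(3)[of b] f'(3)[of m] b m by auto
        ultimately show ?thesis using b by auto
      qed
      have "lab (flag F (Suc m)) (flag F m) < lab (flag F (Suc m)) (flag F' m)"
        by (rule rising[OF b(1), of "flag F"])
          (use False cov' sub m f(4) in \<open>auto simp: not_le\<close>)
      then show ?thesis using not_less above[of "Suc m"] m(1) by auto
    qed
  next
    \<comment> \<open>Nothing is shared below \<open>m\<close>, so the interval reaches down to the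
      missing bottom, whose step has label 0.\<close>
    case no_b: False
    have diff: "flag F j \<noteq> flag F' j" if "j \<le> m" for j
      using no_b m(2) that by (cases "j = m") auto
    show ?thesis
    proof (cases "\<exists>j<m. lab (flag F (Suc j)) (flag F j) \<le> lab (flag F (Suc (Suc j))) (flag F (Suc j))")
      case True
      then obtain j where j: "j < m"
        "lab (flag F (Suc j)) (flag F j) \<le> lab (flag F (Suc (Suc j))) (flag F (Suc j))" by auto
      then obtain B' where "covers B' (flag F (Suc (Suc j)))" "flag F j \<subset> B'"
        "lab (flag F (Suc (Suc j))) B' < lab (flag F (Suc (Suc j))) (flag F (Suc j))"
        using descent[OF f(4)[of "Suc j"] f(4)[of j]] m(1) by auto
      then show ?thesis using smaller[of "Suc j" B'] diff[of "Suc j"] j m(1) by auto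
    next
      case False
      show ?thesis
      proof (cases "0 \<le> lab (flag F (Suc 0)) (flag F 0)")
        case True
        then obtain B' where "covers B' (flag F (Suc 0))"
          "lab (flag F (Suc 0)) B' < lab (flag F (Suc 0)) (flag F 0)"
          using descent_bot[OF f(4)[of 0]] f(3)[of 0] m(1) by auto
        then show ?thesis using smaller[of 0 B'] diff[of 0] m(1) by auto
      next
        case neg: False
        have "lab (flag F (Suc m)) (flag F m) < lab (flag F (Suc m)) (flag F' m)"
          by (rule rising_bot[of m "flag F"])
            (use False neg cov' m f(3,4) in \<open>auto simp: not_le\<close>)
        then show ?thesis using not_less above[of "Suc m"] m(1) by auto
      qed
    qed
  qed
qed

end

section \<open>Finite groups\<close>

locale finite_group = group G for G (structure) +
  assumes fin: "finite (carrier G)"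
begin

lemma mult_inv_cancel: "x \<in> carrier G \<Longrightarrow> y \<in> carrier G \<Longrightarrow> x \<otimes> (inv x \<otimes> y) = y"
  by (simp add: m_assoc[symmetric])

lemma inv_mult_cancel: "x \<in> carrier G \<Longrightarrow> y \<in> carrier G \<Longrightarrow> inv x \<otimes> (x \<otimes> y) = y"
  by (simp add: m_assoc[symmetric])

lemmas word_simps = m_assoc inv_mult_group mult_inv_cancel inv_mult_cancel

lemma sub_finite: "subgroup H G \<Longrightarrow> finite H"
  using fin subgroup.subset finite_subset by blast

lemma sub_card_pos: "subgroup H G \<Longrightarrow> 0 < card H"
  using sub_finite subgroup.one_closed card_gt_0_iff by blast

lemma sub_group: "subgroup H G \<Longrightarrow> finite_group (G\<lparr>carrier := H\<rparr>)"
  by (simp add: finite_group_def finite_group_axioms_def subgroup_imp_group sub_finite)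

lemma sub_iff:
  assumes H: "subgroup H G"
  shows "subgroup K (G\<lparr>carrier := H\<rparr>) \<longleftrightarrow> subgroup K G \<and> K \<subseteq> H"
proof
  assume K: "subgroup K (G\<lparr>carrier := H\<rparr>)"
  show "subgroup K G \<and> K \<subseteq> H" using incl_subgroup[OF H K] subgroup.subset[OF K] by simp
next
  assume "subgroup K G \<and> K \<subseteq> H"
  then show "subgroup K (G\<lparr>carrier := H\<rparr>)" using subgroup_incl[OF _ H] by simp
qed

lemma sub_card_less: "subgroup H G \<Longrightarrow> H \<noteq> carrier G \<Longrightarrow> card H < card (carrier G)"
  using psubset_card_mono[OF fin, of H] subgroup.subset by blast

lemma card_dvd_carrier: "subgroup H G \<Longrightarrow> card H dvd card (carrier G)"
  using lagrange[of H] by (metis dvd_triv_right order_def)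

lemma card_dvd:
  assumes "subgroup H G" "subgroup K G" "K \<subseteq> H" shows "card K dvd card H"
proof -
  interpret H: finite_group "G\<lparr>carrier := H\<rparr>" by (rule sub_group[OF assms(1)])
  show ?thesis using H.card_dvd_carrier[of K] sub_iff[OF assms(1)] assms by simp
qed

lemma sub_eqI:
  assumes "subgroup H G" "subgroup K G" "K \<subseteq> H" "card H \<le> card K" shows "K = H"
  using card_subset_eq[OF sub_finite[OF assms(1)] assms(3)] card_mono[OF sub_finite[OF assms(1)] assms(3)]
    assms(4) by simp

lemma normal_iff:
  "N \<lhd> G \<longleftrightarrow> subgroup N G \<and> (\<forall>x\<in>carrier G. \<forall>h\<in>N. x \<otimes> h \<otimes> inv x \<in> N)"
  by (rule normal_inv_iff)

lemma normal_sub_iff: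
  assumes "subgroup H G"
  shows "N \<lhd> (G\<lparr>carrier := H\<rparr>) \<longleftrightarrow>
    subgroup N G \<and> N \<subseteq> H \<and> (\<forall>x\<in>H. \<forall>h\<in>N. x \<otimes> h \<otimes> inv x \<in> N)"
proof -
  interpret H: finite_group "G\<lparr>carrier := H\<rparr>" by (rule sub_group[OF assms(1)])
  show ?thesis unfolding H.normal_iff sub_iff[OF assms]
    using m_inv_consistent[OF assms] by auto
qed

lemma conj_closed:
  "N \<lhd> G \<Longrightarrow> x \<in> carrier G \<Longrightarrow> h \<in> N \<Longrightarrow> x \<otimes> h \<otimes> inv x \<in> N"
  using normal_iff by auto

lemma conj_closed':
  assumes "N \<lhd> G" "x \<in> carrier G" "h \<in> N" shows "inv x \<otimes> h \<otimes> x \<in> N"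
  using conj_closed[OF assms(1), of "inv x" h] assms by auto

lemma set_mult_iff: "x \<in> H <#> K \<longleftrightarrow> (\<exists>h\<in>H. \<exists>k\<in>K. x = h \<otimes> k)"
  by (auto simp: set_mult_def)

lemma mult_mem: "h \<in> H \<Longrightarrow> k \<in> K \<Longrightarrow> h \<otimes> k \<in> H <#> K"
  by (auto simp: set_mult_def)

lemma normal_mult_subgroup: "N \<lhd> G \<Longrightarrow> subgroup H G \<Longrightarrow> subgroup (N <#> H) G"
  by (rule mult_norm_subgroup)

lemma normal_mult_commute: "N \<lhd> G \<Longrightarrow> subgroup H G \<Longrightarrow> N <#> H = H <#> N"
  using commut_normal by auto

lemma sub_set_mult1: "subgroup K G \<Longrightarrow> H \<subseteq> carrier G \<Longrightarrow> H \<subseteq> H <#> K"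
  using subgroup.one_closed mult_mem[of _ H \<one> K] by fastforce

lemma sub_set_mult2: "subgroup H G \<Longrightarrow> K \<subseteq> carrier G \<Longrightarrow> K \<subseteq> H <#> K"
  using subgroup.one_closed mult_mem[of \<one> H _ K] by fastforce

lemma set_mult_least: "subgroup L G \<Longrightarrow> H \<subseteq> L \<Longrightarrow> K \<subseteq> L \<Longrightarrow> H <#> K \<subseteq> L"
  by (auto simp: set_mult_def subgroup.m_closed subset_iff)

text \<open>The fibre of multiplication H x K \<rightarrow> HK over h k consists of the pairs (h t,
  t^-1 k) with t \<in> H \<inter> K. The product HK is only a set here.\<close>

lemma card_set_mult:
  assumes H: "subgroup H G" and K: "subgroup K G"
  shows "card (H <#> K) * card (H \<inter> K) = card H * card K"
proof -
  let ?f = "\<lambda>z. {q \<in> H \<times> K. fst q \<otimes> snd q = z}"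
  have HK: "\<And>h. h \<in> H \<Longrightarrow> h \<in> carrier G" "\<And>k. k \<in> K \<Longrightarrow> k \<in> carrier G"
    using H K subgroup.mem_carrier by metis+
  have finHK: "finite (H <#> K)" "finite (H \<times> K)"
    using sub_finite[OF H] sub_finite[OF K] set_mult_closed[of H K] HK finite_subset[OF _ fin] by auto
  have fib: "card (?f z) = card (H \<inter> K)" if "z \<in> H <#> K" for z
  proof -
    obtain h k where hk: "h \<in> H" "k \<in> K" "z = h \<otimes> k" using \<open>z \<in> H <#> K\<close> set_mult_iff by auto
    have "bij_betw (\<lambda>t. (h \<otimes> t, inv t \<otimes> k)) (H \<inter> K) (?f z)"
    proof (rule bij_betwI[where g = "\<lambda>q. inv h \<otimes> fst q"])
      show "(\<lambda>t. (h \<otimes> t, inv t \<otimes> k)) \<in> H \<inter> K \<rightarrow> ?f z"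
        using hk HK H K by (auto simp: subgroup.m_closed subgroup.m_inv_closed word_simps)
      show "(\<lambda>q. inv h \<otimes> fst q) \<in> ?f z \<rightarrow> H \<inter> K"
      proof
        fix q assume q: "q \<in> ?f z"
        then have q': "fst q \<in> H" "snd q \<in> K" "fst q \<otimes> snd q = h \<otimes> k" using hk by auto
        have c: "fst q \<in> carrier G" "snd q \<in> carrier G" "h \<in> carrier G" "k \<in> carrier G"
          using HK hk q' by auto
        have "inv h \<otimes> fst q = inv h \<otimes> (fst q \<otimes> snd q) \<otimes> inv (snd q)"
          using c by (simp add: word_simps)
        then have "inv h \<otimes> fst q = k \<otimes> inv (snd q)" unfolding q'(3) using c by (simp add: word_simps)
        moreover have "k \<otimes> inv (snd q) \<in> K" using K q' hk subgroup.m_closed subgroup.m_inv_closed by metis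
        moreover have "inv h \<otimes> fst q \<in> H" using H q' hk subgroup.m_closed subgroup.m_inv_closed by metis
        ultimately show "inv h \<otimes> fst q \<in> H \<inter> K" by simp
      qed
      fix t assume "t \<in> H \<inter> K"
      then show "inv h \<otimes> fst (h \<otimes> t, inv t \<otimes> k) = t" using hk HK by (simp add: m_assoc[symmetric])
    next
      fix q assume q: "q \<in> ?f z"
      then have q': "fst q \<in> H" "snd q \<in> K" "fst q \<otimes> snd q = h \<otimes> k" using hk by auto
      then have c: "fst q \<in> carrier G" "snd q \<in> carrier G" "h \<in> carrier G" "k \<in> carrier G"
        using HK hk by auto
      have "inv (inv h \<otimes> fst q) \<otimes> k = inv (fst q) \<otimes> (h \<otimes> k)" using c by (simp add: word_simps)
      then have "h \<otimes> (inv h \<otimes> fst q) = fst q" "inv (inv h \<otimes> fst q) \<otimes> k = snd q"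
        unfolding q'(3)[symmetric] using c by (simp_all add: word_simps)
      then show "(h \<otimes> (inv h \<otimes> fst q), inv (inv h \<otimes> fst q) \<otimes> k) = q" by (metis prod.collapse)
    qed
    then show ?thesis by (rule bij_betw_same_card[symmetric])
  qed
  have "card (\<Union>z\<in>H <#> K. ?f z) = (\<Sum>z\<in>H <#> K. card (?f z))"
    using finHK(2) by (intro card_UN_disjoint[OF finHK(1)]) (auto intro: finite_subset)
  moreover have "(\<Union>z\<in>H <#> K. ?f z) = H \<times> K" by (force simp: set_mult_def)
  ultimately show ?thesis using fib by (simp add: card_cartesian_product)
qed

definition maximal_subgroup :: "'a set \<Rightarrow> bool" where
  "maximal_subgroup M \<longleftrightarrow> subgroup M G \<and> M \<noteq> carrier G \<and>
    (\<forall>H. subgroup H G \<longrightarrow> M \<subseteq> H \<longrightarrow> H = M \<or> H = carrier G)"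

lemma maximal_subgroup_ex:
  assumes "subgroup H G" "H \<noteq> carrier G"
  obtains M where "maximal_subgroup M" "H \<subseteq> M"
proof -
  define S where "S = {M. subgroup M G \<and> M \<noteq> carrier G \<and> H \<subseteq> M}"
  have "S \<subseteq> Pow (carrier G)" using subgroup.subset by (auto simp: S_def)
  then have "finite S" using fin by (simp add: finite_subset)
  moreover have "H \<in> S" using assms by (simp add: S_def)
  ultimately obtain M where M: "M \<in> S" "\<forall>L\<in>S. M \<subseteq> L \<longrightarrow> M = L"
    using finite_has_maximal2[of S H] by blast
  have "maximal_subgroup M" unfolding maximal_subgroup_def
  proof (intro conjI allI impI)
    fix L assume "subgroup L G" "M \<subseteq> L"
    then show "L = M \<or> L = carrier G" using M by (cases "L = carrier G") (auto simp: S_def)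
  qed (use M in \<open>auto simp: S_def\<close>)
  then show thesis using that M(1) by (simp add: S_def)
qed

text \<open>The case of exponent 1 in Sylow's theorem, which provides subgroups of every prime power
  order dividing the order of the group.\<close>

lemma cauchy:
  assumes "prime p" "p dvd card (carrier G)"
  obtains x where "x \<in> carrier G" "x \<noteq> \<one>" "x [^] p = \<one>" "card (generate G {x}) = p"
proof -
  obtain m where "order G = p ^ 1 * m" using assms(2) by (auto simp: order_def)
  then obtain P where P: "subgroup P G" "card P = p"
    using sylow_thm[OF assms(1) is_group _ fin, of 1 m] by auto
  have "P \<noteq> {\<one>}" using P(2) prime_gt_1_nat[OF assms(1)] by auto
  then obtain x where x: "x \<in> P" "x \<noteq> \<one>" using subgroup.one_closed[OF P(1)] by auto
  then have xc: "x \<in> carrier G" using P(1) subgroup.mem_carrier by metis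
  have gen: "subgroup (generate G {x}) G" "generate G {x} \<subseteq> P"
    using generate_is_subgroup generate_subgroup_incl[OF _ P(1)] xc x by auto
  have "card (generate G {x}) dvd p" using card_dvd[OF P(1) gen] P(2) by simp
  moreover have "card (generate G {x}) \<noteq> 1"
  proof
    assume "card (generate G {x}) = 1"
    then obtain y where "generate G {x} = {y}" using card_1_singletonE by auto
    then show False using generate.incl[of x "{x}" G] generate.one[of G "{x}"] x(2) by auto
  qed
  ultimately have c: "card (generate G {x}) = p" using assms(1) prime_nat_iff by blast
  have "x [^] p = \<one>" using generate_pow_card[OF xc] c pow_ord_eq_1[OF xc] by simp
  then show thesis using that xc x(2) c by blast
qed

lemma card_generate_prime:
  assumes "x \<in> carrier G" "x \<noteq> \<one>" "x [^] p = \<one>" "prime p"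
  shows "card (generate G {x}) = p"
proof -
  have "ord x dvd p" using pow_eq_id[OF assms(1)] assms(3) by simp
  moreover have "ord x \<noteq> 1" using ord_eq_1[OF assms(1)] assms(2) by simp
  ultimately show ?thesis using generate_pow_card[OF assms(1)] assms(4) prime_nat_iff by metis
qed

lemma generate_powers:
  assumes "x \<in> carrier G" shows "generate G {x} = {x [^] k | k. k \<in> (UNIV::nat set)}"
  using generate_pow_on_finite_carrier[OF fin assms] by simp

lemma generate_singleton_subgroup: "subgroup (generate G {x}) G" if "x \<in> carrier G"
  using generate_is_subgroup that by auto

lemma sub_generate: "subgroup H G \<Longrightarrow> x \<in> H \<Longrightarrow> generate G {x} \<subseteq> H"
  using generate_subgroup_incl by auto

lemma prime_subgroup_eq_generate:
  assumes "subgroup W G" "prime (card W)" "w \<in> W" "w \<noteq> \<one>" shows "W = generate G {w}"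
proof -
  have w: "w \<in> carrier G" using assms subgroup.mem_carrier by metis
  have "generate G {w} \<subseteq> W" using sub_generate assms by auto
  have "card (generate G {w}) dvd card W"
    using card_dvd[OF assms(1) generate_singleton_subgroup[OF w] sub_generate[OF assms(1,3)]] .
  moreover have "card (generate G {w}) \<noteq> 1"
    using generate_pow_card[OF w] ord_eq_1[OF w] assms(4) by simp
  ultimately have "card (generate G {w}) = card W" using assms(2) prime_nat_iff by metis
  then show ?thesis using card_subset_eq[OF sub_finite[OF assms(1)] \<open>generate G {w} \<subseteq> W\<close>] by simp
qed

lemma sub_pow_closed: "subgroup H G \<Longrightarrow> x \<in> H \<Longrightarrow> x [^] (n::nat) \<in> H"
  by (metis subgroup_imp_group group.is_monoid monoid.nat_pow_closed nat_pow_consistent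
      partial_object.simps(1) partial_object.update_convs(1) monoid.surjective
      partial_object.select_convs(1) sub_group finite_group_def)

end

section \<open>Fixed points of p-groups and conjugation into subgroups of index prime to p\<close>

lemma p_action_fixed_point:
  fixes act :: "'q \<Rightarrow> 'e \<Rightarrow> 'e"
  assumes "finite_group Q" "prime p" "card (carrier Q) = p ^ k" "finite E"
    and cl: "\<And>g e. g \<in> carrier Q \<Longrightarrow> e \<in> E \<Longrightarrow> act g e \<in> E"
    and one: "\<And>e. e \<in> E \<Longrightarrow> act \<one>\<^bsub>Q\<^esub> e = e"
    and mul: "\<And>g h e. g \<in> carrier Q \<Longrightarrow> h \<in> carrier Q \<Longrightarrow> e \<in> E \<Longrightarrow> act (g \<otimes>\<^bsub>Q\<^esub> h) e = act g (act h e)"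
    and nd: "\<not> p dvd card E"
  obtains e where "e \<in> E" "\<And>g. g \<in> carrier Q \<Longrightarrow> act g e = e"
proof -
  interpret Q: finite_group Q by fact
  let ?\<phi> = "\<lambda>g. \<lambda>e\<in>E. act g e"
  have bij: "?\<phi> g \<in> Bij E" if g: "g \<in> carrier Q" for g
  proof -
    have "bij_betw (act g) E E"
      by (rule bij_betwI[where g = "act (inv\<^bsub>Q\<^esub> g)"])
        (use g cl one mul[symmetric] in \<open>auto simp: Q.l_inv Q.r_inv\<close>)
    then show ?thesis by (auto simp: Bij_def cong: bij_betw_cong)
  qed
  have ga: "group_action Q E ?\<phi>"
    unfolding group_action_def group_hom_def group_hom_axioms_def
  proof (intro conjI)
    show "group Q" by (rule Q.is_group)
    show "group (BijGroup E)" by (rule group_BijGroup)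
    show "?\<phi> \<in> hom Q (BijGroup E)"
    proof (rule homI)
      fix g assume "g \<in> carrier Q" then show "?\<phi> g \<in> carrier (BijGroup E)"
        using bij by (auto simp: BijGroup_def)
    next
      fix g h assume "g \<in> carrier Q" "h \<in> carrier Q"
      then show "?\<phi> (g \<otimes>\<^bsub>Q\<^esub> h) = ?\<phi> g \<otimes>\<^bsub>BijGroup E\<^esub> ?\<phi> h"
        using bij mul cl by (auto simp: BijGroup_def compose_def fun_eq_iff)
    qed
  qed
  interpret group_action Q E ?\<phi> by (rule ga)
  \<comment> \<open>The orbits partition E, whose size is not divisible by p. An orbit of length
    prime to p has length 1, since orbit lengths divide p^k.\<close>
  have "\<exists>orb\<in>orbits Q E ?\<phi>. \<not> p dvd card orb"
  proof (rule ccontr)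
    assume "\<not> ?thesis"
    then have "p dvd (\<Sum>orb\<in>orbits Q E ?\<phi>. card orb)" by (intro dvd_sum) auto
    moreover have "(\<Sum>orb\<in>orbits Q E ?\<phi>. card orb) = card E"
    proof -
      have "card (\<Union>(orbits Q E ?\<phi>)) = (\<Sum>orb\<in>orbits Q E ?\<phi>. card orb)"
      proof (rule card_Union_disjoint)
        show "pairwise disjnt (orbits Q E ?\<phi>)"
          using disjoint_union by (auto simp: pairwise_def disjnt_def)
        show "\<And>A. A \<in> orbits Q E ?\<phi> \<Longrightarrow> finite A"
          using orbits_coverture assms(4) by (metis Union_upper finite_subset)
      qed
      then show ?thesis using orbits_coverture by simp
    qed
    ultimately show False using nd by simp
  qed
  then obtain e where e: "e \<in> E" "\<not> p dvd card (orbit Q ?\<phi> e)" by (auto simp: orbits_def)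
  have "card (orbit Q ?\<phi> e) * card (stabilizer Q ?\<phi> e) = p ^ k"
    using orbit_stabilizer_theorem[OF e(1)] assms(3) by (simp add: order_def)
  then have "card (orbit Q ?\<phi> e) dvd p ^ k" by (metis dvd_triv_left)
  then obtain j where "card (orbit Q ?\<phi> e) = p ^ j" using divides_primepow_nat[OF assms(2)] by blast
  then have "card (orbit Q ?\<phi> e) = 1" using e(2) by (cases j) auto
  then obtain y where y: "orbit Q ?\<phi> e = {y}" using card_1_singletonE by blast
  have "act g e = y" if "g \<in> carrier Q" for g
  proof -
    have "?\<phi> g e \<in> orbit Q ?\<phi> e" using that by (auto simp: orbit_def)
    then show ?thesis using y e(1) by simp
  qed
  then have "act g e = e" if "g \<in> carrier Q" for g using one[OF e(1)] that Q.one_closed by metis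
  then show thesis using that e(1) by blast
qed

context finite_group begin

text \<open>Q acts by translation on the cosets of P, whose number is prime to p; the inverse in
  \<open>e #> inv g\<close> makes right translation a left action. A fixed coset P t means t Q t^-1
  \<subseteq> P.\<close>

lemma sylow_contains:
  assumes P: "subgroup P G" "\<not> p dvd card (rcosets P)" and Q: "subgroup Q G" "card Q = p ^ k" "prime p"
  obtains t where "t \<in> carrier G" "\<And>q. q \<in> Q \<Longrightarrow> t \<otimes> q \<otimes> inv t \<in> P"
proof -
  have Qc: "\<And>q. q \<in> Q \<Longrightarrow> q \<in> carrier G" using Q(1) subgroup.mem_carrier by metis
  have sub: "\<And>e. e \<in> rcosets P \<Longrightarrow> e \<subseteq> carrier G" using rcosets_subset_PowG[OF P(1)] by auto
  have inv_in: "\<And>q. q \<in> Q \<Longrightarrow> inv q \<in> Q" using Q(1) subgroup.m_inv_closed by metis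
  obtain e where e: "e \<in> rcosets P" "\<And>g. g \<in> Q \<Longrightarrow> e #> inv g = e"
  proof (rule p_action_fixed_point[of "G\<lparr>carrier := Q\<rparr>" p k "rcosets P" "\<lambda>g e. e #> inv g"])
    show "finite_group (G\<lparr>carrier := Q\<rparr>)" by (rule sub_group[OF Q(1)])
    show "finite (rcosets P)" 
      using fin rcosets_subset_PowG[OF P(1)] finite_subset by blast
  next
    fix g e assume g: "g \<in> carrier (G\<lparr>carrier := Q\<rparr>)" and e: "e \<in> rcosets P"
    obtain t where "t \<in> carrier G" "e = P #> t" using e by (auto simp: RCOSETS_def)
    then show "e #> inv g \<in> rcosets P"
      using g Qc coset_mult_assoc[of P t "inv g"] subgroup.subset[OF P(1)] rcosetsI by simp
  next
    fix g h e assume gh: "g \<in> carrier (G\<lparr>carrier := Q\<rparr>)" "h \<in> carrier (G\<lparr>carrier := Q\<rparr>)" and e: "e \<in> rcosets P"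
    then show "e #> inv (g \<otimes>\<^bsub>G\<lparr>carrier := Q\<rparr>\<^esub> h) = (e #> inv h) #> inv g"
      using coset_mult_assoc[OF sub[OF e], of "inv h" "inv g"] Qc by (simp add: inv_mult_group)
  qed (use Q P sub in \<open>auto simp: coset_mult_one\<close>)
  obtain t where t: "t \<in> carrier G" "e = P #> t" using e(1) by (auto simp: RCOSETS_def)
  have "t \<otimes> q \<otimes> inv t \<in> P" if q: "q \<in> Q" for q
  proof -
    have "e #> q = e" using e(2)[OF inv_in[OF q]] Qc[OF q] by simp
    then have "P #> (t \<otimes> q) = P #> t"
      using coset_mult_assoc[of P t q] subgroup.subset[OF P(1)] t Qc[OF q] by simp
    then have "t \<otimes> q \<in> P #> t" using rcos_self[OF _ P(1), of "t \<otimes> q"] t Qc[OF q] by simp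
    then show ?thesis using subgroup.rcos_module_imp[OF P(1) is_group t(1), of "t \<otimes> q"] by simp
  qed
  then show thesis using that t(1) by blast
qed

end

section \<open>Corestriction and complements\<close>

lemma (in comm_group) hom_finprod_self:
  assumes "h \<in> hom G G" "finite I" "f \<in> I \<rightarrow> carrier G"
  shows "h (finprod G f I) = finprod G (\<lambda>i. h (f i)) I"
  using assms(2,3)
proof (induction I rule: finite_induct)
  case empty
  then show ?case using hom_one[OF assms(1) is_group is_group] by simp
next
  case (insert i I)
  then have c: "f \<in> I \<rightarrow> carrier G" "f i \<in> carrier G" by auto
  have hc: "(\<lambda>i. h (f i)) \<in> I \<rightarrow> carrier G" "h (f i) \<in> carrier G"
    using c hom_in_carrier[OF assms(1)] by auto
  show ?case using insert c hc hom_mult[OF assms(1) c(2) finprod_closed[OF c(1)]] by simp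
qed

context finite_group begin

lemma rcoset_closed:
  assumes "subgroup P G" "c \<in> rcosets P" "g \<in> carrier G" shows "c #> g \<in> rcosets P"
proof -
  obtain t where "t \<in> carrier G" "c = P #> t" using assms(2) by (auto simp: RCOSETS_def)
  then show ?thesis using assms(3) coset_mult_assoc[of P t g] subgroup.subset[OF assms(1)] rcosetsI by simp
qed

lemma rcoset_sub: "subgroup P G \<Longrightarrow> c \<in> rcosets P \<Longrightarrow> c \<subseteq> carrier G"
  using rcosets_subset_PowG by auto

lemma rcoset_mult: "subgroup P G \<Longrightarrow> c \<in> rcosets P \<Longrightarrow> g \<in> carrier G \<Longrightarrow> h \<in> carrier G \<Longrightarrow>
    (c #> g) #> h = c #> (g \<otimes> h)"
  using coset_mult_assoc rcoset_sub by simp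

lemma rcosets_fin: "subgroup P G \<Longrightarrow> finite (rcosets P)"
  using fin rcosets_subset_PowG finite_subset by blast

lemma rcoset_diff:
  assumes P: "subgroup P G" and c: "c \<in> rcosets P" and x: "x \<in> c" "y \<in> c"
  shows "x \<otimes> inv y \<in> P"
proof -
  obtain t where t: "t \<in> carrier G" "c = P #> t" using c by (auto simp: RCOSETS_def)
  then obtain p q where pq: "p \<in> P" "q \<in> P" "x = p \<otimes> t" "y = q \<otimes> t" using x by (auto simp: r_coset_def)
  then have "p \<in> carrier G" "q \<in> carrier G" using P subgroup.mem_carrier by metis+
  then have "x \<otimes> inv y = p \<otimes> inv q" using pq t by (simp add: word_simps)
  then show ?thesis using pq P subgroup.m_closed subgroup.m_inv_closed by metis
qed

lemma rcoset_mem_mult: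
  "subgroup P G \<Longrightarrow> c \<in> rcosets P \<Longrightarrow> x \<in> c \<Longrightarrow> g \<in> carrier G \<Longrightarrow> x \<otimes> g \<in> c #> g"
  by (auto simp: r_coset_def)

lemma section_ex:
  assumes "subgroup P G" obtains \<sigma> where "\<And>c. c \<in> rcosets P \<Longrightarrow> \<sigma> c \<in> c"
    "\<And>c. c \<in> rcosets P \<Longrightarrow> \<sigma> c \<in> carrier G"
proof -
  have ne: "c \<noteq> {}" if "c \<in> rcosets P" for c using subgroup.rcosets_non_empty[OF assms that] .
  define \<sigma> where "\<sigma> = (\<lambda>c. SOME y. y \<in> (c :: 'a set))"
  have "\<sigma> c \<in> c" if "c \<in> rcosets P" for c
    using ne[OF that] unfolding \<sigma>_def by (simp add: some_in_eq)
  then show thesis using that[of \<sigma>] rcoset_sub[OF assms] by blast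
qed

lemma rcosets_shift_bij:
  assumes P: "subgroup P G" and g: "g \<in> carrier G"
  shows "inj_on (\<lambda>c. c #> g) (rcosets P)" "(\<lambda>c. c #> g) ` (rcosets P) = rcosets P"
proof -
  have *: "(c #> g) #> inv g = c" "(c #> inv g) #> g = c" if "c \<in> rcosets P" for c
    using rcoset_mult[OF P that] g coset_mult_one rcoset_sub[OF P that] by simp_all
  show "inj_on (\<lambda>c. c #> g) (rcosets P)" 
    by (rule inj_on_inverseI[where g = "\<lambda>c. c #> inv g"]) (rule *(1))
  show "(\<lambda>c. c #> g) ` (rcosets P) = rcosets P"
  proof (intro equalityI subsetI)
    fix c assume "c \<in> (\<lambda>c. c #> g) ` (rcosets P)"
    then show "c \<in> rcosets P" using rcoset_closed[OF P _ g] by auto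
  next
    fix c assume c: "c \<in> rcosets P"
    have "c #> inv g \<in> rcosets P" using rcoset_closed[OF P c] g by simp
    then show "c \<in> (\<lambda>c. c #> g) ` (rcosets P)" using *(2)[OF c] by (metis imageI)
  qed
qed

text \<open>
  For a crossed homomorphism \<open>d\<close> from \<open>P\<close> to \<open>A\<close> and a choice \<open>\<sigma>\<close> of coset representatives of \<open>P\<close>, this is
  the corestriction to the whole group. The trivial action gives the transfer homomorphism.
\<close>

definition corestriction where
  "corestriction A P act d \<sigma> g =
    finprod A (\<lambda>c. act (\<sigma> (c #> g)) (d (\<sigma> c \<otimes> g \<otimes> inv (\<sigma> (c #> g))))) (rcosets P)"

text \<open>The factor at the coset c satisfies w(g h, c) = h.w(g, c) w(h, c g). In the product over
  all cosets the shift from c to c g only permutes the second family of factors. Note that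
  \<open>act\<close> is a right action.\<close>

lemma corestriction_crossed_hom:
  assumes P: "subgroup P G" and A: "comm_group A"
    and act: "\<And>g. g \<in> carrier G \<Longrightarrow> act g \<in> hom A A"
    and act_mult: "\<And>g h a. g \<in> carrier G \<Longrightarrow> h \<in> carrier G \<Longrightarrow> a \<in> carrier A \<Longrightarrow>
      act (g \<otimes> h) a = act h (act g a)"
    and d: "\<And>x. x \<in> P \<Longrightarrow> d x \<in> carrier A"
    and d_mult: "\<And>x y. x \<in> P \<Longrightarrow> y \<in> P \<Longrightarrow> d (x \<otimes> y) = act y (d x) \<otimes>\<^bsub>A\<^esub> d y"
    and sec: "\<And>c. c \<in> rcosets P \<Longrightarrow> \<sigma> c \<in> c"
  shows "\<And>g. g \<in> carrier G \<Longrightarrow> corestriction A P act d \<sigma> g \<in> carrier A"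
    "\<And>g h. g \<in> carrier G \<Longrightarrow> h \<in> carrier G \<Longrightarrow> corestriction A P act d \<sigma> (g \<otimes> h) =
      act h (corestriction A P act d \<sigma> g) \<otimes>\<^bsub>A\<^esub> corestriction A P act d \<sigma> h"
proof -
  interpret A: comm_group A by (rule A)
  define w where "w = (\<lambda>g c. act (\<sigma> (c #> g)) (d (\<sigma> c \<otimes> g \<otimes> inv (\<sigma> (c #> g)))))"
  have D: "corestriction A P act d \<sigma> g = finprod A (w g) (rcosets P)" for g
    by (simp add: corestriction_def w_def)
  have secG: "\<sigma> c \<in> carrier G" if "c \<in> rcosets P" for c using sec[OF that] rcoset_sub[OF P that] by auto
  have inP: "\<sigma> c \<otimes> g \<otimes> inv (\<sigma> (c #> g)) \<in> P" if "c \<in> rcosets P" "g \<in> carrier G" for c g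
    using rcoset_diff[OF P rcoset_closed[OF P that] rcoset_mem_mult[OF P that(1) sec[OF that(1)] that(2)]]
      sec rcoset_closed[OF P that] by simp
  have w: "w g c \<in> carrier A" if "c \<in> rcosets P" "g \<in> carrier G" for c g
    unfolding w_def using hom_in_carrier[OF act] secG rcoset_closed[OF P that] d inP[OF that] by simp
  show cl: "corestriction A P act d \<sigma> g \<in> carrier A" if "g \<in> carrier G" for g
    unfolding D using w that by (intro A.finprod_closed) auto
  fix g h assume g: "g \<in> carrier G" and h: "h \<in> carrier G"
  have step: "w (g \<otimes> h) c = act h (w g c) \<otimes>\<^bsub>A\<^esub> w h (c #> g)" if c: "c \<in> rcosets P" for c
  proof -
    let ?u = "\<sigma> c \<otimes> g \<otimes> inv (\<sigma> (c #> g))" and ?v = "\<sigma> (c #> g) \<otimes> h \<otimes> inv (\<sigma> (c #> (g \<otimes> h)))"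
    let ?s = "\<sigma> (c #> (g \<otimes> h))"
    have cg: "c #> g \<in> rcosets P" "c #> (g \<otimes> h) \<in> rcosets P" "(c #> g) #> h = c #> (g \<otimes> h)"
      using rcoset_closed[OF P c] g h rcoset_mult[OF P c g h] by auto
    have s: "\<sigma> c \<in> carrier G" "\<sigma> (c #> g) \<in> carrier G" "?s \<in> carrier G" using secG c cg by auto
    have uv: "?u \<in> P" "?v \<in> P" using inP[OF c g] inP[OF cg(1) h] cg(3) by auto
    then have uvG: "?u \<in> carrier G" "?v \<in> carrier G" using P subgroup.mem_carrier by metis+
    \<comment> \<open>The path from c to c g h is cut at c g.\<close>
    have "\<sigma> c \<otimes> (g \<otimes> h) \<otimes> inv ?s = ?u \<otimes> ?v" using s g h by (simp add: word_simps)
    then have "w (g \<otimes> h) c = act ?s (act ?v (d ?u) \<otimes>\<^bsub>A\<^esub> d ?v)"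
      unfolding w_def using d_mult[OF uv] by simp
    also have "\<dots> = act ?s (act ?v (d ?u)) \<otimes>\<^bsub>A\<^esub> act ?s (d ?v)"
      using hom_mult[OF act[OF s(3)]] hom_in_carrier[OF act[OF uvG(2)]] d uv by simp
    also have "act ?s (act ?v (d ?u)) = act (?v \<otimes> ?s) (d ?u)" using act_mult[OF uvG(2) s(3) d[OF uv(1)]] by simp
    also have "?v \<otimes> ?s = \<sigma> (c #> g) \<otimes> h" using s g h by (simp add: word_simps)
    also have "act (\<sigma> (c #> g) \<otimes> h) (d ?u) = act h (w g c)"
      unfolding w_def using act_mult[OF s(2) h d[OF uv(1)]] by simp
    also have "act ?s (d ?v) = w h (c #> g)" unfolding w_def using cg(3) by simp
    finally show ?thesis .
  qed
  have f: "(\<lambda>c. act h (w g c)) \<in> (rcosets P) \<rightarrow> carrier A" "(\<lambda>c. w h (c #> g)) \<in> (rcosets P) \<rightarrow> carrier A"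
    using hom_in_carrier[OF act[OF h]] w rcoset_closed[OF P] g h by auto
  have "finprod A (w (g \<otimes> h)) (rcosets P) = finprod A (\<lambda>c. act h (w g c) \<otimes>\<^bsub>A\<^esub> w h (c #> g)) (rcosets P)"
    using step f by (intro A.finprod_cong') auto
  also have "\<dots> = finprod A (\<lambda>c. act h (w g c)) (rcosets P) \<otimes>\<^bsub>A\<^esub> finprod A (\<lambda>c. w h (c #> g)) (rcosets P)"
    by (rule A.finprod_multf[OF f])
  also have "finprod A (\<lambda>c. act h (w g c)) (rcosets P) = act h (finprod A (w g) (rcosets P))"
    using A.hom_finprod_self[OF act[OF h] rcosets_fin[OF P], of "w g"] w g by auto
  also have "finprod A (\<lambda>c. w h (c #> g)) (rcosets P) = finprod A (w h) ((\<lambda>c. c #> g) ` (rcosets P))"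
    using rcosets_shift_bij[OF P g] w h by (intro A.finprod_reindex[symmetric]) auto
  also have "\<dots> = finprod A (w h) (rcosets P)" using rcosets_shift_bij[OF P g] by simp
  finally show "corestriction A P act d \<sigma> (g \<otimes> h) =
      act h (corestriction A P act d \<sigma> g) \<otimes>\<^bsub>A\<^esub> corestriction A P act d \<sigma> h" unfolding D .
qed

lemma sub_comm_group:
  assumes "subgroup A G" "\<And>x y. x \<in> A \<Longrightarrow> y \<in> A \<Longrightarrow> x \<otimes> y = y \<otimes> x"
  shows "comm_group (G\<lparr>carrier := A\<rparr>)"
  by (rule group.group_comm_groupI[OF subgroup_imp_group[OF assms(1)]]) (use assms(2) in simp)

lemma pow_coprime_bij:
  assumes x: "x \<in> carrier G" and c: "coprime n (m::nat)" and xm: "x [^] m = \<one>"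
  obtains k :: nat where "(x [^] k) [^] n = x" "(x [^] n) [^] k = x"
proof -
  have "\<exists>k. x [^] (n * k) = x"
  \<comment> \<open>Bezout needs a nonzero exponent; n = 0 is coprime to m only for m = 1.\<close>
  proof (cases "n = 0")
    case True
    then have "m = 1" using c by simp
    then show ?thesis using xm x True by (intro exI[of _ 0]) simp
  next
    case False
    then obtain k j where "n * k = m * j + 1" using bezout_nat[of n m] c by auto
    then have "x [^] (n * k) = (x [^] m) [^] j \<otimes> x" using x by (simp add: nat_pow_mult[symmetric] nat_pow_pow)
    then show ?thesis using xm x by (intro exI[of _ k]) simp
  qed
  then obtain k where "x [^] (n * k) = x" by auto
  then show thesis using that[of k] x by (simp add: nat_pow_pow mult.commute)
qed

text \<open>
  The complement is the zero set of the corestriction of the projection \<open>P \<rightarrow> A\<close> along \<open>B\<close>, which is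
  the power map with exponent \<open>|G : P|\<close> on \<open>A\<close>.
\<close>

theorem gaschuetz_complement:
  assumes A: "A \<lhd> G" and comm: "\<And>x y. x \<in> A \<Longrightarrow> y \<in> A \<Longrightarrow> x \<otimes> y = y \<otimes> x"
    and P: "subgroup P G" "A \<subseteq> P" and B: "subgroup B G" "B \<subseteq> P" "A \<inter> B = {\<one>}" "P \<subseteq> B <#> A"
    and cop: "coprime (card (rcosets P)) (card A)"
  obtains K where "subgroup K G" "A \<inter> K = {\<one>}" "A <#> K = carrier G"
proof -
  have As: "subgroup A G" using A normal_imp_subgroup by blast
  let ?A = "G\<lparr>carrier := A\<rparr>"
  interpret A: comm_group ?A by (rule sub_comm_group[OF As comm])
  have AG: "a \<in> carrier G" if "a \<in> A" for a using As that subgroup.mem_carrier by metis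
  have BG: "b \<in> carrier G" if "b \<in> B" for b using B that subgroup.mem_carrier by metis
  have PG: "b \<in> carrier G" if "b \<in> P" for b using P that subgroup.mem_carrier by metis
  define act where "act = (\<lambda>g a. inv g \<otimes> a \<otimes> g)"
  have actA: "act g a \<in> A" if "g \<in> carrier G" "a \<in> A" for g a
    using conj_closed'[OF A that] by (simp add: act_def)
  have act_triv: "act g a = a" if "g \<in> A" "a \<in> A" for g a
    using comm[OF that(2,1)] AG that by (simp add: act_def word_simps)
  have act: "act g \<in> hom ?A ?A" if "g \<in> carrier G" for g
    using that actA AG by (auto simp: hom_def) (simp add: act_def word_simps)
  have act_mult: "act (g \<otimes> h) a = act h (act g a)" if "g \<in> carrier G" "h \<in> carrier G" "a \<in> carrier ?A" for g h a
    using that AG by (simp add: act_def word_simps)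
  \<comment> \<open>The A-component in P = B A. It is the identity on A, and it is a crossed
    homomorphism for conjugation because A is abelian, so that only B-components act.\<close>
  define d where "d = (\<lambda>x. THE a. a \<in> A \<and> (\<exists>b\<in>B. x = b \<otimes> a))"
  have d_eq: "d (b \<otimes> a) = a" if "b \<in> B" "a \<in> A" for a b
    unfolding d_def
  proof (rule the_equality)
    fix a' assume "a' \<in> A \<and> (\<exists>b'\<in>B. b \<otimes> a = b' \<otimes> a')"
    then obtain b' where a': "a' \<in> A" "b' \<in> B" "b \<otimes> a = b' \<otimes> a'" by auto
    note c = AG[OF that(2)] BG[OF that(1)] AG[OF a'(1)] BG[OF a'(2)]
    have "inv b' \<otimes> b = inv b' \<otimes> (b \<otimes> a) \<otimes> inv a" using c by (simp add: word_simps)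
    then have e: "inv b' \<otimes> b = a' \<otimes> inv a" unfolding a'(3) using c by (simp add: word_simps)
    have "inv b' \<otimes> b \<in> B" using B a' that subgroup.m_closed subgroup.m_inv_closed by metis
    moreover have "a' \<otimes> inv a \<in> A" using As a' that subgroup.m_closed subgroup.m_inv_closed by metis
    ultimately have "a' \<otimes> inv a = \<one>" using e B(3) by auto
    then show "a' = a" using c by (metis inv_equality inv_inv inv_closed)
  qed (use that in auto)
  have P_dec: "\<exists>b\<in>B. \<exists>a\<in>A. x = b \<otimes> a" if "x \<in> P" for x using B(4) that set_mult_iff by auto
  have dA: "d x \<in> carrier ?A" if "x \<in> P" for x using P_dec[OF that] d_eq by auto
  have d_mult: "d (x \<otimes> y) = act y (d x) \<otimes>\<^bsub>?A\<^esub> d y" if xy: "x \<in> P" "y \<in> P" for x y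
  proof -
    obtain b a where x: "b \<in> B" "a \<in> A" "x = b \<otimes> a" using P_dec[OF xy(1)] by auto
    obtain b' a' where y: "b' \<in> B" "a' \<in> A" "y = b' \<otimes> a'" using P_dec[OF xy(2)] by auto
    note c = AG[OF x(2)] BG[OF x(1)] AG[OF y(2)] BG[OF y(1)]
    have "act y a = act a' (act b' a)" using act_mult[of b' a' a] y x c by simp
    also have "\<dots> = act b' a" using act_triv[OF y(2)] actA c x by simp
    finally have act_ya: "act y a = act b' a" .
    have "x \<otimes> y = (b \<otimes> b') \<otimes> (act b' a \<otimes> a')" using x y c by (simp add: act_def word_simps)
    moreover have "b \<otimes> b' \<in> B" "act b' a \<otimes> a' \<in> A"
      using subgroup.m_closed[OF B(1)] subgroup.m_closed[OF As] actA c x y by auto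
    ultimately have "d (x \<otimes> y) = act b' a \<otimes> a'" using d_eq by simp
    then show ?thesis using act_ya d_eq x y by simp
  qed
  obtain \<sigma> where sec: "\<And>c. c \<in> rcosets P \<Longrightarrow> \<sigma> c \<in> c" "\<And>c. c \<in> rcosets P \<Longrightarrow> \<sigma> c \<in> carrier G"
    using section_ex[OF P(1)] by blast
  define D where "D = corestriction ?A P act d \<sigma>"
  have D: "D g \<in> A" if "g \<in> carrier G" for g
  proof -
    have "D g \<in> carrier ?A" unfolding D_def
      by (rule corestriction_crossed_hom(1)[OF P(1) A.comm_group_axioms act act_mult dA d_mult sec(1) that])
    then show ?thesis by simp
  qed
  have D_mult: "D (g \<otimes> h) = act h (D g) \<otimes> D h" if "g \<in> carrier G" "h \<in> carrier G" for g h
  proof -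
    have "D (g \<otimes> h) = act h (D g) \<otimes>\<^bsub>?A\<^esub> D h" unfolding D_def
      by (rule corestriction_crossed_hom(2)[OF P(1) A.comm_group_axioms act act_mult dA d_mult sec(1) that])
    then show ?thesis by simp
  qed
  let ?n = "card (rcosets P)"
  \<comment> \<open>The normal subgroup A lies in P and therefore fixes every coset. In each factor
    of the corestriction the element a is conjugated by a representative and back again.\<close>
  have D_A: "D a = a [^] ?n" if a: "a \<in> A" for a
  proof -
    have "act (\<sigma> (c #> a)) (d (\<sigma> c \<otimes> a \<otimes> inv (\<sigma> (c #> a)))) = a" if c: "c \<in> rcosets P" for c
    proof -
      have s: "\<sigma> c \<in> carrier G" "\<sigma> c \<in> c" using sec[OF c] by auto
      have conjA: "\<sigma> c \<otimes> a \<otimes> inv (\<sigma> c) \<in> A" using conj_closed[OF A s(1) a] .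
      obtain t where t: "t \<in> carrier G" "c = P #> t" using c by (auto simp: RCOSETS_def)
      have "t \<otimes> a \<otimes> inv t \<in> P" using conj_closed[OF A t(1) a] P(2) by auto
      then have "P #> (t \<otimes> a \<otimes> inv t) = P" using coset_join2[OF _ P(1)] PG by blast
      then have "P #> t = (P #> (t \<otimes> a \<otimes> inv t)) #> t" by simp
      also have "\<dots> = P #> (t \<otimes> a \<otimes> inv t \<otimes> t)"
        using coset_mult_assoc[of P "t \<otimes> a \<otimes> inv t" t] subgroup.subset[OF P(1)] t AG[OF a] by simp
      also have "t \<otimes> a \<otimes> inv t \<otimes> t = t \<otimes> a" using t AG[OF a] by (simp add: word_simps)
      also have "P #> (t \<otimes> a) = c #> a"
        using coset_mult_assoc[of P t a] subgroup.subset[OF P(1)] t AG[OF a] by simp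
      finally have ca: "c #> a = c" using t by simp
      have "d (\<sigma> c \<otimes> a \<otimes> inv (\<sigma> c)) = \<sigma> c \<otimes> a \<otimes> inv (\<sigma> c)"
        using d_eq[OF subgroup.one_closed[OF B(1)] conjA] AG[OF conjA] by simp
      then show ?thesis unfolding ca using s AG[OF a] by (simp add: act_def word_simps)
    qed
    then have "D a = finprod ?A (\<lambda>c. a) (rcosets P)"
      unfolding D_def corestriction_def using a by (intro A.finprod_cong') auto
    also have "\<dots> = a [^]\<^bsub>?A\<^esub> ?n" using a by (intro A.finprod_const) simp
    finally show ?thesis using nat_pow_consistent[of a ?n A] by simp
  qed
  have D_one: "D \<one> = \<one>" using D_A[OF subgroup.one_closed[OF As]] by simp
  have act_one: "act g \<one> = \<one>" if "g \<in> carrier G" for g using that by (simp add: act_def)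
  define K where "K = {g \<in> carrier G. D g = \<one>}"
  have Ks: "subgroup K G"
  proof (rule subgroupI)
    show "K \<noteq> {}" using D_one by (auto simp: K_def)
    fix g assume g: "g \<in> K"
    then have "D (g \<otimes> inv g) = D (inv g)" using D_mult[of g "inv g"] act_one D AG by (simp add: K_def)
    then show "inv g \<in> K" using g D_one by (simp add: K_def)
  next
    fix g h assume "g \<in> K" "h \<in> K"
    then show "g \<otimes> h \<in> K" using D_mult act_one by (simp add: K_def)
  qed (auto simp: K_def)
  have pow_card: "a [^] card A = \<one>" if "a \<in> A" for a
  proof -
    have "a [^]\<^bsub>?A\<^esub> order ?A = \<one>\<^bsub>?A\<^esub>"
      by (rule A.pow_order_eq_1) (use that in auto)
    then show ?thesis using nat_pow_consistent[of a "card A" A] by (simp add: order_def)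
  qed
  have AK: "A \<inter> K = {\<one>}"
  proof -
    have "a = \<one>" if a: "a \<in> A" "a \<in> K" for a
    proof -
      obtain k where "(a [^] ?n) [^] (k::nat) = a"
        using pow_coprime_bij[OF AG[OF a(1)] cop pow_card[OF a(1)]] by metis
      moreover have "a [^] ?n = \<one>" using a D_A by (simp add: K_def)
      ultimately show ?thesis by simp
    qed
    then show ?thesis using subgroup.one_closed[OF As] subgroup.one_closed[OF Ks] by blast
  qed
  have "carrier G \<subseteq> A <#> K"
  proof
    fix g assume g: "g \<in> carrier G"
    have iA: "inv (D g) \<in> A" using subgroup.m_inv_closed[OF As D[OF g]] .
    define e where "e = inv (D g)"
    have e: "e \<in> A" using iA by (simp add: e_def)
    \<comment> \<open>This gives an n-th root a of the inverse of D g, where n is the index of P. As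
      a acts trivially on A, the value of D at g a is trivial.\<close>
    obtain k :: nat where k: "(e [^] k) [^] ?n = e"
      using pow_coprime_bij[OF AG[OF e] cop pow_card[OF e]] by blast
    define a where "a = e [^] k"
    have a: "a \<in> A" unfolding a_def by (rule sub_pow_closed[OF As e])
    have "D (g \<otimes> a) = act a (D g) \<otimes> D a" using D_mult g AG[OF a] by simp
    also have "\<dots> = D g \<otimes> inv (D g)" using act_triv[OF a D[OF g]] D_A[OF a] k by (simp add: a_def e_def)
    also have "\<dots> = \<one>" using AG[OF D[OF g]] by simp
    finally have ga: "g \<otimes> a \<in> K" using g AG[OF a] by (simp add: K_def)
    have "(g \<otimes> inv a \<otimes> inv g) \<in> A" using conj_closed[OF A g subgroup.m_inv_closed[OF As a]] .
    moreover have "g = (g \<otimes> inv a \<otimes> inv g) \<otimes> (g \<otimes> a)" using g AG[OF a] by (simp add: word_simps)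
    ultimately show "g \<in> A <#> K" using ga mult_mem by metis
  qed
  moreover have "A <#> K \<subseteq> carrier G"
    using set_mult_closed[OF subgroup.subset[OF As] subgroup.subset[OF Ks]] .
  ultimately show thesis using that Ks AK by blast
qed

end

text \<open>Take B maximal with A \<inter> B trivial. If x were outside B A, the subgroup B <x>
  would still meet A trivially: an equation a = b x^k puts x^k into B A, which forces p | k, hence
  x^k = 1 and a \<in> A \<inter> B.\<close>

lemma elementary_abelian_complement:
  fixes p :: nat
  assumes "comm_group P" "finite (carrier P)" "prime p" "\<And>x. x \<in> carrier P \<Longrightarrow> x [^]\<^bsub>P\<^esub> p = \<one>\<^bsub>P\<^esub>"
    and A: "subgroup A P"
  obtains B where "subgroup B P" "A \<inter> B = {\<one>\<^bsub>P\<^esub>}" "carrier P \<subseteq> B <#>\<^bsub>P\<^esub> A"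
proof -
  interpret P: comm_group P by fact
  interpret finite_group P using assms(2) by unfold_locales
  define S where "S = {B. subgroup B P \<and> A \<inter> B = {\<one>\<^bsub>P\<^esub>}}"
  have "S \<subseteq> Pow (carrier P)" using subgroup.subset by (auto simp: S_def)
  then have "finite S" using fin by (simp add: finite_subset)
  moreover have "{\<one>\<^bsub>P\<^esub>} \<in> S" using subgroup.one_closed[OF A] P.triv_subgroup by (auto simp: S_def)
  ultimately obtain B where B': "B \<in> S" "\<forall>L\<in>S. B \<subseteq> L \<longrightarrow> B = L"
    using finite_has_maximal2[of S] by blast
  then have B: "subgroup B P" "A \<inter> B = {\<one>\<^bsub>P\<^esub>}" by (auto simp: S_def)
  have BG: "b \<in> carrier P" if "b \<in> B" for b using B that subgroup.mem_carrier by metis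
  have BA: "subgroup (B <#>\<^bsub>P\<^esub> A) P" by (rule P.mult_subgroups[OF B(1) A])
  have "carrier P \<subseteq> B <#>\<^bsub>P\<^esub> A"
  proof (rule ccontr)
    assume "\<not> ?thesis"
    then obtain x where x: "x \<in> carrier P" "x \<notin> B <#>\<^bsub>P\<^esub> A" by auto
    let ?X = "generate P {x}"
    have X: "subgroup ?X P" "x \<in> ?X" using generate_singleton_subgroup[OF x(1)] generate.incl[of x "{x}" P] by auto
    have BX: "subgroup (B <#>\<^bsub>P\<^esub> ?X) P" by (rule P.mult_subgroups[OF B(1) X(1)])
    have "a = \<one>\<^bsub>P\<^esub>" if a: "a \<in> A" "a \<in> B <#>\<^bsub>P\<^esub> ?X" for a
    proof -
      obtain b k where bk: "b \<in> B" "a = b \<otimes>\<^bsub>P\<^esub> (x [^]\<^bsub>P\<^esub> (k::nat))"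
        using a(2) set_mult_iff generate_powers[OF x(1)] by auto
      have "x [^]\<^bsub>P\<^esub> k = inv\<^bsub>P\<^esub> b \<otimes>\<^bsub>P\<^esub> a" using bk BG x by (simp add: word_simps)
      then have xk: "x [^]\<^bsub>P\<^esub> k \<in> B <#>\<^bsub>P\<^esub> A"
        using mult_mem[OF subgroup.m_inv_closed[OF B(1) bk(1)] a(1)] by simp
      have "p dvd k"
      proof (rule ccontr)
        assume "\<not> p dvd k"
        then have "coprime k p" using assms(3) prime_imp_coprime coprime_commute by blast
        then obtain j where "(x [^]\<^bsub>P\<^esub> k) [^]\<^bsub>P\<^esub> (j::nat) = x"
          using pow_coprime_bij[OF x(1) _ assms(4)[OF x(1)]] by metis
        then show False using sub_pow_closed[OF BA xk, of j] x(2) by simp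
      qed
      then obtain j where "k = p * j" by auto
      then have "x [^]\<^bsub>P\<^esub> k = \<one>\<^bsub>P\<^esub>" using P.nat_pow_pow[OF x(1), of p j] assms(4)[OF x(1)] by simp
      then have "a \<in> B" using bk BG by simp
      then show ?thesis using a(1) B(2) by auto
    qed
    then have "A \<inter> (B <#>\<^bsub>P\<^esub> ?X) = {\<one>\<^bsub>P\<^esub>}"
      using subgroup.one_closed[OF A] subgroup.one_closed[OF BX] by blast
    then have "B <#>\<^bsub>P\<^esub> ?X \<in> S" using BX by (simp add: S_def)
    moreover have "B \<subseteq> B <#>\<^bsub>P\<^esub> ?X" using sub_set_mult1[OF X(1)] subgroup.subset[OF B(1)] by auto
    ultimately have "B = B <#>\<^bsub>P\<^esub> ?X" using B'(2) by auto
    moreover have "x \<in> B <#>\<^bsub>P\<^esub> ?X" using sub_set_mult2[OF B(1) subgroup.subset[OF X(1)]] X(2) by auto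
    ultimately have "x \<in> B" by simp
    then show False using x(2) sub_set_mult1[OF A subgroup.subset[OF B(1)]] by auto
  qed
  then show thesis using that B by blast
qed

text \<open>All p-subgroups instead of the Sylow subgroups: in this form the condition passes to
  subgroups at once. Conjugation into Sylow subgroups gives the equivalence in
  \<open>elementary_p_subgroups_iff\<close>.\<close>

definition elementary_p_subgroups :: "('a, 'b) monoid_scheme \<Rightarrow> bool" where
  "elementary_p_subgroups G \<longleftrightarrow> (\<forall>p S. prime p \<longrightarrow> subgroup S G \<longrightarrow> (\<exists>k. card S = p ^ k) \<longrightarrow>
    (\<forall>x\<in>S. x [^]\<^bsub>G\<^esub> p = \<one>\<^bsub>G\<^esub> \<and> (\<forall>y\<in>S. x \<otimes>\<^bsub>G\<^esub> y = y \<otimes>\<^bsub>G\<^esub> x)))"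

section \<open>Complements of normal p-subgroups\<close>

context finite_group begin

lemma elementary_p_subgroupsD:
  assumes "elementary_p_subgroups G" "prime p" "subgroup S G" "card S = p ^ k" "x \<in> S"
  shows "x [^] p = \<one>" "y \<in> S \<Longrightarrow> x \<otimes> y = y \<otimes> x"
  using assms unfolding elementary_p_subgroups_def by blast+

lemma elementary_p_subgroups_sub:
  assumes "elementary_p_subgroups G" "subgroup H G"
  shows "elementary_p_subgroups (G\<lparr>carrier := H\<rparr>)"
  unfolding elementary_p_subgroups_def sub_iff[OF assms(2)]
proof (intro allI impI ballI)
  fix p S x assume "prime p" "subgroup S G \<and> S \<subseteq> H" "\<exists>k. card S = p ^ k" "x \<in> S"
  then show "x [^]\<^bsub>G\<lparr>carrier := H\<rparr>\<^esub> p = \<one>\<^bsub>G\<lparr>carrier := H\<rparr>\<^esub> \<and>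
      (\<forall>y\<in>S. x \<otimes>\<^bsub>G\<lparr>carrier := H\<rparr>\<^esub> y = y \<otimes>\<^bsub>G\<lparr>carrier := H\<rparr>\<^esub> x)"
    using elementary_p_subgroupsD[OF assms(1)] nat_pow_consistent[of x p H] by auto
qed

lemma sylow_subgroup_obtain:
  assumes "prime p"
  obtains P a where "subgroup P G" "card P = p ^ a" "\<not> p dvd card (rcosets P)"
    "card P = p ^ multiplicity p (order G)"
proof -
  let ?a = "multiplicity p (order G)"
  have pos: "order G \<noteq> 0" using order_gt_0_iff_finite fin by simp
  obtain m where m: "order G = p ^ ?a * m" using multiplicity_dvd[of p "order G"] by auto
  have nd: "\<not> p dvd m"
  proof
    assume "p dvd m"
    then have "p ^ Suc ?a dvd order G" using m by (metis mult_dvd_mono dvd_refl power_Suc2)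
    then have "Suc ?a \<le> ?a" using pos prime_gt_1_nat[OF assms] by (intro multiplicity_geI) auto
    then show False by simp
  qed
  obtain P where P: "subgroup P G" "card P = p ^ ?a"
    using sylow_thm[OF assms is_group m fin] by blast
  have "card (rcosets P) * p ^ ?a = p ^ ?a * m" using lagrange[OF P(1)] P(2) m by simp
  then have "card (rcosets P) = m" using prime_gt_0_nat[OF assms] by simp
  then show thesis using that P nd by blast
qed

text \<open>A normal p-subgroup lies in a Sylow subgroup P, since conjugation does not move it. It
  splits in the elementary abelian P, and the index of P is prime to p, so the splitting passes to
  the whole group.\<close>

lemma normal_p_subgroup_complement:
  assumes el: "elementary_p_subgroups G" and A: "A \<lhd> G" "card A = p ^ k" and p: "prime p"
  obtains K where "subgroup K G" "A \<inter> K = {\<one>}" "A <#> K = carrier G"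
proof -
  have As: "subgroup A G" using A normal_imp_subgroup by blast
  have AG: "a \<in> carrier G" if "a \<in> A" for a using As that subgroup.mem_carrier by metis
  obtain P n where P: "subgroup P G" "card P = p ^ n" "\<not> p dvd card (rcosets P)"
    using sylow_subgroup_obtain[OF p] by blast
  obtain t where t: "t \<in> carrier G" "\<And>q. q \<in> A \<Longrightarrow> t \<otimes> q \<otimes> inv t \<in> P"
    using sylow_contains[OF P(1,3) As A(2) p] by blast
  have AP: "A \<subseteq> P"
  proof
    fix a assume a: "a \<in> A"
    have "t \<otimes> (inv t \<otimes> a \<otimes> t) \<otimes> inv t \<in> P" using t(2)[OF conj_closed'[OF A(1) t(1) a]] .
    moreover have "t \<otimes> (inv t \<otimes> a \<otimes> t) \<otimes> inv t = a" using t(1) AG[OF a] by (simp add: word_simps)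
    ultimately show "a \<in> P" by simp
  qed
  let ?P = "G\<lparr>carrier := P\<rparr>"
  have cP: "comm_group ?P"
    by (rule sub_comm_group[OF P(1)]) (rule elementary_p_subgroupsD(2)[OF el p P(1,2)])
  obtain B where B: "subgroup B ?P" "A \<inter> B = {\<one>\<^bsub>?P\<^esub>}" "carrier ?P \<subseteq> B <#>\<^bsub>?P\<^esub> A"
  proof (rule elementary_abelian_complement[OF cP _ p])
    show "finite (carrier ?P)" using sub_finite[OF P(1)] by simp
    show "\<And>x. x \<in> carrier ?P \<Longrightarrow> x [^]\<^bsub>?P\<^esub> p = \<one>\<^bsub>?P\<^esub>"
      using elementary_p_subgroupsD(1)[OF el p P(1,2)] nat_pow_consistent[of _ p P] by simp
    show "subgroup A ?P" using sub_iff[OF P(1)] As AP by simp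
  qed
  have "coprime p (card (rcosets P))" using P(3) p prime_imp_coprime by blast
  then have cop: "coprime (card (rcosets P)) (card A)"
    unfolding A(2) by (simp add: coprime_commute)
  have B': "subgroup B G" "B \<subseteq> P" "A \<inter> B = {\<one>}" "P \<subseteq> B <#> A"
    using B sub_iff[OF P(1)] by auto
  show thesis
    by (rule gaschuetz_complement[OF A(1) elementary_p_subgroupsD(2)[OF el p As A(2)] P(1) AP B' cop that])
qed

end

section \<open>Normal series with factors of prime order\<close>

text \<open>Factors are measured by the orders of the terms, which avoids quotient groups in the
  inductions. With a function as index, intersections with a subgroup and products by it are
  pointwise operations.\<close>

definition prime_series :: "('a, 'b) monoid_scheme \<Rightarrow> nat \<Rightarrow> (nat \<Rightarrow> 'a set) \<Rightarrow> bool" where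
  "prime_series G d N \<longleftrightarrow> N 0 = {\<one>\<^bsub>G\<^esub>} \<and> N d = carrier G \<and> (\<forall>i\<le>d. N i \<lhd> G) \<and>
    (\<forall>i<d. N i \<subseteq> N (Suc i) \<and> (\<exists>p. prime p \<and> card (N (Suc i)) = p * card (N i)))"

definition has_prime_series :: "('a, 'b) monoid_scheme \<Rightarrow> bool" where
  "has_prime_series G \<longleftrightarrow> (\<exists>d N. prime_series G d N)"

text \<open>The groups called complemented in the overview.\<close>

definition elementary_supersolvable :: "('a, 'b) monoid_scheme \<Rightarrow> bool" where
  "elementary_supersolvable G \<longleftrightarrow> has_prime_series G \<and> elementary_p_subgroups G"

context finite_group begin

lemma prime_between:
  assumes "subgroup N G" "subgroup L G" "subgroup M G" "N \<subseteq> L" "L \<subseteq> M" "card M = p * card N" "prime p"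
  shows "L = N \<or> L = M"
proof -
  obtain e where e: "card L = card N * e" using card_dvd[OF assms(2,1,4)] by auto
  have "card L dvd card M" using card_dvd[OF assms(3,2,5)] .
  then have "e dvd p" using e assms(6) sub_card_pos[OF assms(1)] by (simp add: mult.commute)
  then have "e = 1 \<or> e = p" using assms(7) prime_nat_iff by blast
  then show ?thesis
  proof
    assume "e = 1" then show ?thesis using sub_eqI[OF assms(2,1,4)] e by simp
  next
    assume "e = p" then show ?thesis using sub_eqI[OF assms(3,2,5)] e assms(6) by simp
  qed
qed

text \<open>The group N (H \<inter> M) lies between N and M, whose quotient has prime order, so it
  is one of them. The product formula converts this into orders.\<close>

lemma card_inter_step:
  assumes H: "subgroup H G" and N: "N \<lhd> G" and M: "M \<lhd> G" and NM: "N \<subseteq> M" "card M = p * card N" "prime p"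
  shows "H \<inter> M = H \<inter> N \<or> card (H \<inter> M) = p * card (H \<inter> N)"
proof -
  have s: "subgroup N G" "subgroup M G" using N M normal_imp_subgroup by auto
  have HM: "subgroup (H \<inter> M) G" "subgroup (H \<inter> N) G" using subgroups_Inter_pair H s by auto
  have L: "subgroup (N <#> (H \<inter> M)) G" by (rule normal_mult_subgroup[OF N HM(1)])
  have "N \<subseteq> N <#> (H \<inter> M)" by (rule sub_set_mult1[OF HM(1) subgroup.subset[OF s(1)]])
  moreover have "N <#> (H \<inter> M) \<subseteq> M" by (rule set_mult_least[OF s(2) NM(1)]) simp
  ultimately have or: "N <#> (H \<inter> M) = N \<or> N <#> (H \<inter> M) = M"
    by (rule prime_between[OF s(1) L s(2) _ _ NM(2,3)])
  have eq: "N \<inter> (H \<inter> M) = H \<inter> N" using NM(1) by blast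
  have c: "card (N <#> (H \<inter> M)) * card (H \<inter> N) = card N * card (H \<inter> M)"
    using card_set_mult[OF s(1) HM(1)] eq by simp
  have pos: "0 < card N" using sub_card_pos[OF s(1)] .
  from or show ?thesis
  proof
    assume "N <#> (H \<inter> M) = N"
    then have "card (H \<inter> N) = card (H \<inter> M)" using c pos by simp
    then have "H \<inter> N = H \<inter> M" using NM(1) by (intro sub_eqI[OF HM]) auto
    then show ?thesis by simp
  next
    assume "N <#> (H \<inter> M) = M"
    then show ?thesis using c pos NM(2) by simp
  qed
qed

text \<open>Intersecting a series with a subgroup makes some terms coincide; here the repetitions
  are deleted.\<close>

lemma has_prime_series_if_weak_series:
  assumes "N 0 = {\<one>}" "N d = carrier G" "\<And>i. i \<le> d \<Longrightarrow> N i \<lhd> G"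
    and step: "\<And>i. i < d \<Longrightarrow> N i = N (Suc i) \<or> (N i \<subseteq> N (Suc i) \<and> (\<exists>p. prime p \<and> card (N (Suc i)) = p * card (N i)))"
  shows "has_prime_series G"
proof -
  have "\<exists>e M. M 0 = {\<one>} \<and> M e = N k \<and> (\<forall>i\<le>e. M i \<lhd> G) \<and>
    (\<forall>i<e. M i \<subseteq> M (Suc i) \<and> (\<exists>p. prime p \<and> card (M (Suc i)) = p * card (M i)))" if "k \<le> d" for k
    using that
  proof (induction k)
    case 0
    then show ?case using assms(1) assms(3)[of 0] by (intro exI[of _ 0] exI[of _ N]) simp
  next
    case (Suc k)
    then obtain e M where M: "M 0 = {\<one>}" "M e = N k" "\<forall>i\<le>e. M i \<lhd> G"
      "\<forall>i<e. M i \<subseteq> M (Suc i) \<and> (\<exists>p. prime p \<and> card (M (Suc i)) = p * card (M i))" by auto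
    show ?case
    proof (cases "N k = N (Suc k)")
      case True
      then show ?thesis using M by (intro exI[of _ e] exI[of _ M]) simp
    next
      case False
      then have s: "N k \<subseteq> N (Suc k)" "\<exists>p. prime p \<and> card (N (Suc k)) = p * card (N k)"
        using step[of k] Suc by auto
      show ?thesis
        by (rule exI[of _ "Suc e"], rule exI[of _ "M(Suc e := N (Suc k))"])
          (use M s assms(3)[OF Suc.prems] in \<open>auto simp: le_Suc_eq less_Suc_eq\<close>)
    qed
  qed
  from this[of d] show ?thesis unfolding has_prime_series_def prime_series_def assms(2)[symmetric] by auto
qed

lemma has_prime_series_sub:
  assumes "has_prime_series G" and H: "subgroup H G" shows "has_prime_series (G\<lparr>carrier := H\<rparr>)"
proof -
  obtain d N where N: "N 0 = {\<one>}" "N d = carrier G" "\<And>i. i \<le> d \<Longrightarrow> N i \<lhd> G"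
    "\<And>i. i < d \<Longrightarrow> N i \<subseteq> N (Suc i) \<and> (\<exists>p. prime p \<and> card (N (Suc i)) = p * card (N i))"
    using assms(1) unfolding has_prime_series_def prime_series_def by auto
  interpret H: finite_group "G\<lparr>carrier := H\<rparr>" by (rule sub_group[OF H])
  show ?thesis
  proof (rule H.has_prime_series_if_weak_series[of "\<lambda>i. H \<inter> N i" d])
    show "H \<inter> N 0 = {\<one>\<^bsub>G\<lparr>carrier := H\<rparr>\<^esub>}" using N(1) subgroup.one_closed[OF H] by auto
    show "H \<inter> N d = carrier (G\<lparr>carrier := H\<rparr>)" using N(2) subgroup.subset[OF H] by auto
    fix i assume i: "i \<le> d"
    have "subgroup (H \<inter> N i) G" using subgroups_Inter_pair[OF H normal_imp_subgroup[OF N(3)[OF i]]] .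
    then show "H \<inter> N i \<lhd> G\<lparr>carrier := H\<rparr>" unfolding normal_sub_iff[OF H]
      using conj_closed[OF N(3)[OF i]] subgroup.m_closed[OF H] subgroup.m_inv_closed[OF H] subgroup.subset[OF H]
      by auto
  next
    fix i assume i: "i < d"
    then obtain p where p: "N i \<subseteq> N (Suc i)" "prime p" "card (N (Suc i)) = p * card (N i)" using N(4) by blast
    have "H \<inter> N (Suc i) = H \<inter> N i \<or> card (H \<inter> N (Suc i)) = p * card (H \<inter> N i)"
      by (rule card_inter_step[OF H N(3) N(3) p(1,3,2)]) (use i in auto)
    then show "H \<inter> N i = H \<inter> N (Suc i) \<or> H \<inter> N i \<subseteq> H \<inter> N (Suc i) \<and>
      (\<exists>p. prime p \<and> card (H \<inter> N (Suc i)) = p * card (H \<inter> N i))"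
      using p by blast
  qed
qed

lemma elementary_supersolvable_sub:
  "elementary_supersolvable G \<Longrightarrow> subgroup H G \<Longrightarrow> elementary_supersolvable (G\<lparr>carrier := H\<rparr>)"
  unfolding elementary_supersolvable_def using has_prime_series_sub elementary_p_subgroups_sub by blast

text \<open>Intersect U with the series. At the first nontrivial intersection the order jumps from 1
  to a prime.\<close>

lemma prime_order_normal_ex:
  assumes "has_prime_series G" and U: "U \<lhd> G" "U \<noteq> {\<one>}"
  obtains W where "W \<lhd> G" "W \<subseteq> U" "prime (card W)"
proof -
  obtain d N where N: "N 0 = {\<one>}" "N d = carrier G" "\<And>i. i \<le> d \<Longrightarrow> N i \<lhd> G"
    "\<And>i. i < d \<Longrightarrow> N i \<subseteq> N (Suc i) \<and> (\<exists>p. prime p \<and> card (N (Suc i)) = p * card (N i))"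
    using assms(1) unfolding has_prime_series_def prime_series_def by auto
  have Us: "subgroup U G" using U normal_imp_subgroup by auto
  define i where "i = (LEAST i. i \<le> d \<and> U \<inter> N i \<noteq> {\<one>})"
  have "d \<le> d \<and> U \<inter> N d \<noteq> {\<one>}" using N(2) U(2) subgroup.subset[OF Us] by auto
  then have i: "i \<le> d \<and> U \<inter> N i \<noteq> {\<one>}" unfolding i_def by (rule LeastI)
  have "i \<noteq> 0" using i N(1) subgroup.one_closed[OF Us] by auto
  then obtain j where j: "i = Suc j" by (cases i) auto
  have jd: "j < d" using i j by auto
  have Uj: "U \<inter> N j = {\<one>}" using not_less_Least[of j "\<lambda>i. i \<le> d \<and> U \<inter> N i \<noteq> {\<one>}"] i j by (auto simp: i_def)
  obtain p where p: "N j \<subseteq> N i" "prime p" "card (N i) = p * card (N j)" using N(4)[OF jd] j by auto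
  have "card (U \<inter> N i) = p * card (U \<inter> N j)"
    using card_inter_step[OF Us N(3)[of j] N(3)[of i] p(1,3,2)] i jd Uj by auto
  then have "prime (card (U \<inter> N i))" using Uj p by simp
  moreover have "U \<inter> N i \<lhd> G" using normal_subgroup_intersect[OF U(1) N(3)] i by auto
  ultimately show thesis using that by blast
qed

text \<open>Modulo V every element of the group agrees with an element of K, and K normalizes L.
  Conjugation by V changes elements of L only by factors from V, since V is normal.\<close>

lemma normal_lift:
  assumes V: "V \<lhd> G" and K: "subgroup K G" "V <#> K = carrier G" and L: "L \<lhd> G\<lparr>carrier := K\<rparr>"
  shows "V <#> L \<lhd> G"
proof -
  have L': "subgroup L G" "L \<subseteq> K" "\<And>x h. x \<in> K \<Longrightarrow> h \<in> L \<Longrightarrow> x \<otimes> h \<otimes> inv x \<in> L"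
    using L normal_sub_iff[OF K(1)] by auto
  have Vs: "subgroup V G" using V normal_imp_subgroup by auto
  have VG: "v \<in> carrier G" if "v \<in> V" for v using Vs that subgroup.mem_carrier by metis
  have KG: "v \<in> carrier G" if "v \<in> K" for v using K that subgroup.mem_carrier by metis
  have "g \<otimes> x \<otimes> inv g \<in> V <#> L" if g: "g \<in> carrier G" and x: "x \<in> V <#> L" for g x
  proof -
    obtain v l where vl: "v \<in> V" "l \<in> L" "x = v \<otimes> l" using x set_mult_iff by auto
    obtain u k where uk: "u \<in> V" "k \<in> K" "g = u \<otimes> k" using g K(2) set_mult_iff by blast
    let ?l = "k \<otimes> l \<otimes> inv k"
    have l: "?l \<in> L" using L'(3) uk vl by auto
    note c = VG[OF vl(1)] KG[OF subsetD[OF L'(2) vl(2)]] VG[OF uk(1)] KG[OF uk(2)] KG[OF subsetD[OF L'(2) l]]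
    have "g \<otimes> x \<otimes> inv g = (u \<otimes> (k \<otimes> v \<otimes> inv k) \<otimes> (?l \<otimes> inv u \<otimes> inv ?l)) \<otimes> ?l"
      using c by (simp add: uk vl word_simps)
    moreover have "u \<otimes> (k \<otimes> v \<otimes> inv k) \<otimes> (?l \<otimes> inv u \<otimes> inv ?l) \<in> V"
      using subgroup.m_closed[OF Vs] conj_closed[OF V] c vl uk subgroup.m_inv_closed[OF Vs] by auto
    ultimately show ?thesis using l mult_mem by metis
  qed
  then show ?thesis unfolding normal_iff using normal_mult_subgroup[OF V L'(1)] by blast
qed

lemma card_set_mult_disjoint:
  assumes "subgroup V G" "subgroup L G" "V \<inter> L = {\<one>}" shows "card (V <#> L) = card V * card L"
  using card_set_mult[OF assms(1,2)] assms(3) by simp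

text \<open>K represents the quotient by V, so its series lifts by multiplication with V. The
  trivial subgroup is put in front, and V becomes the first factor.\<close>

lemma has_prime_series_extend:
  assumes V: "V \<lhd> G" "prime (card V)" and K: "subgroup K G" "V \<inter> K = {\<one>}" "V <#> K = carrier G"
    and ss: "has_prime_series (G\<lparr>carrier := K\<rparr>)"
  shows "has_prime_series G"
proof -
  obtain d N where N: "N 0 = {\<one>}" "N d = K" "\<And>i. i \<le> d \<Longrightarrow> N i \<lhd> G\<lparr>carrier := K\<rparr>"
    "\<And>i. i < d \<Longrightarrow> N i \<subseteq> N (Suc i) \<and> (\<exists>p. prime p \<and> card (N (Suc i)) = p * card (N i))"
    using ss unfolding has_prime_series_def prime_series_def by auto
  have Vs: "subgroup V G" using V normal_imp_subgroup by auto
  have NK: "subgroup (N i) G" "N i \<subseteq> K" if "i \<le> d" for i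
    using N(3)[OF that] normal_sub_iff[OF K(1)] by auto
  have c: "card (V <#> N i) = card V * card (N i)" if "i \<le> d" for i
    using card_set_mult_disjoint[OF Vs NK(1)[OF that]] NK[OF that] K(2) subgroup.one_closed[OF Vs]
      subgroup.one_closed[OF NK(1)[OF that]] by blast
  show ?thesis
  proof (rule has_prime_series_if_weak_series[of "\<lambda>i. case i of 0 \<Rightarrow> {\<one>} | Suc i \<Rightarrow> V <#> N i" "Suc d"])
    fix i assume "i \<le> Suc d"
    then show "(case i of 0 \<Rightarrow> {\<one>} | Suc i \<Rightarrow> V <#> N i) \<lhd> G"
      using one_is_normal normal_lift[OF V(1) K(1,3) N(3)] by (auto split: nat.split)
  next
    fix i assume i: "i < Suc d"
    show "(case i of 0 \<Rightarrow> {\<one>} | Suc i \<Rightarrow> V <#> N i) = (case Suc i of 0 \<Rightarrow> {\<one>} | Suc i \<Rightarrow> V <#> N i) \<or>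
      ((case i of 0 \<Rightarrow> {\<one>} | Suc i \<Rightarrow> V <#> N i) \<subseteq> (case Suc i of 0 \<Rightarrow> {\<one>} | Suc i \<Rightarrow> V <#> N i) \<and>
      (\<exists>p. prime p \<and> card (case Suc i of 0 \<Rightarrow> {\<one>} | Suc i \<Rightarrow> V <#> N i) =
        p * card (case i of 0 \<Rightarrow> {\<one>} | Suc i \<Rightarrow> V <#> N i)))"
    proof (cases i)
      case 0
      have "\<one> \<in> V <#> N 0" using subgroup.one_closed[OF normal_mult_subgroup[OF V(1) NK(1)[of 0]]] by simp
      then show ?thesis using c[of 0] N(1) V(2) 0 by auto
    next
      case (Suc j)
      then obtain p where "N j \<subseteq> N i" "prime p" "card (N i) = p * card (N j)" using N(4)[of j] i by auto
      then show ?thesis using c[of i] c[of j] i Suc mono_set_mult[of V V "N j" "N i"] by auto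
    qed
  qed (use N K in auto)
qed

text \<open>Multiply L by the terms of the series one after the other. Just before the product
  becomes the whole group, its index is the order of a factor of the series. For a maximal L this
  says that L itself has prime index.\<close>

lemma prime_index_supergroup_ex:
  assumes "has_prime_series G" and L: "subgroup L G" "L \<noteq> carrier G"
  obtains L' p where "subgroup L' G" "L \<subseteq> L'" "prime p" "card (carrier G) = p * card L'"
proof -
  obtain d N where N: "N 0 = {\<one>}" "N d = carrier G" "\<And>i. i \<le> d \<Longrightarrow> N i \<lhd> G"
    "\<And>i. i < d \<Longrightarrow> N i \<subseteq> N (Suc i) \<and> (\<exists>p. prime p \<and> card (N (Suc i)) = p * card (N i))"
    using assms(1) unfolding has_prime_series_def prime_series_def by auto
  have Ns: "subgroup (N i) G" if "i \<le> d" for i using N(3)[OF that] normal_imp_subgroup by auto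
  have NL: "subgroup (N i <#> L) G" if "i \<le> d" for i using normal_mult_subgroup[OF N(3)[OF that] L(1)] .
  define i where "i = (LEAST i. i \<le> d \<and> N i <#> L = carrier G)"
  have "carrier G <#> L = carrier G"
    using sub_set_mult1[OF L(1), of "carrier G"] set_mult_closed[OF _ subgroup.subset[OF L(1)]] by auto
  then have "d \<le> d \<and> N d <#> L = carrier G" using N(2) by simp
  then have i: "i \<le> d \<and> N i <#> L = carrier G" unfolding i_def by (rule LeastI)
  have "N 0 <#> L = L" using N(1) subgroup.subset[OF L(1)] by (force simp: set_mult_def)
  then have "i \<noteq> 0" using i L(2) by auto
  then obtain j where j: "i = Suc j" by (cases i) auto
  have jd: "j < d" "j \<le> d" "i \<le> d" using i j by auto
  let ?L = "N j <#> L"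
  have ne: "?L \<noteq> carrier G" using not_less_Least[of j "\<lambda>i. i \<le> d \<and> N i <#> L = carrier G"] jd j by (auto simp: i_def)
  obtain p where p: "N j \<subseteq> N i" "prime p" "card (N i) = p * card (N j)" using N(4)[OF jd(1)] j by auto
  have sub: "N j \<subseteq> ?L" "L \<subseteq> ?L"
    using sub_set_mult1[OF L(1) subgroup.subset[OF Ns[OF jd(2)]]]
      sub_set_mult2[OF Ns[OF jd(2)] subgroup.subset[OF L(1)]] by auto
  have int: "subgroup (N i \<inter> ?L) G" using subgroups_Inter_pair[OF Ns[OF jd(3)] NL[OF jd(2)]] .
  have "N i \<inter> ?L = N j \<or> N i \<inter> ?L = N i"
    by (rule prime_between[OF Ns[OF jd(2)] int Ns[OF jd(3)] _ _ p(3,2)]) (use sub p in auto)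
  moreover have "N i \<inter> ?L \<noteq> N i"
  proof
    assume "N i \<inter> ?L = N i"
    then have "N i <#> L \<subseteq> ?L" using sub(2) by (intro set_mult_least[OF NL[OF jd(2)]]) auto
    then show False using i ne subgroup.subset[OF NL[OF jd(2)]] by auto
  qed
  ultimately have eq: "N i \<inter> ?L = N j" by simp
  have "N i <#> L \<subseteq> N i <#> ?L" using sub by (intro mono_set_mult) auto
  then have "N i <#> ?L = carrier G"
    using i set_mult_closed[OF subgroup.subset[OF Ns[OF jd(3)]] subgroup.subset[OF NL[OF jd(2)]]] by auto
  then have "card (carrier G) * card (N j) = p * card (N j) * card ?L"
    using card_set_mult[OF Ns[OF jd(3)] NL[OF jd(2)]] eq p by simp
  then have "card (carrier G) = p * card ?L" using sub_card_pos[OF Ns[OF jd(2)]] by simp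
  then show thesis using that[OF NL[OF jd(2)] sub(2) p(2)] by simp
qed

text \<open>A complement C of D meets V in a normal subgroup, because D centralizes the abelian V.
  If C \<inter> V were nontrivial, it would contain a normal subgroup of prime order, which lies in
  D by hypothesis. The lemma extends properties of normal subgroups of prime order to V, with D as
  the part of V that has the property.\<close>

lemma socle_eq:
  assumes X: "elementary_supersolvable G" and V: "V \<lhd> G" "card V = p ^ k" "prime p" and D: "D \<lhd> G" "D \<subseteq> V"
    and soc: "\<And>W. W \<lhd> G \<Longrightarrow> W \<subseteq> V \<Longrightarrow> prime (card W) \<Longrightarrow> W \<subseteq> D"
  shows "D = V"
proof -
  have el: "elementary_p_subgroups G" using X by (simp add: elementary_supersolvable_def)
  have s: "subgroup V G" "subgroup D G" using V D normal_imp_subgroup by auto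
  have VG: "v \<in> carrier G" if "v \<in> V" for v using s that subgroup.mem_carrier by metis
  have "card D dvd p ^ k" using card_dvd[OF s D(2)] V(2) by simp
  then obtain j where "card D = p ^ j" using divides_primepow_nat[OF V(3)] by auto
  then obtain C where C: "subgroup C G" "D \<inter> C = {\<one>}" "D <#> C = carrier G"
    using normal_p_subgroup_complement[OF el D(1) _ V(3)] by blast
  have CV: "subgroup (C \<inter> V) G" using subgroups_Inter_pair[OF C(1) s(1)] .
  have "g \<otimes> x \<otimes> inv g \<in> C \<inter> V" if g: "g \<in> carrier G" and x: "x \<in> C \<inter> V" for g x
  proof -
    obtain d c where dc: "d \<in> D" "c \<in> C" "g = d \<otimes> c" using g C(3) set_mult_iff by blast
    let ?y = "c \<otimes> x \<otimes> inv c"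
    have cG: "c \<in> carrier G" "x \<in> carrier G" "d \<in> carrier G" "d \<in> V"
      using dc C x D VG subgroup.mem_carrier[OF C(1)] by auto
    have yC: "?y \<in> C" using subgroup.m_closed[OF C(1)] subgroup.m_inv_closed[OF C(1)] dc x by auto
    have yV: "?y \<in> V" using conj_closed[OF V(1) cG(1)] x by auto
    have "g \<otimes> x \<otimes> inv g = (d \<otimes> ?y) \<otimes> inv d" using cG dc(3) by (simp add: word_simps)
    also have "d \<otimes> ?y = ?y \<otimes> d" using elementary_p_subgroupsD(2)[OF el V(3) s(1) V(2) cG(4) yV] .
    also have "?y \<otimes> d \<otimes> inv d = ?y" using cG by (simp add: word_simps)
    finally show ?thesis using yC yV by simp
  qed
  then have CVn: "C \<inter> V \<lhd> G" unfolding normal_iff using CV by blast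
  have CV1: "C \<inter> V = {\<one>}"
  proof (rule ccontr)
    assume "C \<inter> V \<noteq> {\<one>}"
    then obtain W where W: "W \<lhd> G" "W \<subseteq> C \<inter> V" "prime (card W)"
      using prime_order_normal_ex[OF _ CVn] X by (auto simp: elementary_supersolvable_def)
    then have "W \<subseteq> {\<one>}" using soc[of W] C(2) by auto
    then have "card W \<le> 1" using card_mono[of "{\<one>}" W] by simp
    then show False using W(3) prime_gt_1_nat[of "card W"] by simp
  qed
  have "v \<in> D" if v: "v \<in> V" for v
  proof -
    obtain d c where dc: "d \<in> D" "c \<in> C" "v = d \<otimes> c" using VG[OF v] C(3) set_mult_iff by blast
    then have cG: "c \<in> carrier G" "d \<in> carrier G" using subgroup.mem_carrier[OF C(1)] D VG by auto
    have "c = inv d \<otimes> v" using cG dc by (simp add: word_simps)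
    moreover have "inv d \<otimes> v \<in> V" using subgroup.m_closed[OF s(1)] subgroup.m_inv_closed[OF s(1)] dc(1) D v by blast
    ultimately have "c \<in> V" by simp
    then have "c = \<one>" using dc CV1 by auto
    then show ?thesis using dc cG by simp
  qed
  then show ?thesis using D(2) by auto
qed

lemma centralizer_subgroup:
  assumes "S \<subseteq> carrier G" shows "subgroup {g \<in> carrier G. \<forall>x\<in>S. g \<otimes> x = x \<otimes> g} G"
proof (rule subgroupI)
  fix g assume g: "g \<in> {g \<in> carrier G. \<forall>x\<in>S. g \<otimes> x = x \<otimes> g}"
  have "inv g \<otimes> x = x \<otimes> inv g" if x: "x \<in> S" for x
  proof -
    have c: "g \<in> carrier G" "x \<in> carrier G" using g x assms by auto
    have "inv g \<otimes> x = inv g \<otimes> (x \<otimes> g) \<otimes> inv g" using c by (simp add: word_simps)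
    also have "x \<otimes> g = g \<otimes> x" using g x by auto
    finally show ?thesis using c by (simp add: word_simps)
  qed
  then show "inv g \<in> {g \<in> carrier G. \<forall>x\<in>S. g \<otimes> x = x \<otimes> g}" using g by auto
next
  fix g h assume g: "g \<in> {g \<in> carrier G. \<forall>x\<in>S. g \<otimes> x = x \<otimes> g}" and h: "h \<in> {g \<in> carrier G. \<forall>x\<in>S. g \<otimes> x = x \<otimes> g}"
  have "g \<otimes> h \<otimes> x = x \<otimes> (g \<otimes> h)" if x: "x \<in> S" for x
  proof -
    have c: "g \<in> carrier G" "h \<in> carrier G" "x \<in> carrier G" using g h x assms by auto
    have "g \<otimes> h \<otimes> x = g \<otimes> (h \<otimes> x)" using c by (simp add: m_assoc)
    also have "h \<otimes> x = x \<otimes> h" using h x by auto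
    also have "g \<otimes> (x \<otimes> h) = (g \<otimes> x) \<otimes> h" using c by (simp add: m_assoc)
    also have "g \<otimes> x = x \<otimes> g" using g x by auto
    finally show ?thesis using c by (simp add: m_assoc)
  qed
  then show "g \<otimes> h \<in> {g \<in> carrier G. \<forall>x\<in>S. g \<otimes> x = x \<otimes> g}" using g h by auto
next
  show "{g \<in> carrier G. \<forall>x\<in>S. g \<otimes> x = x \<otimes> g} \<noteq> {}"
    using assms by (auto intro!: exI[of _ \<one>] simp: subset_iff)
qed auto

text \<open>
  The index of the centralizer of \<open>w \<noteq> 1\<close> is at most \<open>p - 1\<close>, hence has no prime factor.
\<close>

lemma smallest_prime_central:
  assumes W: "W \<lhd> G" "card W = p" and p: "prime p"
    and small: "\<And>q. prime q \<Longrightarrow> q dvd card (carrier G) \<Longrightarrow> p \<le> q"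
    and w: "w \<in> W" and g: "g \<in> carrier G"
  shows "g \<otimes> w = w \<otimes> g"
proof (cases "w = \<one>")
  case False
  have Ws: "subgroup W G" using W normal_imp_subgroup by auto
  have wG: "w \<in> carrier G" using Ws w subgroup.mem_carrier by metis
  let ?C = "{g \<in> carrier G. \<forall>x\<in>{w}. g \<otimes> x = x \<otimes> g}"
  have C: "subgroup ?C G" using centralizer_subgroup[of "{w}"] wG by auto
  obtain \<sigma> where sec: "\<And>c. c \<in> rcosets ?C \<Longrightarrow> \<sigma> c \<in> c" "\<And>c. c \<in> rcosets ?C \<Longrightarrow> \<sigma> c \<in> carrier G"
    using section_ex[OF C] by blast
  let ?f = "\<lambda>c. inv (\<sigma> c) \<otimes> w \<otimes> \<sigma> c"
  \<comment> \<open>Cosets of the centralizer correspond to conjugates of w, and these are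
    nontrivial elements of W.\<close>
  have "inj_on ?f (rcosets ?C)"
  proof (rule inj_onI)
    fix c c' assume c: "c \<in> rcosets ?C" "c' \<in> rcosets ?C" and eq: "?f c = ?f c'"
    let ?s = "\<sigma> c" and ?t = "\<sigma> c'"
    note cG = sec(2)[OF c(1)] sec(2)[OF c(2)] wG
    have "?t \<otimes> inv ?s \<otimes> w = ?t \<otimes> (inv ?s \<otimes> w \<otimes> ?s) \<otimes> inv ?s" using cG by (simp add: word_simps)
    also have "\<dots> = w \<otimes> (?t \<otimes> inv ?s)" unfolding eq using cG by (simp add: word_simps)
    finally have "?t \<otimes> inv ?s \<in> ?C" using cG by simp
    then have "?t \<in> ?C #> ?s" using subgroup.rcos_module_rev[OF C is_group cG(1,2)] by simp
    then have "?C #> ?s = ?C #> ?t" using repr_independence[OF _ cG(1) C] by simp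
    moreover have "?C #> ?s = c" "?C #> ?t = c'"
      using c sec(1)[OF c(1)] sec(1)[OF c(2)] repr_independence[OF _ _ C] by (auto simp: RCOSETS_def)
    ultimately show "c = c'" by simp
  qed
  moreover have "?f ` (rcosets ?C) \<subseteq> W - {\<one>}"
  proof
    fix y assume "y \<in> ?f ` (rcosets ?C)"
    then obtain c where c: "c \<in> rcosets ?C" "y = ?f c" by auto
    have "y \<in> W" using conj_closed'[OF W(1) sec(2)[OF c(1)] w] c by simp
    moreover have "y \<noteq> \<one>"
    proof
      assume "y = \<one>"
      then have "\<sigma> c \<otimes> (inv (\<sigma> c) \<otimes> w \<otimes> \<sigma> c) \<otimes> inv (\<sigma> c) = \<one>" using c sec(2)[OF c(1)] by simp
      then show False using sec(2)[OF c(1)] wG False by (simp add: word_simps)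
    qed
    ultimately show "y \<in> W - {\<one>}" by simp
  qed
  ultimately have "card (rcosets ?C) \<le> card (W - {\<one>})"
    using card_inj_on_le sub_finite[OF Ws] by blast
  then have le: "card (rcosets ?C) \<le> p - 1" using W(2) subgroup.one_closed[OF Ws] sub_finite[OF Ws] by simp
  have lag: "card (rcosets ?C) * card ?C = card (carrier G)" using lagrange[OF C] by (simp add: order_def)
  have pos: "0 < card (rcosets ?C)"
  proof (rule ccontr)
    assume "\<not> ?thesis"
    then have "card (carrier G) = 0" using lag by simp
    then show False using sub_card_pos[OF subgroup_self] by simp
  qed
  have "card (rcosets ?C) = 1"
  proof (rule ccontr)
    assume "card (rcosets ?C) \<noteq> 1"
    then obtain q where q: "prime q" "q dvd card (rcosets ?C)" using prime_factor_nat by blast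
    have "q dvd card (carrier G)" unfolding lag[symmetric] by (rule dvd_mult2[OF q(2)])
    then have "p \<le> q" using small q(1) by simp
    moreover have "q \<le> card (rcosets ?C)" using q(2) pos by (simp add: dvd_imp_le)
    ultimately show False using le prime_gt_0_nat[OF p] by linarith
  qed
  then have "?C = carrier G" using lag by (intro sub_eqI[OF subgroup_self C]) auto
  then show ?thesis using g by auto
qed (use g in simp)

text \<open>Apply \<open>socle_eq\<close> to the part of the centre in P: normal subgroups of prime
  order in P have order p and are central, because p is the smallest prime divisor.\<close>

lemma normal_p_subgroup_central:
  assumes X: "elementary_supersolvable G" and P: "P \<lhd> G" "card P = p ^ k" and p: "prime p"
    and small: "\<And>q. prime q \<Longrightarrow> q dvd card (carrier G) \<Longrightarrow> p \<le> q"
    and x: "x \<in> P" and g: "g \<in> carrier G"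
  shows "g \<otimes> x = x \<otimes> g"
proof -
  have Ps: "subgroup P G" using P normal_imp_subgroup by auto
  have PG: "v \<in> carrier G" if "v \<in> P" for v using Ps that subgroup.mem_carrier by metis
  let ?Z = "{z \<in> carrier G. \<forall>h\<in>carrier G. z \<otimes> h = h \<otimes> z}"
  have Z: "subgroup ?Z G" using centralizer_subgroup[of "carrier G"] by simp
  have D: "?Z \<inter> P \<lhd> G" unfolding normal_iff
  proof (intro conjI ballI)
    show "subgroup (?Z \<inter> P) G" using subgroups_Inter_pair[OF Z Ps] .
    fix g z assume g: "g \<in> carrier G" and z: "z \<in> ?Z \<inter> P"
    have zG: "z \<in> carrier G" using z by simp
    have "g \<otimes> z = z \<otimes> g" using z g by auto
    then have "g \<otimes> z \<otimes> inv g = z" using g zG by (simp add: word_simps)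
    then show "g \<otimes> z \<otimes> inv g \<in> ?Z \<inter> P" using z by simp
  qed
  have "?Z \<inter> P = P"
  proof (rule socle_eq[OF X P p D])
    fix W assume W: "W \<lhd> G" "W \<subseteq> P" "prime (card W)"
    have "card W dvd p ^ k" using card_dvd[OF Ps normal_imp_subgroup[OF W(1)] W(2)] P(2) by simp
    then have "card W = p" using W(3) p by (meson prime_dvd_power primes_dvd_imp_eq)
    then have "g \<otimes> w = w \<otimes> g" if "w \<in> W" "g \<in> carrier G" for w g
      using smallest_prime_central[OF W(1) _ p small that] by simp
    then show "W \<subseteq> ?Z \<inter> P" using W(2) PG by force
  qed simp
  then have "x \<in> ?Z" using x by blast
  then show ?thesis using g by simp
qed

section \<open>Transfer\<close>

text \<open>Put y = t x t^-1. Both P and t P t^-1 centralize y, and P has index prime to p in the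
  centralizer of y. Some c in this centralizer therefore moves t P t^-1 into P. Then c t normalizes
  P and so centralizes x, which gives y = c y c^-1 = x.\<close>

lemma burnside_fusion:
  assumes P: "subgroup P G" "card P = p ^ a" "\<not> p dvd card (rcosets P)" and p: "prime p"
    and comm: "\<And>x y. x \<in> P \<Longrightarrow> y \<in> P \<Longrightarrow> x \<otimes> y = y \<otimes> x"
    and cent: "\<And>n x. n \<in> carrier G \<Longrightarrow> (\<And>y. y \<in> P \<Longrightarrow> n \<otimes> y \<otimes> inv n \<in> P) \<Longrightarrow> x \<in> P \<Longrightarrow> n \<otimes> x \<otimes> inv n = x"
    and x: "x \<in> P" and t: "t \<in> carrier G" and tx: "t \<otimes> x \<otimes> inv t \<in> P"
  shows "t \<otimes> x \<otimes> inv t = x"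
proof -
  have PG: "v \<in> carrier G" if "v \<in> P" for v using P(1) that subgroup.mem_carrier by metis
  define y where "y = t \<otimes> x \<otimes> inv t"
  have y: "y \<in> P" "y \<in> carrier G" using tx PG by (auto simp: y_def)
  let ?C = "{g \<in> carrier G. \<forall>x\<in>{y}. g \<otimes> x = x \<otimes> g}"
  have C: "subgroup ?C G" using centralizer_subgroup[of "{y}"] y by auto
  let ?G = "G\<lparr>carrier := ?C\<rparr>"
  interpret C: finite_group ?G by (rule sub_group[OF C])
  have PC: "P \<subseteq> ?C" using comm y PG by auto
  let ?Q = "(\<lambda>z. t \<otimes> z \<otimes> inv t) ` P"
  have Q: "subgroup ?Q G"
  proof (rule subgroupI)
    show "?Q \<noteq> {}" using x by auto
    show "?Q \<subseteq> carrier G" using PG t by auto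
    fix u assume "u \<in> ?Q" then obtain z where z: "z \<in> P" "u = t \<otimes> z \<otimes> inv t" by auto
    then have "inv u = t \<otimes> inv z \<otimes> inv t" using t PG by (simp add: word_simps)
    then show "inv u \<in> ?Q" using subgroup.m_inv_closed[OF P(1) z(1)] by auto
    fix v assume "v \<in> ?Q" then obtain z' where z': "z' \<in> P" "v = t \<otimes> z' \<otimes> inv t" by auto
    then have "u \<otimes> v = t \<otimes> (z \<otimes> z') \<otimes> inv t" using z t PG by (simp add: word_simps)
    then show "u \<otimes> v \<in> ?Q" using subgroup.m_closed[OF P(1) z(1) z'(1)] by auto
  qed
  have QC: "?Q \<subseteq> ?C"
  proof
    fix u assume "u \<in> ?Q" then obtain z where z: "z \<in> P" "u = t \<otimes> z \<otimes> inv t" by auto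
    have "u \<otimes> y = t \<otimes> (z \<otimes> x) \<otimes> inv t" using z t PG x by (simp add: y_def word_simps)
    also have "z \<otimes> x = x \<otimes> z" using comm[OF z(1) x] .
    also have "t \<otimes> (x \<otimes> z) \<otimes> inv t = y \<otimes> u" using z t PG x by (simp add: y_def word_simps)
    finally show "u \<in> ?C" using z t PG by simp
  qed
  have "inj_on (\<lambda>z. t \<otimes> z \<otimes> inv t) P"
    by (rule inj_on_inverseI[where g = "\<lambda>z. inv t \<otimes> z \<otimes> t"]) (use t PG in \<open>simp add: word_simps\<close>)
  then have cQ: "card ?Q = p ^ a" using P(2) by (simp add: card_image)
  have "card (rcosets\<^bsub>?G\<^esub> P) * card P = card ?C"
    using C.lagrange[of P] sub_iff[OF C] P(1) PC by (simp add: order_def)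
  moreover have "card (rcosets P) * card P = card (carrier G)" using lagrange[OF P(1)] by (simp add: order_def)
  ultimately have "card (rcosets\<^bsub>?G\<^esub> P) * card P dvd card (rcosets P) * card P"
    using card_dvd_carrier[OF C] by simp
  then have "card (rcosets\<^bsub>?G\<^esub> P) dvd card (rcosets P)"
    using sub_card_pos[OF P(1)] by simp
  then have nd: "\<not> p dvd card (rcosets\<^bsub>?G\<^esub> P)" using P(3) dvd_trans by blast
  have sC: "subgroup P ?G" "subgroup ?Q ?G" using sub_iff[OF C] P(1) PC Q QC by auto
  obtain c where c: "c \<in> carrier ?G" "\<And>q. q \<in> ?Q \<Longrightarrow> c \<otimes>\<^bsub>?G\<^esub> q \<otimes>\<^bsub>?G\<^esub> inv\<^bsub>?G\<^esub> c \<in> P"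
    using C.sylow_contains[OF sC(1) nd sC(2) cQ p] by blast
  have cG: "c \<in> carrier G" "c \<otimes> y = y \<otimes> c" using c(1) by auto
  have c2: "c \<otimes> q \<otimes> inv c \<in> P" if "q \<in> ?Q" for q using c(2)[OF that] m_inv_consistent[OF C] c(1) by simp
  have "(c \<otimes> t) \<otimes> x \<otimes> inv (c \<otimes> t) = x"
  proof (rule cent[OF _ _ x])
    show "c \<otimes> t \<in> carrier G" using cG t by simp
    fix z assume z: "z \<in> P"
    have "(c \<otimes> t) \<otimes> z \<otimes> inv (c \<otimes> t) = c \<otimes> (t \<otimes> z \<otimes> inv t) \<otimes> inv c"
      using cG t PG[OF z] by (simp add: word_simps)
    then show "(c \<otimes> t) \<otimes> z \<otimes> inv (c \<otimes> t) \<in> P" using c2[of "t \<otimes> z \<otimes> inv t"] z by simp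
  qed
  moreover have "(c \<otimes> t) \<otimes> x \<otimes> inv (c \<otimes> t) = (c \<otimes> y) \<otimes> inv c"
    using cG(1) t PG[OF x] by (simp add: y_def word_simps)
  moreover have "(c \<otimes> y) \<otimes> inv c = y" unfolding cG(2) using cG(1) y by (simp add: word_simps)
  ultimately show ?thesis by (simp add: y_def)
qed

text \<open>The transfer to P is the corestriction of the identity for the trivial action. It sends
  x to x^n, where n is the index of P, because x has no other conjugate in P. As p does not divide
  n, this is not 1.\<close>

lemma transfer_nontrivial:
  assumes P: "subgroup P G" "\<not> p dvd card (rcosets P)" and p: "prime p"
    and comm: "\<And>x y. x \<in> P \<Longrightarrow> y \<in> P \<Longrightarrow> x \<otimes> y = y \<otimes> x"
    and x: "x \<in> P" "x \<noteq> \<one>" "x [^] p = \<one>"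
    and fus: "\<And>t. t \<in> carrier G \<Longrightarrow> t \<otimes> x \<otimes> inv t \<in> P \<Longrightarrow> t \<otimes> x \<otimes> inv t = x"
  obtains V where "V \<in> hom G (G\<lparr>carrier := P\<rparr>)" "V x \<noteq> \<one>"
proof -
  let ?P = "G\<lparr>carrier := P\<rparr>"
  interpret A: comm_group ?P by (rule sub_comm_group[OF P(1) comm])
  have PG: "v \<in> carrier G" if "v \<in> P" for v using P(1) that subgroup.mem_carrier by metis
  have xG: "x \<in> carrier G" using PG x by auto
  obtain \<sigma> where sec: "\<And>c. c \<in> rcosets P \<Longrightarrow> \<sigma> c \<in> c" "\<And>c. c \<in> rcosets P \<Longrightarrow> \<sigma> c \<in> carrier G"
    using section_ex[OF P(1)] by blast
  define V where "V = corestriction ?P P (\<lambda>g a. a) (\<lambda>x. x) \<sigma>"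
  have Vc: "V g \<in> carrier ?P" if "g \<in> carrier G" for g unfolding V_def
    by (rule corestriction_crossed_hom(1)[OF P(1) A.comm_group_axioms _ _ _ _ sec(1) that]) (auto simp: hom_def)
  have Vm: "V (g \<otimes> h) = V g \<otimes>\<^bsub>?P\<^esub> V h" if "g \<in> carrier G" "h \<in> carrier G" for g h unfolding V_def
    by (rule corestriction_crossed_hom(2)[OF P(1) A.comm_group_axioms _ _ _ _ sec(1) that]) (auto simp: hom_def)
  have hom: "V \<in> hom G ?P" using Vc Vm by (auto simp: hom_def)
  define w where "w = (\<lambda>c. \<sigma> c \<otimes> x \<otimes> inv (\<sigma> (c #> x)))"
  have wP: "w c \<in> P" if "c \<in> rcosets P" for c
    unfolding w_def using rcoset_diff[OF P(1) rcoset_closed[OF P(1) that xG]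
        rcoset_mem_mult[OF P(1) that sec(1)[OF that] xG]] sec rcoset_closed[OF P(1) that xG] by simp
  have cx: "c #> x [^] (i::nat) \<in> rcosets P" if "c \<in> rcosets P" for c i
    using rcoset_closed[OF P(1) that] xG by simp
  have cxS: "(c #> x [^] (i::nat)) #> x = c #> x [^] (Suc i)" if "c \<in> rcosets P" for c i
    using rcoset_mult[OF P(1) that] xG by simp
  \<comment> \<open>Along c, c x, c x^2, ... each representative cancels against the inverse from
    the preceding factor.\<close>
  have tele: "finprod ?P (\<lambda>i. w (c #> x [^] i)) {..<n} = \<sigma> c \<otimes> x [^] n \<otimes> inv (\<sigma> (c #> x [^] n))"
    if c: "c \<in> rcosets P" for c and n :: nat
  proof (induction n)
    case 0
    then show ?case using sec(2)[OF c] coset_mult_one rcoset_sub[OF P(1) c] by simp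
  next
    case (Suc n)
    note cG = sec(2)[OF c] sec(2)[OF cx[OF c, of n]] sec(2)[OF cx[OF c, of "Suc n"]]
    have "finprod ?P (\<lambda>i. w (c #> x [^] i)) {..<Suc n} = w (c #> x [^] n) \<otimes> finprod ?P (\<lambda>i. w (c #> x [^] i)) {..<n}"
      using wP[OF cx[OF c]] by (simp add: lessThan_Suc)
    also have "\<dots> = finprod ?P (\<lambda>i. w (c #> x [^] i)) {..<n} \<otimes> w (c #> x [^] n)"
      using comm[OF wP[OF cx[OF c]], of "finprod ?P (\<lambda>i. w (c #> x [^] i)) {..<n}" n]
        A.finprod_closed[of "\<lambda>i. w (c #> x [^] i)" "{..<n}"] wP[OF cx[OF c]] by auto
    also have "\<dots> = \<sigma> c \<otimes> x [^] (Suc n) \<otimes> inv (\<sigma> (c #> x [^] (Suc n)))"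
    proof -
      have "w (c #> x [^] n) = \<sigma> (c #> x [^] n) \<otimes> x \<otimes> inv (\<sigma> (c #> x [^] (Suc n)))"
        unfolding w_def cxS[OF c] by simp
      then show ?thesis unfolding Suc using cG xG by (simp add: word_simps)
    qed
    finally show ?case .
  qed
  \<comment> \<open>a fixed coset contributes \<open>x\<close>, an orbit of length \<open>p\<close> contributes \<open>1 = x [^] p\<close> by telescoping\<close>
  have main: "finprod ?P w S = x [^] card S" if "finite S" "S \<subseteq> rcosets P" "\<And>c. c \<in> S \<Longrightarrow> c #> x \<in> S" for S
    using that
  proof (induction S rule: finite_psubset_induct)
    case (psubset S)
    have inj: "c = c'" if "c #> x = c' #> x" "c \<in> S" "c' \<in> S" for c c'
      using rcosets_shift_bij(1)[OF P(1) xG] that psubset.prems(1) by (auto dest: inj_onD)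
    show ?case
    proof (cases "S = {}")
      case True then show ?thesis by simp
    next
      case False
      then obtain c where c: "c \<in> S" by auto
      have cR: "c \<in> rcosets P" using c psubset.prems by auto
      show ?thesis
      proof (cases "c #> x = c")
        case True
        let ?S = "S - {c}"
        have "finprod ?P w ?S = x [^] card ?S"
        proof (rule psubset.IH)
          fix c' assume c': "c' \<in> ?S"
          then have "c' #> x \<noteq> c" using inj[of c' c] True c by auto
          then show "c' #> x \<in> ?S" using psubset.prems(2) c' by auto
        qed (use c psubset.prems in auto)
        moreover have "w c = x"
          unfolding w_def True by (rule fus[OF sec(2)[OF cR]]) (use wP[OF cR] True in \<open>simp add: w_def\<close>)
        moreover have "S = insert c ?S" using c by auto
        moreover have "finprod ?P w (insert c ?S) = w c \<otimes> finprod ?P w ?S"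
          using psubset.hyps wP psubset.prems(1) c by (subst A.finprod_insert) auto
        moreover have "card S = Suc (card ?S)" by (rule card.remove[OF psubset.hyps c])
        ultimately show ?thesis using xG nat_pow_Suc2[OF xG, of "card ?S"] by metis
      next
        case ne: False
        let ?o = "\<lambda>i::nat. c #> x [^] i"
        let ?O = "?o ` {..<p}"
        have oS: "?o i \<in> S" for i
        proof (induction i)
          case 0 then show ?case using c coset_mult_one rcoset_sub[OF P(1) cR] by simp
        next
          case (Suc i) then show ?case using psubset.prems(2)[OF Suc] cxS[OF cR] by simp
        qed
        have op: "?o (i + p) = ?o i" for i using x(3) xG by (simp add: nat_pow_mult[symmetric])
        have o_mod: "?o i \<in> ?O" for i
        proof -
          have "x [^] i = x [^] (p * (i div p)) \<otimes> x [^] (i mod p)" using xG by (simp add: nat_pow_mult)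
          also have "x [^] (p * (i div p)) = \<one>" using nat_pow_pow[OF xG, of p "i div p"] x(3) by simp
          finally have "x [^] i = x [^] (i mod p)" using xG by simp
          then show ?thesis using prime_gt_0_nat[OF p] by simp
        qed
        have o_inj: "inj_on ?o {..<p}"
        proof -
          have False if ij: "i < j" "j < p" "?o i = ?o j" for i j
          proof -
            have "c #> (x [^] (j - i)) = (c #> x [^] j) #> inv (x [^] i)"
            proof -
              have "x [^] j = x [^] (j - i) \<otimes> x [^] i" using ij xG by (simp add: nat_pow_mult)
              then show ?thesis using rcoset_mult[OF P(1) cR] xG by (simp add: word_simps)
            qed
            also have "\<dots> = (c #> x [^] i) #> inv (x [^] i)" using ij by simp
            also have "\<dots> = c" using rcoset_mult[OF P(1) cR] xG rcoset_sub[OF P(1) cR] by simp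
            finally have fx: "c #> (x [^] (j - i)) = c" .
            have fxk: "c #> ((x [^] (j - i)) [^] k) = c" for k :: nat
            proof (induction k)
              case 0 then show ?case using rcoset_sub[OF P(1) cR] by simp
            next
              case (Suc k)
              have "c #> ((x [^] (j - i)) [^] Suc k) = (c #> ((x [^] (j - i)) [^] k)) #> (x [^] (j - i))"
                using rcoset_mult[OF P(1) cR] xG by simp
              then show ?case using Suc fx by simp
            qed
            have "\<not> p dvd j - i" using ij by (auto dest: dvd_imp_le)
            then have "coprime (j - i) p" using p prime_imp_coprime coprime_commute by blast
            then obtain k :: nat where "(x [^] (j - i)) [^] k = x" using pow_coprime_bij[OF xG _ x(3)] by metis
            then show False using fxk[of k] ne by simp
          qed
          then show ?thesis by (intro inj_onI) (metis lessThan_iff linorder_neqE_nat)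
        qed
        let ?S = "S - ?O"
        have OS: "?O \<subseteq> S" using oS by auto
        have cO: "c \<in> ?O" using o_mod[of 0] rcoset_sub[OF P(1) cR] by simp
        have IH: "finprod ?P w ?S = x [^] card ?S"
        proof (rule psubset.IH)
          fix c' assume c': "c' \<in> ?S"
          have "c' #> x \<notin> ?O"
          proof
            assume "c' #> x \<in> ?O"
            then obtain i where "c' #> x = ?o i" by auto
            \<comment> \<open>Shifting by a full period gives every point of the orbit a
              predecessor, also the one with i = 0.\<close>
            then have "c' #> x = ?o (i + p)" using op by simp
            then have "c' #> x = ?o (i + p - 1) #> x"
              using cxS[OF cR, of "i + p - 1"] prime_gt_0_nat[OF p] by simp
            then have "c' = ?o (i + p - 1)" using inj[OF _ _ oS] c' by auto
            then show False using o_mod c' by blast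
          qed
          then show "c' #> x \<in> ?S" using psubset.prems(2) c' by auto
        qed (use c cO psubset.prems in auto)
        have wS: "w \<in> ?O \<rightarrow> P" "w \<in> ?S \<rightarrow> P" using wP OS psubset.prems(1) by auto
        have "finprod ?P w ?O = finprod ?P (\<lambda>i. w (?o i)) {..<p}"
          using o_inj wS by (intro A.finprod_reindex) auto
        also have "\<dots> = \<one>" unfolding tele[OF cR] using x(3) op[of 0] rcoset_sub[OF P(1) cR] sec(2)[OF cR] by simp
        finally have "finprod ?P w ?O = \<one>" .
        moreover have "finprod ?P w (?O \<union> ?S) = finprod ?P w ?O \<otimes>\<^bsub>?P\<^esub> finprod ?P w ?S"
          using wS psubset.hyps by (intro A.finprod_Un_disjoint) auto
        moreover have "?O \<union> ?S = S" using OS by auto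
        ultimately have "finprod ?P w S = x [^] card ?S" using IH xG by simp
        moreover have "card S = p + card ?S"
          using card_Diff_subset[OF _ OS] card_mono[OF psubset.hyps OS] card_image[OF o_inj] by simp
        ultimately show ?thesis using xG x(3) by (simp add: nat_pow_mult[symmetric])
      qed
    qed
  qed
  let ?n = "card (rcosets P)"
  have Vx: "V x = x [^] ?n"
    using main[OF rcosets_fin[OF P(1)] subset_refl rcoset_closed[OF P(1) _ xG]]
    by (simp add: V_def corestriction_def w_def)
  have "coprime ?n p" using P(2) p prime_imp_coprime coprime_commute by blast
  then obtain k :: nat where "(x [^] ?n) [^] k = x" using pow_coprime_bij[OF xG _ x(3)] by metis
  then have "x [^] ?n \<noteq> \<one>" using x(2) by auto
  then show thesis using that[OF hom] Vx by simp
qed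

lemma elementary_p_subgroups_if_proper:
  assumes proper: "\<And>H. subgroup H G \<Longrightarrow> H \<noteq> carrier G \<Longrightarrow> elementary_p_subgroups (G\<lparr>carrier := H\<rparr>)"
    and np: "\<And>p k. prime p \<Longrightarrow> card (carrier G) \<noteq> p ^ k"
  shows "elementary_p_subgroups G"
  unfolding elementary_p_subgroups_def
proof (intro allI impI ballI)
  fix p :: nat and S x assume S: "prime p" "subgroup S G" "\<exists>k. card S = p ^ k" "x \<in> S"
  then have ne: "S \<noteq> carrier G" using np by auto
  interpret S: finite_group "G\<lparr>carrier := S\<rparr>" by (rule sub_group[OF S(2)])
  obtain k where k: "card S = p ^ k" using S(3) by auto
  have "subgroup S (G\<lparr>carrier := S\<rparr>)" using sub_iff[OF S(2)] S(2) by auto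
  note e = S.elementary_p_subgroupsD[OF proper[OF S(2) ne] S(1) this k S(4)]
  show "x [^] p = \<one> \<and> (\<forall>y\<in>S. x \<otimes> y = y \<otimes> x)"
    using e nat_pow_consistent[of x p S] by simp
qed

text \<open>Let P be a Sylow subgroup for the smallest prime divisor p. If P is not normal, its
  normalizer is proper, hence complemented, and P is central there by the choice of p. So no two
  elements of P are fused by an element moving one to the other, and the transfer to P is
  nontrivial. Its kernel is the required subgroup; it is not 1 because P is smaller than the
  group.\<close>

theorem nonsimple_if_proper_elementary_supersolvable:
  assumes proper: "\<And>H. subgroup H G \<Longrightarrow> H \<noteq> carrier G \<Longrightarrow> elementary_supersolvable (G\<lparr>carrier := H\<rparr>)"
    and np: "\<And>p k. prime p \<Longrightarrow> card (carrier G) \<noteq> p ^ k"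
  obtains N where "N \<lhd> G" "N \<noteq> {\<one>}" "N \<noteq> carrier G"
proof -
  have el: "elementary_p_subgroups G"
    using elementary_p_subgroups_if_proper proper np by (simp add: elementary_supersolvable_def)
  have "card (carrier G) \<noteq> 1" using np[of 2 0] by simp
  then have ex: "\<exists>q. prime q \<and> q dvd card (carrier G)" using prime_factor_nat by blast
  define p where "p = (LEAST q. prime q \<and> q dvd card (carrier G))"
  have p: "prime p" "p dvd card (carrier G)" using LeastI_ex[OF ex] by (auto simp: p_def)
  have small: "p \<le> q" if "prime q" "q dvd card (carrier G)" for q
    unfolding p_def using that by (intro Least_le) auto
  obtain P a where P: "subgroup P G" "card P = p ^ a" "\<not> p dvd card (rcosets P)" using sylow_subgroup_obtain[OF p(1)] by blast
  have PG: "v \<in> carrier G" if "v \<in> P" for v using P(1) that subgroup.mem_carrier by metis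
  note eP = elementary_p_subgroupsD[OF el p(1) P(1,2)]
  have "a \<noteq> 0"
  proof
    assume "a = 0"
    then have "card (rcosets P) = card (carrier G)" using lagrange[OF P(1)] P(2) by (simp add: order_def)
    then show False using P(3) p(2) by simp
  qed
  then have cP: "card P \<noteq> 1" using P(2) prime_gt_1_nat[OF p(1)] by (metis nat_power_eq_Suc_0_iff One_nat_def nat_neq_iff)
  have P1: "P \<noteq> {\<one>}" using cP by auto
  have Pne: "P \<noteq> carrier G" using np p(1) P(2) by auto
  show thesis
  proof (cases "P \<lhd> G")
    case True then show ?thesis using that P1 Pne by blast
  next
    case False
    have cent: "n \<otimes> z \<otimes> inv n = z"
      if n: "n \<in> carrier G" "\<And>y. y \<in> P \<Longrightarrow> n \<otimes> y \<otimes> inv n \<in> P" and z: "z \<in> P" for n z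
    proof -
      let ?N = "{n \<in> carrier G. \<forall>y\<in>P. n \<otimes> y \<otimes> inv n \<in> P}"
      have N: "subgroup ?N G"
      proof (rule subgroupI)
        show "?N \<noteq> {}" using n by auto
        fix g assume g: "g \<in> ?N"
        have gG: "g \<in> carrier G" using g by simp
        have "inj_on (\<lambda>y. g \<otimes> y \<otimes> inv g) P"
          by (rule inj_on_inverseI[where g = "\<lambda>z. inv g \<otimes> z \<otimes> g"]) (use gG PG in \<open>simp add: word_simps\<close>)
        then have surj: "(\<lambda>y. g \<otimes> y \<otimes> inv g) ` P = P"
          using endo_inj_surj[OF sub_finite[OF P(1)], of "\<lambda>y. g \<otimes> y \<otimes> inv g"] g by blast
        have "inv g \<otimes> y \<otimes> inv (inv g) \<in> P" if y: "y \<in> P" for y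
        proof -
          obtain y' where y': "y' \<in> P" "y = g \<otimes> y' \<otimes> inv g" using surj y by blast
          then show ?thesis using gG PG by (simp add: word_simps)
        qed
        then show "inv g \<in> ?N" using gG by simp
        fix h assume h: "h \<in> ?N"
        have "g \<otimes> h \<otimes> y \<otimes> inv (g \<otimes> h) \<in> P" if y: "y \<in> P" for y
        proof -
          have "g \<otimes> h \<otimes> y \<otimes> inv (g \<otimes> h) = g \<otimes> (h \<otimes> y \<otimes> inv h) \<otimes> inv g"
            using gG h PG[OF y] by (simp add: word_simps)
          then show ?thesis using g h y by simp
        qed
        then show "g \<otimes> h \<in> ?N" using gG h by simp
      qed auto
      have "?N \<noteq> carrier G"
      proof
        assume "?N = carrier G"
        then have "\<forall>x\<in>carrier G. \<forall>h\<in>P. x \<otimes> h \<otimes> inv x \<in> P" by blast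
        then show False using \<open>\<not> P \<lhd> G\<close> P(1) normal_iff by blast
      qed
      then have XN: "elementary_supersolvable (G\<lparr>carrier := ?N\<rparr>)" using proper[OF N] by simp
      interpret N: finite_group "G\<lparr>carrier := ?N\<rparr>" by (rule sub_group[OF N])
      have PN: "P \<subseteq> ?N"
        using PG subgroup.m_closed[OF P(1)] subgroup.m_inv_closed[OF P(1)] by auto
      have nPN: "P \<lhd> G\<lparr>carrier := ?N\<rparr>" unfolding normal_sub_iff[OF N] using P(1) PN by auto
      have "n \<otimes>\<^bsub>G\<lparr>carrier := ?N\<rparr>\<^esub> z = z \<otimes>\<^bsub>G\<lparr>carrier := ?N\<rparr>\<^esub> n"
      proof (rule N.normal_p_subgroup_central[OF XN nPN P(2) p(1) _ z])
        show "n \<in> carrier (G\<lparr>carrier := ?N\<rparr>)" using n by simp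
        fix q :: nat assume q: "prime q" "q dvd card (carrier (G\<lparr>carrier := ?N\<rparr>))"
        then have "q dvd card (carrier G)" using card_dvd_carrier[OF N] dvd_trans by simp
        then show "p \<le> q" using small q(1) by simp
      qed
      then have "n \<otimes> z = z \<otimes> n" by simp
      then show ?thesis using n(1) PG[OF z] by (simp add: word_simps)
    qed
    obtain x where x: "x \<in> P" "x \<noteq> \<one>" using P1 subgroup.one_closed[OF P(1)] by blast
    have fus: "t \<otimes> x \<otimes> inv t = x" if "t \<in> carrier G" "t \<otimes> x \<otimes> inv t \<in> P" for t
      by (rule burnside_fusion[OF P p(1) eP(2) cent x(1) that])
    obtain V where V: "V \<in> hom G (G\<lparr>carrier := P\<rparr>)" "V x \<noteq> \<one>"
      using transfer_nontrivial[OF P(1,3) p(1) eP(2) x eP(1)[OF x(1)] fus] by blast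
    interpret V: group_hom G "G\<lparr>carrier := P\<rparr>" V
      using V(1) subgroup_imp_group[OF P(1)] is_group by (simp add: group_hom_def group_hom_axioms_def)
    let ?N = "kernel G (G\<lparr>carrier := P\<rparr>) V"
    have "?N \<noteq> {\<one>}"
    proof
      assume "?N = {\<one>}"
      then have "inj_on V (carrier G)" using V.trivial_ker_imp_inj by simp
      then have "card (carrier G) \<le> card P"
        using V.hom_closed sub_finite[OF P(1)] by (intro card_inj_on_le[of V]) auto
      then show False using sub_card_less[OF P(1) Pne] by simp
    qed
    moreover have "?N \<noteq> carrier G" using V(2) PG[OF x(1)] by (auto simp: kernel_def)
    ultimately show ?thesis using that V.normal_kernel by blast
  qed
qed

end

section \<open>Shelling the coset poset of a complemented group\<close>

locale complemented_series = finite_group G for G (structure) +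
  fixes d :: nat and N M :: "nat \<Rightarrow> 'a set"
  assumes N_zero: "N 0 = {\<one>}" and N_top: "N d = carrier G"
    and N_normal: "i \<le> d \<Longrightarrow> N i \<lhd> G"
    and N_step: "i < d \<Longrightarrow> N i \<subseteq> N (Suc i)"
    and N_prime: "i < d \<Longrightarrow> \<exists>p. prime p \<and> card (N (Suc i)) = p * card (N i)"
    and M_subgroup: "i < d \<Longrightarrow> subgroup (M i) G"
    and N_le_M: "i < d \<Longrightarrow> N i \<subseteq> M i"
    and M_int_N: "i < d \<Longrightarrow> M i \<inter> N (Suc i) = N i"
    and N_mult_M: "i < d \<Longrightarrow> N (Suc i) <#> M i = carrier G"

text \<open>Induction over a normal subgroup V of prime order with complement K. The series and the
  complements of K are pulled back as V N_i and V M_i; the first factor V is complemented by K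
  itself.\<close>

lemma complemented_series_ex:
  assumes "finite_group G" "elementary_supersolvable G"
  shows "\<exists>d N M. complemented_series G d N M"
  using assms
proof (induction "card (carrier G)" arbitrary: G rule: less_induct)
  case less
  interpret finite_group G by (rule less.prems(1))
  show ?case
  proof (cases "carrier G = {\<one>\<^bsub>G\<^esub>}")
    case True
    have "complemented_series G 0 (\<lambda>_. {\<one>\<^bsub>G\<^esub>}) (\<lambda>_. {})"
      by (intro complemented_series.intro complemented_series_axioms.intro finite_group_axioms)
        (use True one_is_normal in simp_all)
    then show ?thesis by blast
  next
    case False
    have el: "has_prime_series G" "elementary_p_subgroups G" using less.prems(2) by (auto simp: elementary_supersolvable_def)
    have "carrier G \<lhd> G" by (rule normal_self)
    then obtain V where V: "V \<lhd> G" "prime (card V)" using prime_order_normal_ex[OF el(1) _ False] by blast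
    then obtain K where K: "subgroup K G" "V \<inter> K = {\<one>\<^bsub>G\<^esub>}" "V <#>\<^bsub>G\<^esub> K = carrier G"
      using normal_p_subgroup_complement[OF el(2) V(1), of "card V" 1] by auto
    have Vs: "subgroup V G" using V normal_imp_subgroup by auto
    have VG: "v \<in> carrier G" if "v \<in> V" for v using Vs that subgroup.mem_carrier by metis
    have KG: "v \<in> carrier G" if "v \<in> K" for v using K that subgroup.mem_carrier by metis
    have "card (carrier G) = card V * card K" using card_set_mult_disjoint[OF Vs K(1,2)] K(3) by simp
    then have "card K < card (carrier G)" using V(2) prime_gt_1_nat[OF V(2)] sub_card_pos[OF K(1)] by simp
    then obtain d N M where "complemented_series (G\<lparr>carrier := K\<rparr>) d N M"
      using less.hyps[of "G\<lparr>carrier := K\<rparr>"] sub_group[OF K(1)] elementary_supersolvable_sub[OF less.prems(2) K(1)] by auto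
    then interpret K: complemented_series "G\<lparr>carrier := K\<rparr>" d N M .
    let ?N = "\<lambda>i. case i of 0 \<Rightarrow> {\<one>\<^bsub>G\<^esub>} | Suc i \<Rightarrow> V <#>\<^bsub>G\<^esub> N i"
    let ?M = "\<lambda>i. case i of 0 \<Rightarrow> K | Suc i \<Rightarrow> V <#>\<^bsub>G\<^esub> M i"
    have Ns: "subgroup (N i) G" "N i \<subseteq> K" if "i \<le> d" for i
      using K.N_normal[OF that] normal_sub_iff[OF K(1)] by auto
    have Ms: "subgroup (M i) G" "M i \<subseteq> K" if "i < d" for i
      using K.M_subgroup[OF that] sub_iff[OF K(1)] by auto
    have c: "card (V <#>\<^bsub>G\<^esub> N i) = card V * card (N i)" if "i \<le> d" for i
      using card_set_mult_disjoint[OF Vs Ns(1)[OF that]] Ns[OF that] K(2) subgroup.one_closed[OF Vs]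
        subgroup.one_closed[OF Ns(1)[OF that]] by blast
    have V1: "V <#>\<^bsub>G\<^esub> N 0 = V" using K.N_zero subgroup.subset[OF Vs] by (force simp: set_mult_def)
    have "complemented_series G (Suc d) ?N ?M"
    proof (intro complemented_series.intro complemented_series_axioms.intro finite_group_axioms)
      fix i assume i: "i < Suc d"
      show "?N i \<subseteq> ?N (Suc i)"
      proof (cases i)
        case 0 then show ?thesis using V1 subgroup.one_closed[OF Vs] by simp
      next
        case (Suc j) then show ?thesis using mono_set_mult[of V V "N j" "N i"] K.N_step[of j] i by auto
      qed
      show "\<exists>p. prime p \<and> card (?N (Suc i)) = p * card (?N i)"
      proof (cases i)
        case 0 then show ?thesis using V1 V(2) by auto
      next
        case (Suc j) then show ?thesis using K.N_prime[of j] i c[of i] c[of j] by auto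
      qed
      show "subgroup (?M i) G" using K(1) normal_mult_subgroup[OF V(1) Ms(1)] i by (cases i) auto
      show "?N i \<subseteq> ?M i"
      proof (cases i)
        case 0 then show ?thesis using subgroup.one_closed[OF K(1)] by simp
      next
        case (Suc j) then show ?thesis using mono_set_mult[of V V "N j" "M j"] K.N_le_M[of j] i by auto
      qed
      show "?M i \<inter> ?N (Suc i) = ?N i"
      proof (cases i)
        case 0 then show ?thesis using V1 K(2) by auto
      next
        case (Suc j)
        then have j: "j < d" using i by simp
        \<comment> \<open>Factorizations in V K are unique, so the claim reduces to the
          corresponding one in K.\<close>
        have "(V <#>\<^bsub>G\<^esub> M j) \<inter> (V <#>\<^bsub>G\<^esub> N (Suc j)) \<subseteq> V <#>\<^bsub>G\<^esub> N j"
        proof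
          fix x assume "x \<in> (V <#>\<^bsub>G\<^esub> M j) \<inter> (V <#>\<^bsub>G\<^esub> N (Suc j))"
          then obtain v m v' n where x: "v \<in> V" "m \<in> M j" "x = v \<otimes>\<^bsub>G\<^esub> m" "v' \<in> V" "n \<in> N (Suc j)"
            "x = v' \<otimes>\<^bsub>G\<^esub> n" unfolding set_mult_iff Int_iff by blast
          have mn: "m \<in> K" "n \<in> K" using x Ms[OF j] Ns[of "Suc j"] j by auto
          note cG = VG[OF x(1)] VG[OF x(4)] KG[OF mn(1)] KG[OF mn(2)]
          have "inv\<^bsub>G\<^esub> v' \<otimes>\<^bsub>G\<^esub> v = inv\<^bsub>G\<^esub> v' \<otimes>\<^bsub>G\<^esub> (v \<otimes>\<^bsub>G\<^esub> m) \<otimes>\<^bsub>G\<^esub> inv\<^bsub>G\<^esub> m"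
            using cG by (simp add: word_simps)
          also have "v \<otimes>\<^bsub>G\<^esub> m = v' \<otimes>\<^bsub>G\<^esub> n" using x by simp
          finally have e: "inv\<^bsub>G\<^esub> v' \<otimes>\<^bsub>G\<^esub> v = n \<otimes>\<^bsub>G\<^esub> inv\<^bsub>G\<^esub> m" using cG by (simp add: word_simps)
          have "n \<otimes>\<^bsub>G\<^esub> inv\<^bsub>G\<^esub> m \<in> K" using subgroup.m_closed[OF K(1) mn(2) subgroup.m_inv_closed[OF K(1) mn(1)]] .
          moreover have "inv\<^bsub>G\<^esub> v' \<otimes>\<^bsub>G\<^esub> v \<in> V" using subgroup.m_closed[OF Vs subgroup.m_inv_closed[OF Vs x(4)] x(1)] .
          ultimately have "n \<otimes>\<^bsub>G\<^esub> inv\<^bsub>G\<^esub> m = \<one>\<^bsub>G\<^esub>" using e K(2) by auto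
          then have "n = m" using cG by (metis inv_equality inv_inv inv_closed)
          then have "m \<in> N j" using x K.M_int_N[OF j] by auto
          then show "x \<in> V <#>\<^bsub>G\<^esub> N j" using x mult_mem by simp
        qed
        moreover have "V <#>\<^bsub>G\<^esub> N j \<subseteq> (V <#>\<^bsub>G\<^esub> M j) \<inter> (V <#>\<^bsub>G\<^esub> N (Suc j))"
          using mono_set_mult[of V V "N j" "M j"] mono_set_mult[of V V "N j" "N (Suc j)"] K.N_le_M[OF j] K.N_step[OF j]
          by auto
        ultimately show ?thesis using Suc by auto
      qed
      show "?N (Suc i) <#>\<^bsub>G\<^esub> ?M i = carrier G"
      proof (cases i)
        case 0 then show ?thesis using V1 K(3) by simp
      next
        case (Suc j)
        then have j: "j < d" using i by simp
        have s: "subgroup (V <#>\<^bsub>G\<^esub> N (Suc j)) G" "subgroup (V <#>\<^bsub>G\<^esub> M j) G"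
          using normal_mult_subgroup[OF V(1)] Ns[of "Suc j"] Ms[OF j] j by auto
        have "carrier G \<subseteq> (V <#>\<^bsub>G\<^esub> N (Suc j)) <#>\<^bsub>G\<^esub> (V <#>\<^bsub>G\<^esub> M j)"
        proof
          fix g assume "g \<in> carrier G"
          then obtain v k where g: "v \<in> V" "k \<in> K" "g = v \<otimes>\<^bsub>G\<^esub> k" using K(3) set_mult_iff by blast
          have "k \<in> N (Suc j) <#>\<^bsub>G\<^esub> M j" using K.N_mult_M[OF j] g by simp
          then obtain n m where nm: "n \<in> N (Suc j)" "m \<in> M j" "k = n \<otimes>\<^bsub>G\<^esub> m" using set_mult_iff by blast
          have "n \<in> carrier G" "m \<in> carrier G" using nm KG Ns[of "Suc j"] Ms[OF j] j by auto
          then have "g = (v \<otimes>\<^bsub>G\<^esub> n) \<otimes>\<^bsub>G\<^esub> m" using g nm VG by (simp add: m_assoc)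
          moreover have "m \<in> V <#>\<^bsub>G\<^esub> M j" using sub_set_mult2[OF Vs subgroup.subset[OF Ms(1)[OF j]]] nm by auto
          ultimately show "g \<in> (V <#>\<^bsub>G\<^esub> N (Suc j)) <#>\<^bsub>G\<^esub> (V <#>\<^bsub>G\<^esub> M j)"
            using mult_mem[OF g(1) nm(1)] mult_mem by metis
        qed
        then show ?thesis using set_mult_closed[OF subgroup.subset[OF s(1)] subgroup.subset[OF s(2)]] Suc by auto
      qed
    next
      fix i assume "i \<le> Suc d"
      then show "?N i \<lhd> G" using one_is_normal normal_lift[OF V(1) K(1,3) K.N_normal] by (cases i) auto
    qed (use K.N_top K in auto)
    then show ?thesis by blast
  qed
qed

section \<open>Cosets and their stabilizers\<close>

context finite_group begin

text \<open>The set A A^-1, which for a right coset H x is H: the subgroup is recovered without a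
  choice of representative.\<close>

definition stab :: "'a set \<Rightarrow> 'a set" where
  "stab A = {a \<otimes> inv b | a b. a \<in> A \<and> b \<in> A}"

definition is_coset :: "'a set \<Rightarrow> bool" where
  "is_coset A \<longleftrightarrow> (\<exists>H x. subgroup H G \<and> x \<in> carrier G \<and> A = H #> x)"

lemma is_coset_carrier: "is_coset (carrier G)"
  unfolding is_coset_def
  by (intro exI[of _ "carrier G"] exI[of _ \<one>]) (simp add: subgroup_self)

lemma coset_poset_carrier_iff: "A \<in> carrier (coset_poset G) \<longleftrightarrow> is_coset A \<and> A \<noteq> carrier G"
proof
  assume "A \<in> carrier (coset_poset G)"
  then obtain H x where H: "subgroup H G" "H \<noteq> carrier G" "x \<in> carrier G" "A = H #> x"
    by (auto simp: coset_poset_def RCOSETS_def)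
  have "A \<noteq> carrier G"
  proof
    assume "A = carrier G"
    then have "H #> \<one> = H #> x" using H repr_independence[OF _ H(3,1), of \<one>] by simp
    then have "H = carrier G" using H \<open>A = carrier G\<close> subgroup.subset[OF H(1)] by simp
    then show False using H by simp
  qed
  then show "is_coset A \<and> A \<noteq> carrier G" using H by (auto simp: is_coset_def)
next
  assume A: "is_coset A \<and> A \<noteq> carrier G"
  then obtain H x where H: "subgroup H G" "x \<in> carrier G" "A = H #> x" by (auto simp: is_coset_def)
  have "H \<noteq> carrier G" using A H coset_join2[OF H(2) subgroup_self] by auto
  then show "A \<in> carrier (coset_poset G)" using H by (auto simp: coset_poset_def RCOSETS_def)
qed

lemma coset_stab:
  assumes "subgroup H G" "x \<in> carrier G" shows "stab (H #> x) = H"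
proof
  have HG: "h \<in> carrier G" if "h \<in> H" for h using assms that subgroup.mem_carrier by metis
  show "stab (H #> x) \<subseteq> H"
    using rcoset_diff[OF assms(1) rcosetsI[OF subgroup.subset[OF assms(1)] assms(2)]] by (auto simp: stab_def)
  show "H \<subseteq> stab (H #> x)"
  proof
    fix h assume h: "h \<in> H"
    have "h \<otimes> x \<in> H #> x" "x \<in> H #> x" using h rcos_self[OF assms(2,1)] by (auto simp: r_coset_def)
    moreover have "h = (h \<otimes> x) \<otimes> inv x" using HG[OF h] assms by (simp add: word_simps)
    ultimately show "h \<in> stab (H #> x)" unfolding stab_def by blast
  qed
qed

lemma stab_subgroup: "is_coset A \<Longrightarrow> subgroup (stab A) G"
  unfolding is_coset_def using coset_stab by auto

lemma coset_eq_stab: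
  assumes "is_coset A" "y \<in> A" shows "A = stab A #> y" "y \<in> carrier G"
proof -
  obtain H x where H: "subgroup H G" "x \<in> carrier G" "A = H #> x" using assms by (auto simp: is_coset_def)
  then show "A = stab A #> y" using coset_stab repr_independence[OF _ H(2,1)] assms by simp
  show "y \<in> carrier G" using H r_coset_subset_G[OF subgroup.subset[OF H(1)] H(2)] assms by auto
qed

lemma coset_nonempty: "is_coset A \<Longrightarrow> \<exists>y. y \<in> A"
  unfolding is_coset_def using rcos_self by blast

lemma coset_subset: "is_coset A \<Longrightarrow> A \<subseteq> carrier G"
  using coset_eq_stab(2) by auto

lemma stab_mono: "A \<subseteq> B \<Longrightarrow> stab A \<subseteq> stab B" by (auto simp: stab_def)

lemma stab_least: "subgroup L G \<Longrightarrow> A \<subseteq> L \<Longrightarrow> stab A \<subseteq> L"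
  by (auto simp: stab_def subset_iff subgroup.m_closed subgroup.m_inv_closed)

lemma is_cosetI: "subgroup H G \<Longrightarrow> x \<in> carrier G \<Longrightarrow> is_coset (H #> x)"
  unfolding is_coset_def by blast

lemma coset_subsetI:
  assumes "is_coset A" "is_coset B" "y \<in> A" "y \<in> B" "stab A \<subseteq> stab B" shows "A \<subseteq> B"
  using coset_eq_stab(1)[OF assms(1,3)] coset_eq_stab(1)[OF assms(2,4)] assms(5) unfolding r_coset_def by blast

lemma coset_eqI:
  assumes "is_coset A" "is_coset B" "A \<subseteq> B" "stab B \<subseteq> stab A" shows "A = B"
proof -
  obtain y where "y \<in> A" using coset_nonempty assms by blast
  then show ?thesis using coset_subsetI[OF assms(2,1)] assms by blast
qed

lemma sub_inter_prod:
  assumes "subgroup H G" "subgroup K G" "K \<subseteq> H" "N \<lhd> G" shows "subgroup ((H \<inter> N) <#> K) G" "(H \<inter> N) <#> K \<subseteq> H"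
proof -
  have Ns: "subgroup N G" using assms normal_imp_subgroup by auto
  interpret H: finite_group "G\<lparr>carrier := H\<rparr>" by (rule sub_group[OF assms(1)])
  have "H \<inter> N \<lhd> G\<lparr>carrier := H\<rparr>" unfolding normal_sub_iff[OF assms(1)]
    using subgroups_Inter_pair[OF assms(1) Ns] conj_closed[OF assms(4)] subgroup.m_closed[OF assms(1)]
      subgroup.m_inv_closed[OF assms(1)] subgroup.subset[OF assms(1)] by auto
  then have "subgroup ((H \<inter> N) <#> K) (G\<lparr>carrier := H\<rparr>)"
    using H.normal_mult_subgroup sub_iff[OF assms(1)] assms by fastforce
  then show "subgroup ((H \<inter> N) <#> K) G" "(H \<inter> N) <#> K \<subseteq> H" using sub_iff[OF assms(1)] by auto
qed

end

section \<open>Types of cosets and the labelling of covers\<close>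

context complemented_series begin

text \<open>
  The factors of the series that are met by \<open>H\<close>; the order of \<open>H\<close> is the product of the orders of
  these factors.
\<close>

definition T :: "'a set \<Rightarrow> nat set" where
  "T H = {i. i < d \<and> (\<exists>x\<in>H. x \<in> N (Suc i) - N i)}"

lemma finite_T: "finite (T H)" by (simp add: T_def)

lemma T_mono: "H \<subseteq> K \<Longrightarrow> T H \<subseteq> T K" by (auto simp: T_def)

lemma T_less: "i \<in> T H \<Longrightarrow> i < d" by (simp add: T_def)

lemma N_subgroup: "i \<le> d \<Longrightarrow> subgroup (N i) G" using N_normal normal_imp_subgroup by auto

lemma N_mono: "i \<le> j \<Longrightarrow> j \<le> d \<Longrightarrow> N i \<subseteq> N j"
  by (induction j rule: dec_induct) (use N_step in \<open>auto simp: less_eq_Suc_le\<close>)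

lemma T_one: "T {\<one>} = {}" using subgroup.one_closed[OF N_subgroup] by (auto simp: T_def)

text \<open>The factor has prime order, so H covers it as soon as H meets it.\<close>

lemma N_Suc_eq_mult:
  assumes H: "subgroup H G" and i: "i \<in> T H" shows "N (Suc i) = N i <#> (H \<inter> N (Suc i))"
proof -
  have id: "i < d" "i \<le> d" "Suc i \<le> d" using T_less[OF i] by auto
  obtain p where p: "prime p" "card (N (Suc i)) = p * card (N i)" using N_prime[OF id(1)] by auto
  have HN: "subgroup (H \<inter> N (Suc i)) G" using subgroups_Inter_pair[OF H N_subgroup[OF id(3)]] .
  let ?L = "N i <#> (H \<inter> N (Suc i))"
  have L: "subgroup ?L G" by (rule normal_mult_subgroup[OF N_normal[OF id(2)] HN])
  have "N i \<subseteq> ?L" by (rule sub_set_mult1[OF HN subgroup.subset[OF N_subgroup[OF id(2)]]])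
  moreover have "?L \<subseteq> N (Suc i)" by (rule set_mult_least[OF N_subgroup[OF id(3)] N_step[OF id(1)]]) simp
  ultimately have "?L = N i \<or> ?L = N (Suc i)"
    by (rule prime_between[OF N_subgroup[OF id(2)] L N_subgroup[OF id(3)] _ _ p(2,1)])
  moreover have "H \<inter> N (Suc i) \<subseteq> ?L" by (rule sub_set_mult2[OF N_subgroup[OF id(2)] subgroup.subset[OF HN]])
  ultimately show ?thesis using i by (auto simp: T_def)
qed

text \<open>Induction along the series shows K \<inter> N_i \<subseteq> H. An element x of K that
  lies in N_(i+1) but not in N_i has the form n l with n \<in> N_i and l \<in> H, because H covers
  the factor. Then n = x l^-1 lies in K \<inter> N_i, hence in H.\<close>

lemma T_eq:
  assumes H: "subgroup H G" and K: "subgroup K G" and HK: "H \<subseteq> K" and T: "T K \<subseteq> T H" shows "H = K"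
proof -
  have "K \<inter> N i \<subseteq> H" if "i \<le> d" for i
    using that
  proof (induction i)
    case 0
    then show ?case using N_zero subgroup.one_closed[OF H] by auto
  next
    case (Suc i)
    show ?case
    proof
      fix x assume x: "x \<in> K \<inter> N (Suc i)"
      show "x \<in> H"
      proof (cases "x \<in> N i")
        case True then show ?thesis using Suc x by auto
      next
        case False
        then have "i \<in> T K" using x Suc.prems by (auto simp: T_def)
        then have "i \<in> T H" using T by auto
        then have "x \<in> N i <#> (H \<inter> N (Suc i))" using N_Suc_eq_mult[OF H] x by blast
        then obtain n l where nl: "n \<in> N i" "l \<in> H" "x = n \<otimes> l" using set_mult_iff by auto
        have c: "n \<in> carrier G" "l \<in> carrier G"
          using subgroup.mem_carrier[OF N_subgroup[of i]] subgroup.mem_carrier[OF H] nl Suc.prems by auto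
        then have "n = x \<otimes> inv l" using nl by (simp add: word_simps)
        moreover have "x \<otimes> inv l \<in> K" using subgroup.m_closed[OF K] subgroup.m_inv_closed[OF K] x nl(2) HK by blast
        ultimately have "n \<in> H" using Suc nl(1) by auto
        then show ?thesis using nl subgroup.m_closed[OF H] by auto
      qed
    qed
  qed
  from this[of d] show ?thesis using N_top subgroup.subset[OF K] HK by auto
qed

text \<open>The product contains K and H \<inter> N_i, hence meets every factor that H meets. Thus
  types below i that are gained from K to H can be gained inside N_i.\<close>

lemma T_prod:
  assumes H: "subgroup H G" and K: "subgroup K G" "K \<subseteq> H" and i: "i \<le> d" "T H - T K \<subseteq> {..<i}"
  shows "(H \<inter> N i) <#> K = H"
proof (rule T_eq)
  have Ni: "subgroup (H \<inter> N i) G" using subgroups_Inter_pair[OF H N_subgroup[OF i(1)]] .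
  let ?L = "(H \<inter> N i) <#> K"
  show "subgroup ?L G" "?L \<subseteq> H" using sub_inter_prod[OF H K N_normal[OF i(1)]] by auto
  have s: "H \<inter> N i \<subseteq> ?L" "K \<subseteq> ?L"
    using sub_set_mult1[OF K(1) subgroup.subset[OF Ni]] sub_set_mult2[OF Ni subgroup.subset[OF K(1)]] by auto
  show "T H \<subseteq> T ?L"
  proof
    fix j assume j: "j \<in> T H"
    show "j \<in> T ?L"
    proof (cases "j \<in> T K")
      case True then show ?thesis using T_mono[OF s(2)] by auto
    next
      case False
      then have "j < i" using i j by auto
      then have "N (Suc j) \<subseteq> N i" using N_mono i by auto
      then have "j \<in> T (H \<inter> N i)" using j by (auto simp: T_def)
      then show ?thesis using T_mono[OF s(1)] by auto
    qed
  qed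
qed (rule H)

text \<open>Multiplying k by an element of N_i changes neither membership in N_i nor membership in
  N_(i+1).\<close>

lemma T_prod_not:
  assumes K: "subgroup K G" and i: "i < d" "i \<notin> T K" shows "i \<notin> T ((H \<inter> N i) <#> K)"
proof
  assume "i \<in> T ((H \<inter> N i) <#> K)"
  then obtain n k where nk: "n \<in> N i" "k \<in> K" "n \<otimes> k \<in> N (Suc i)" "n \<otimes> k \<notin> N i"
    unfolding T_def set_mult_def by auto
  have s: "subgroup (N i) G" "subgroup (N (Suc i)) G" "n \<in> N (Suc i)" using N_subgroup N_step nk i by auto
  have c: "n \<in> carrier G" "k \<in> carrier G"
    using subgroup.mem_carrier[OF s(1)] subgroup.mem_carrier[OF K] nk by auto
  have "k = inv n \<otimes> (n \<otimes> k)" using c by (simp add: word_simps)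
  moreover have "inv n \<otimes> (n \<otimes> k) \<in> N (Suc i)"
    using subgroup.m_closed[OF s(2) subgroup.m_inv_closed[OF s(2,3)] nk(3)] .
  ultimately have "k \<in> N (Suc i)" by simp
  moreover have "k \<notin> N i" using subgroup.m_closed[OF s(1) nk(1)] nk(4) by blast
  ultimately show False using i nk by (auto simp: T_def)
qed

text \<open>H covers the factor i, so it can take the place of \<open>N (Suc i)\<close> in the
  factorization by \<open>M i\<close>.\<close>

lemma decompose_mult_M:
  assumes H: "subgroup H G" and i: "i \<in> T H" and g: "g \<in> carrier G"
  obtains t m where "t \<in> H" "t \<in> N (Suc i)" "m \<in> M i" "g = t \<otimes> m"
proof -
  have id: "i < d" "Suc i \<le> d" "i \<le> d" using T_less[OF i] by auto
  obtain n m where nm: "n \<in> N (Suc i)" "m \<in> M i" "g = n \<otimes> m" using N_mult_M[OF id(1)] g set_mult_iff by blast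
  have HN: "subgroup (H \<inter> N (Suc i)) G" using subgroups_Inter_pair[OF H N_subgroup[OF id(2)]] .
  have "n \<in> (H \<inter> N (Suc i)) <#> N i"
    using nm(1) N_Suc_eq_mult[OF H i] normal_mult_commute[OF N_normal[OF id(3)] HN] by simp
  then obtain t k where tk: "t \<in> H" "t \<in> N (Suc i)" "k \<in> N i" "n = t \<otimes> k" using set_mult_iff by auto
  have c: "t \<in> carrier G" "k \<in> carrier G" "m \<in> carrier G"
    using subgroup.mem_carrier[OF H] subgroup.mem_carrier[OF N_subgroup[OF id(3)]]
      subgroup.mem_carrier[OF M_subgroup[OF id(1)]] tk nm by auto
  have "k \<otimes> m \<in> M i" using subgroup.m_closed[OF M_subgroup[OF id(1)]] N_le_M[OF id(1)] tk nm by auto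
  moreover have "g = t \<otimes> (k \<otimes> m)" using c nm tk by (simp add: m_assoc)
  ultimately show thesis using that tk by blast
qed

text \<open>For k < i the term \<open>N (Suc k)\<close> is contained in \<open>M i\<close>. For k >
  i an element of type k is moved into \<open>M i\<close> by a factor from H and
  \<open>N (Suc i)\<close>, which lies in \<open>N k\<close> and leaves the type unchanged.\<close>

lemma T_inter_M:
  assumes H: "subgroup H G" and i: "i \<in> T H" shows "T (H \<inter> M i) = T H - {i}"
proof (intro equalityI subsetI)
  fix k assume k: "k \<in> T (H \<inter> M i)"
  then have "k \<noteq> i" using M_int_N[OF T_less[OF i]] by (auto simp: T_def)
  then show "k \<in> T H - {i}" using k T_mono[of "H \<inter> M i" H] by auto
next
  fix k assume k: "k \<in> T H - {i}"
  then obtain h where h: "h \<in> H" "h \<in> N (Suc k)" "h \<notin> N k" "k < d" by (auto simp: T_def)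
  have id: "i < d" using T_less[OF i] .
  show "k \<in> T (H \<inter> M i)"
  proof (cases "k < i")
    case True
    then have "h \<in> M i" using N_mono[of "Suc k" i] N_le_M[OF id] id h by auto
    then show ?thesis using h by (auto simp: T_def)
  next
    case False
    then have ik: "i < k" using k by auto
    have hG: "h \<in> carrier G" using subgroup.mem_carrier[OF H h(1)] .
    obtain t m where tm: "t \<in> H" "t \<in> N (Suc i)" "m \<in> M i" "h = t \<otimes> m" using decompose_mult_M[OF H i hG] by blast
    have s: "subgroup (N k) G" "subgroup (N (Suc k)) G" using N_subgroup h(4) by auto
    have t: "t \<in> N k" "t \<in> N (Suc k)" using N_mono[of "Suc i" k] N_mono[of "Suc i" "Suc k"] ik h(4) tm by auto
    have c: "t \<in> carrier G" "m \<in> carrier G"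
      using subgroup.mem_carrier[OF H] subgroup.mem_carrier[OF M_subgroup[OF id]] tm by auto
    have m: "m = inv t \<otimes> h" using c tm by (simp add: word_simps)
    have "m \<in> H" unfolding m using subgroup.m_closed[OF H subgroup.m_inv_closed[OF H tm(1)] h(1)] .
    moreover have "m \<in> N (Suc k)" unfolding m using subgroup.m_closed[OF s(2) subgroup.m_inv_closed[OF s(2) t(2)] h(2)] .
    moreover have "m \<notin> N k" using subgroup.m_closed[OF s(1) t(1)] tm(4) h(3) by blast
    ultimately show ?thesis using tm h(4) by (auto simp: T_def)
  qed
qed

text \<open>Since the stabilizer times \<open>M i\<close> is the whole group, A contains an element
  of \<open>M i\<close>. With it as representative the intersection is visibly a coset.\<close>

lemma coset_inter_M:
  assumes A: "is_coset A" and i: "i \<in> T (stab A)"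
  shows "is_coset (A \<inter> M i)" "stab (A \<inter> M i) = stab A \<inter> M i"
proof -
  note H = stab_subgroup[OF A]
  have id: "i < d" using T_less[OF i] .
  obtain x where x: "x \<in> A" using coset_nonempty[OF A] by blast
  then have xG: "x \<in> carrier G" using coset_subset[OF A] by auto
  obtain t m where tm: "t \<in> stab A" "m \<in> M i" "x = t \<otimes> m" using decompose_mult_M[OF H i xG] by blast
  have c: "t \<in> carrier G" "m \<in> carrier G"
    using subgroup.mem_carrier[OF H] subgroup.mem_carrier[OF M_subgroup[OF id]] tm by auto
  have m: "m = inv t \<otimes> x" using c tm by (simp add: word_simps)
  have "inv t \<otimes> x \<in> stab A #> x" using subgroup.m_inv_closed[OF H tm(1)] by (auto simp: r_coset_def)
  then have mA: "m \<in> A" using coset_eq_stab(1)[OF A x] m by simp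
  have HM: "subgroup (stab A \<inter> M i) G" using subgroups_Inter_pair[OF H M_subgroup[OF id]] .
  have "A \<inter> M i = (stab A \<inter> M i) #> m"
  proof (intro equalityI subsetI)
    fix y assume y: "y \<in> A \<inter> M i"
    then have "y \<otimes> inv m \<in> stab A" "y \<otimes> inv m \<in> M i"
      using mA tm subgroup.m_closed[OF M_subgroup[OF id]] subgroup.m_inv_closed[OF M_subgroup[OF id]]
      by (auto simp: stab_def)
    moreover have "y = (y \<otimes> inv m) \<otimes> m" using y c coset_subset[OF A] by (auto simp: word_simps)
    ultimately show "y \<in> (stab A \<inter> M i) #> m" unfolding r_coset_def by blast
  next
    fix y assume "y \<in> (stab A \<inter> M i) #> m"
    then obtain h where h: "h \<in> stab A" "h \<in> M i" "y = h \<otimes> m" by (auto simp: r_coset_def)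
    then have "y \<in> stab A #> m" by (auto simp: r_coset_def)
    then show "y \<in> A \<inter> M i" using coset_eq_stab(1)[OF A mA] h subgroup.m_closed[OF M_subgroup[OF id] h(2) tm(2)] by simp
  qed
  then show "is_coset (A \<inter> M i)" "stab (A \<inter> M i) = stab A \<inter> M i"
    using is_cosetI[OF HM c(2)] coset_stab[OF HM c(2)] by auto
qed

definition rank :: "'a set \<Rightarrow> nat" where "rank A = card (T (stab A))"

text \<open>Both values decrease with the type i. Covers cut out by \<open>M i\<close> get negative
  labels, the others positive ones because i < d. On a cover the difference of types is a singleton,
  and labels are compared on covers only.\<close>

definition label :: "'a set \<Rightarrow> 'a set \<Rightarrow> int" where
  "label A B = (let i = THE i. i \<in> T (stab A) - T (stab B) in
    if B = A \<inter> M i then - int i - 1 else int d - int i)"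

definition cover :: "'a set \<Rightarrow> 'a set \<Rightarrow> bool" where
  "cover A B \<longleftrightarrow> A \<in> carrier (coset_poset G) \<and> B \<in> insert (carrier G) (carrier (coset_poset G)) \<and> A \<subset> B \<and>
    rank B = Suc (rank A)"

lemma insert_top_iff: "A \<in> insert (carrier G) (carrier (coset_poset G)) \<longleftrightarrow> is_coset A"
  using coset_poset_carrier_iff is_coset_carrier by auto

lemma coset_psubset_mem: "is_coset A \<Longrightarrow> is_coset B \<Longrightarrow> A \<subset> B \<Longrightarrow> A \<in> carrier (coset_poset G)"
  using coset_poset_carrier_iff[of A] coset_subset[of B] by auto

lemma coset_T_less:
  assumes "is_coset A" "is_coset B" "A \<subset> B" shows "T (stab A) \<subset> T (stab B)"
proof -
  have "stab A \<subseteq> stab B" using stab_mono assms by auto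
  moreover have "\<not> stab B \<subseteq> stab A" using coset_eqI[OF assms(1,2)] assms(3) by auto
  ultimately show ?thesis using T_mono T_eq[OF stab_subgroup[OF assms(1)] stab_subgroup[OF assms(2)]] by blast
qed

lemma rank_less: "is_coset A \<Longrightarrow> is_coset B \<Longrightarrow> A \<subset> B \<Longrightarrow> rank A < rank B"
  unfolding rank_def using coset_T_less finite_T psubset_card_mono by metis

lemma coverE:
  assumes "cover A B"
  obtains i where "is_coset A" "is_coset B" "A \<subset> B" "i < d" "i \<notin> T (stab A)" "T (stab B) = insert i (T (stab A))"
    "label B A = (if A = B \<inter> M i then - int i - 1 else int d - int i)"
proof -
  have A: "is_coset A" "is_coset B" "A \<subset> B" "rank B = Suc (rank A)"
    using assms insert_top_iff unfolding cover_def by auto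
  have "T (stab A) \<subset> T (stab B)" using coset_T_less A by auto
  then have "card (T (stab B) - T (stab A)) = 1"
    using A(4) card_Diff_subset[OF finite_T, of "stab A" "T (stab B)"] by (auto simp: rank_def)
  then obtain i where i: "T (stab B) - T (stab A) = {i}" using card_1_singletonE by blast
  then have "T (stab B) = insert i (T (stab A))" "i \<notin> T (stab A)" using \<open>T (stab A) \<subset> T (stab B)\<close> by auto
  moreover have "i < d" using T_less[of i "stab B"] i by auto
  moreover have "label B A = (if A = B \<inter> M i then - int i - 1 else int d - int i)"
    unfolding label_def i by simp
  ultimately show thesis using that A by blast
qed

lemma coverI:
  assumes "is_coset A" "is_coset B" "A \<subset> B" "i \<notin> T (stab A)" "T (stab B) = insert i (T (stab A))"
  shows "cover A B" "label B A = (if A = B \<inter> M i then - int i - 1 else int d - int i)"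
proof -
  show "cover A B" unfolding cover_def insert_top_iff rank_def assms(5)
    using coset_psubset_mem[OF assms(1-3)] assms finite_T by simp
  have "T (stab B) - T (stab A) = {i}" using assms by auto
  then show "label B A = (if A = B \<inter> M i then - int i - 1 else int d - int i)" unfolding label_def by simp
qed

lemma cover_inter_M:
  assumes A: "is_coset A" and i: "i \<in> T (stab A)"
  shows "cover (A \<inter> M i) A" "label A (A \<inter> M i) = - int i - 1" "T (stab (A \<inter> M i)) = T (stab A) - {i}"
proof -
  show T: "T (stab (A \<inter> M i)) = T (stab A) - {i}"
    using coset_inter_M[OF A i] T_inter_M[OF stab_subgroup[OF A] i] by simp
  have "A \<inter> M i \<noteq> A" using T i by (metis Diff_iff insertI1)
  then have s: "A \<inter> M i \<subset> A" by auto
  have "i \<notin> T (stab (A \<inter> M i))" "T (stab A) = insert i (T (stab (A \<inter> M i)))" using T i by auto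
  note c = coverI[OF coset_inter_M(1)[OF A i] A s this]
  show "cover (A \<inter> M i) A" "label A (A \<inter> M i) = - int i - 1" using c by auto
qed

lemma coset_eq_if_T:
  assumes "is_coset A" "is_coset B" "A \<subseteq> B" "T (stab B) \<subseteq> T (stab A)" shows "A = B"
  using coset_T_less[OF assms(1,2)] assms(3,4) by auto

lemma stab_via_N:
  assumes B: "is_coset B" and D: "is_coset D" "D \<subseteq> B" and i: "i < d" "T (stab B) - T (stab D) \<subseteq> {..<i}"
  shows "(stab B \<inter> N i) <#> stab D = stab B"
  using T_prod[OF stab_subgroup[OF B] stab_subgroup[OF D(1)] stab_mono[OF D(2)]] i by simp

text \<open>The stabilizer of B is generated by its part in N_i, which M_i contains, and by the
  stabilizer of D, which lies in M_i together with D. So B lies in M_i, and the types leave no room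
  between B and A \<inter> M_i.\<close>

lemma cover_eq_inter_M:
  assumes A: "is_coset A" and B: "is_coset B" "B \<subseteq> A" and i: "T (stab A) = insert i (T (stab B))" "i < d"
    and D: "is_coset D" "D \<subseteq> B" "D \<subseteq> M i" and T: "T (stab B) - T (stab D) \<subseteq> {..<i}"
  shows "B = A \<inter> M i"
proof -
  have iA: "i \<in> T (stab A)" using i by simp
  have "stab D \<subseteq> M i" using stab_least[OF M_subgroup[OF i(2)] D(3)] .
  then have "(stab B \<inter> N i) <#> stab D \<subseteq> M i"
    using N_le_M[OF i(2)] by (intro set_mult_least[OF M_subgroup[OF i(2)]]) auto
  then have sB: "stab B \<subseteq> M i" using stab_via_N[OF B(1) D(1,2) i(2) T] by simp
  obtain y where y: "y \<in> D" using coset_nonempty D by blast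
  have "B = stab B #> y" using coset_eq_stab B y D by auto
  moreover have "stab B #> y \<subseteq> M i"
    using sB y D(3) subgroup.m_closed[OF M_subgroup[OF i(2)]] by (auto simp: r_coset_def)
  ultimately have "B \<subseteq> M i" by simp
  then show ?thesis using coset_eq_if_T[OF B(1) coset_inter_M(1)[OF A iA]] B(2) cover_inter_M(3)[OF A iA] i(1) by auto
qed

text \<open>The stabilizers of A, B and B' have the same intersection with N_i, as they differ only
  in the type i. Together with the stabilizer of D this intersection generates that of B, which is
  therefore contained in that of B'; equal types force equality.\<close>

lemma cover_unique_low:
  assumes A: "is_coset A" and B: "is_coset B" "B \<subseteq> A" and B': "is_coset B'" "B' \<subseteq> A"
    and i: "T (stab A) = insert i (T (stab B))" "T (stab A) = insert i (T (stab B'))" "i < d" "i \<notin> T (stab B)" "i \<notin> T (stab B')"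
    and D: "is_coset D" "D \<subseteq> B" "D \<subseteq> B'" and T: "T (stab B) - T (stab D) \<subseteq> {..<i}"
  shows "B = B'"
proof -
  note s = stab_subgroup[OF A] stab_subgroup[OF B'(1)]
  have n: "subgroup (N i) G" using N_subgroup i(3) by simp
  have "stab B' \<inter> N i = stab A \<inter> N i"
  proof (rule T_eq)
    show "subgroup (stab B' \<inter> N i) G" "subgroup (stab A \<inter> N i) G"
      using subgroups_Inter_pair[OF s(2) n] subgroups_Inter_pair[OF s(1) n] .
    show "stab B' \<inter> N i \<subseteq> stab A \<inter> N i" using stab_mono[OF B'(2)] by auto
    show "T (stab A \<inter> N i) \<subseteq> T (stab B' \<inter> N i)"
    proof
      fix j assume j: "j \<in> T (stab A \<inter> N i)"
      then have ji: "j < i" using N_mono[of i j] by (auto simp: T_def not_le[symmetric])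
      then have "j \<in> T (stab B')" using j T_mono[of "stab A \<inter> N i" "stab A"] i(2) by auto
      then show "j \<in> T (stab B' \<inter> N i)" using N_mono[of "Suc j" i] ji i(3) by (auto simp: T_def)
    qed
  qed
  then have "stab B \<inter> N i \<subseteq> stab B'" using stab_mono[OF B(2)] by auto
  then have "(stab B \<inter> N i) <#> stab D \<subseteq> stab B'"
    using stab_mono[OF D(3)] by (intro set_mult_least[OF s(2)]) auto
  then have sub: "stab B \<subseteq> stab B'" using stab_via_N[OF B(1) D(1,2) i(3) T] by simp
  obtain y where "y \<in> D" using coset_nonempty D by blast
  then have "B \<subseteq> B'" using coset_subsetI[OF B(1) B'(1) _ _ sub] D by auto
  moreover have "T (stab B) = T (stab B')" using i by auto
  ultimately show ?thesis using coset_eq_if_T[OF B(1) B'(1)] by auto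
qed

text \<open>\<open>t k\<close> is the type of the k-th cover, counted from below.\<close>

lemma cover_sequence:
  assumes cov: "\<And>k. b \<le> k \<Longrightarrow> k \<le> m \<Longrightarrow> cover (c k) (c (Suc k))" and "b \<le> m"
  obtains t where "\<And>k. b \<le> k \<Longrightarrow> k \<le> Suc m \<Longrightarrow> is_coset (c k)"
    "\<And>k. b \<le> k \<Longrightarrow> k \<le> m \<Longrightarrow> c k \<subset> c (Suc k)" "\<And>k. b \<le> k \<Longrightarrow> k \<le> m \<Longrightarrow> t k < d"
    "\<And>k. b \<le> k \<Longrightarrow> k \<le> m \<Longrightarrow> t k \<notin> T (stab (c k))"
    "\<And>k. b \<le> k \<Longrightarrow> k \<le> m \<Longrightarrow> T (stab (c (Suc k))) = insert (t k) (T (stab (c k)))"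
    "\<And>k. b \<le> k \<Longrightarrow> k \<le> m \<Longrightarrow> label (c (Suc k)) (c k) =
      (if c k = c (Suc k) \<inter> M (t k) then - int (t k) - 1 else int d - int (t k))"
    "\<And>k. b \<le> k \<Longrightarrow> k \<le> Suc m \<Longrightarrow> c b \<subseteq> c k"
    "\<And>k. b \<le> k \<Longrightarrow> k \<le> Suc m \<Longrightarrow> T (stab (c k)) = T (stab (c b)) \<union> t ` {b..<k}"
proof -
  have "\<forall>k. \<exists>t. b \<le> k \<and> k \<le> m \<longrightarrow> is_coset (c k) \<and> is_coset (c (Suc k)) \<and> c k \<subset> c (Suc k) \<and> t < d \<and>
      t \<notin> T (stab (c k)) \<and> T (stab (c (Suc k))) = insert t (T (stab (c k))) \<and>
      label (c (Suc k)) (c k) = (if c k = c (Suc k) \<inter> M t then - int t - 1 else int d - int t)"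
  proof
    fix k
    show "\<exists>t. b \<le> k \<and> k \<le> m \<longrightarrow> is_coset (c k) \<and> is_coset (c (Suc k)) \<and> c k \<subset> c (Suc k) \<and> t < d \<and>
      t \<notin> T (stab (c k)) \<and> T (stab (c (Suc k))) = insert t (T (stab (c k))) \<and>
      label (c (Suc k)) (c k) = (if c k = c (Suc k) \<inter> M t then - int t - 1 else int d - int t)"
    proof (cases "b \<le> k \<and> k \<le> m")
      case True
      then have "cover (c k) (c (Suc k))" using cov by simp
      then show ?thesis by (elim coverE) blast
    next
      case False then show ?thesis by blast
    qed
  qed
  then obtain t where t: "\<forall>k. b \<le> k \<and> k \<le> m \<longrightarrow> is_coset (c k) \<and> is_coset (c (Suc k)) \<and> c k \<subset> c (Suc k) \<and>
      t k < d \<and> t k \<notin> T (stab (c k)) \<and> T (stab (c (Suc k))) = insert (t k) (T (stab (c k))) \<and>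
      label (c (Suc k)) (c k) = (if c k = c (Suc k) \<inter> M (t k) then - int (t k) - 1 else int d - int (t k))"
    by (rule choice[THEN exE])
  show thesis
  proof (rule that[of t])
    fix k assume k: "b \<le> k" "k \<le> Suc m"
    show "is_coset (c k)"
    proof (cases "k = Suc m")
      case True then show ?thesis using t \<open>b \<le> m\<close> by auto
    next
      case False then show ?thesis using t k by auto
    qed
    show "c b \<subseteq> c k" using k
    proof (induction k rule: dec_induct)
      case (step n) then show ?case using t by (meson Suc_leD Suc_le_mono order_trans psubset_imp_subset)
    qed simp
    show "T (stab (c k)) = T (stab (c b)) \<union> t ` {b..<k}" using k
    proof (induction k rule: dec_induct)
      case (step n) then show ?case using t by (auto simp: atLeastLessThanSuc)
    qed simp
  qed (use t in auto)
qed

lemma decreasing_sequence: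
  fixes l :: "nat \<Rightarrow> int"
  assumes "\<And>j. b \<le> j \<Longrightarrow> j < m \<Longrightarrow> l (Suc j) < l j" "b \<le> k" "k < k'" "k' \<le> m"
  shows "l k' < l k"
  using assms(3,4)
proof (induction k')
  case (Suc n)
  have "l (Suc n) < l n" using assms(1)[of n] assms(2) Suc.prems by simp
  then show ?case using Suc by (cases "k = n") auto
qed simp

theorem labelled_poset_coset_poset: "labelled_poset (carrier (coset_poset G)) (carrier G) rank label"
proof (unfold_locales, unfold cover_def[symmetric])
  let ?P = "carrier (coset_poset G)"
  show "finite ?P"
  proof (rule finite_subset)
    show "?P \<subseteq> Pow (carrier G)" using coset_poset_carrier_iff coset_subset by auto
  qed (use fin in simp)
  show "A \<subset> carrier G" if "A \<in> ?P" for A using that coset_poset_carrier_iff coset_subset by blast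
  show "rank A < rank B" if "A \<in> ?P" "B \<in> insert (carrier G) ?P" "A \<subset> B" for A B
    using that rank_less insert_top_iff by blast
next
  let ?P = "carrier (coset_poset G)"
  fix A B assume "A \<in> ?P" "B \<in> insert (carrier G) ?P" and AB: "A \<subset> B" and gap: "Suc (rank A) < rank B"
  then have A: "is_coset A" and B: "is_coset B" using insert_top_iff by auto
  have TAB: "T (stab A) \<subset> T (stab B)" using coset_T_less[OF A B AB] .
  let ?D = "T (stab B) - T (stab A)"
  have cD: "1 < card ?D" using gap TAB card_Diff_subset[OF finite_T, of "stab A" "T (stab B)"] by (auto simp: rank_def)
  \<comment> \<open>The largest missing type: the part of N_i in the stabilizer of B brings in the
    smaller missing types but not i, so the product with the stabilizer of A lies strictly
    between.\<close>
  define i where "i = Max ?D"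
  have fD: "finite ?D" using finite_T by auto
  have "?D \<noteq> {}" using TAB by auto
  then have iD: "i \<in> ?D" unfolding i_def using Max_in[OF fD] by simp
  have "?D \<noteq> {i}" using cD by auto
  then obtain j where j: "j \<in> ?D" "j \<noteq> i" using iD by auto
  then have ji: "j < i" using Max_ge[OF fD] by (simp add: i_def order_less_le)
  have id: "i < d" using T_less iD by auto
  note sA = stab_subgroup[OF A] and sB = stab_subgroup[OF B]
  have sAB: "stab A \<subseteq> stab B" using stab_mono AB by auto
  let ?L = "(stab B \<inter> N i) <#> stab A"
  have nn: "N i \<lhd> G" using N_normal id by simp
  have L: "subgroup ?L G" "?L \<subseteq> stab B" using sub_inter_prod[OF sB sA sAB nn] by auto
  have BN: "subgroup (stab B \<inter> N i) G" using subgroups_Inter_pair[OF sB normal_imp_subgroup[OF nn]] .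
  have sub: "stab B \<inter> N i \<subseteq> ?L" "stab A \<subseteq> ?L"
    using sub_set_mult1[OF sA subgroup.subset[OF BN]] sub_set_mult2[OF BN subgroup.subset[OF sA]] by auto
  have "i \<notin> T ?L" by (rule T_prod_not[OF sA id]) (use iD in auto)
  then have ne1: "?L \<noteq> stab B" using iD by auto
  have "j \<in> T (stab B \<inter> N i)" using j(1) N_mono[of "Suc j" i] ji id by (auto simp: T_def)
  then have "j \<in> T ?L" using T_mono[OF sub(1)] by auto
  then have ne2: "?L \<noteq> stab A" using j by auto
  obtain y where y: "y \<in> A" using coset_nonempty A by blast
  then have yG: "y \<in> carrier G" "y \<in> B" using coset_subset A AB by auto
  let ?C = "?L #> y"
  have C: "is_coset ?C" "stab ?C = ?L" "y \<in> ?C"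
    using is_cosetI[OF L(1) yG(1)] coset_stab[OF L(1) yG(1)] rcos_self[OF yG(1) L(1)] by auto
  have "A \<subseteq> ?C" using coset_subsetI[OF A C(1) y C(3)] sub C by simp
  moreover have "?C \<subseteq> B" using coset_subsetI[OF C(1) B C(3) yG(2)] L C by simp
  moreover have "?C \<noteq> A" "?C \<noteq> B" using C(2) ne1 ne2 by auto
  ultimately show "\<exists>C\<in>?P. A \<subset> C \<and> C \<subset> B" using coset_psubset_mem[OF C(1) B] by blast
next
  let ?P = "carrier (coset_poset G)"
  fix B assume "B \<in> insert (carrier G) ?P" and pos: "0 < rank B"
  then have B: "is_coset B" using insert_top_iff by auto
  obtain y where y: "y \<in> B" using coset_nonempty B by blast
  then have yG: "y \<in> carrier G" using coset_subset B by auto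
  let ?A = "{\<one>} #> y"
  have A: "is_coset ?A" "stab ?A = {\<one>}" using is_cosetI[OF triv_subgroup yG] coset_stab[OF triv_subgroup yG] by auto
  have "?A = {y}" using yG by (auto simp: r_coset_def)
  moreover have "?A \<noteq> B" using A(2) pos T_one by (auto simp: rank_def)
  ultimately have "?A \<subset> B" using y by auto
  then show "\<exists>A\<in>?P. A \<subset> B" using coset_psubset_mem[OF A(1) B] by blast
next
  fix A B C assume c: "cover B A" "cover C B" and le: "label B C \<le> label A B"
  obtain i where i: "is_coset B" "is_coset A" "B \<subset> A" "i < d" "i \<notin> T (stab B)" "T (stab A) = insert i (T (stab B))"
    "label A B = (if B = A \<inter> M i then - int i - 1 else int d - int i)" using coverE[OF c(1)] by blast
  obtain i' where i': "is_coset C" "is_coset B" "C \<subset> B" "i' < d" "i' \<notin> T (stab C)" "T (stab B) = insert i' (T (stab C))"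
    "label B C = (if C = B \<inter> M i' then - int i' - 1 else int d - int i')" using coverE[OF c(2)] by blast
  have ne: "i \<noteq> i'" using i i' by auto
  \<comment> \<open>If C is cut out of B by \<open>M i'\<close>, cutting A by \<open>M i'\<close>
    directly gives a smaller label. Otherwise the descent forces i < i', and the types are
    exchanged: coming from C, type i is gained first, inside \<open>N i'\<close>, so that the top
    step has type i' and a label of at most d - i'.\<close>
  show "\<exists>B'. cover B' A \<and> C \<subset> B' \<and> label A B' < label A B"
  proof (cases "C = B \<inter> M i'")
    case True
    have iA: "i' \<in> T (stab A)" using i i' by auto
    note cc = cover_inter_M[OF i(2) iA]
    have "T (stab (A \<inter> M i')) \<noteq> T (stab C)" using cc(3) i(5,6) i'(6) ne by auto
    then have "C \<subset> A \<inter> M i'" using True i(3) by auto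
    moreover have "label A B \<noteq> - int i' - 1" using i(4,7) ne by auto
    ultimately show ?thesis using cc True le i'(7) by (intro exI[of _ "A \<inter> M i'"]) auto
  next
    case False
    have lt: "i < i'" and lab: "label A B = int d - int i"
      using False le i(4,7) i'(4,7) ne by (auto split: if_splits)
    note sA = stab_subgroup[OF i(2)] and sC = stab_subgroup[OF i'(1)]
    have sCA: "stab C \<subseteq> stab A" using stab_mono i i' by blast
    define L where "L = (stab A \<inter> N i') <#> stab C"
    have nn: "N i' \<lhd> G" using N_normal i' by simp
    have L: "subgroup L G" "L \<subseteq> stab A" unfolding L_def using sub_inter_prod[OF sA sC sCA nn] by auto
    have BN: "subgroup (stab A \<inter> N i') G" using subgroups_Inter_pair[OF sA normal_imp_subgroup[OF nn]] .
    have sub: "stab A \<inter> N i' \<subseteq> L" "stab C \<subseteq> L"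
      unfolding L_def using sub_set_mult1[OF sC subgroup.subset[OF BN]] sub_set_mult2[OF BN subgroup.subset[OF sC]] by auto
    have notin: "i' \<notin> T L" unfolding L_def by (rule T_prod_not[OF sC i'(4,5)])
    have "i \<in> T (stab A \<inter> N i')" using i(6) N_mono[of "Suc i" i'] lt i'(4) by (auto simp: T_def)
    then have "i \<in> T L" using T_mono[OF sub(1)] by auto
    then have TA: "T (stab A) = insert i' (T L)" using T_mono[OF sub(2)] T_mono[OF L(2)] i(6) i'(6) notin by auto
    obtain y where y: "y \<in> C" using coset_nonempty i' by blast
    then have yG: "y \<in> carrier G" "y \<in> A" using coset_subset i i' by blast+
    let ?B = "L #> y"
    have C: "is_coset ?B" "stab ?B = L" "y \<in> ?B"
      using is_cosetI[OF L(1) yG(1)] coset_stab[OF L(1) yG(1)] rcos_self[OF yG(1) L(1)] by auto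
    have "C \<subseteq> ?B" using coset_subsetI[OF i'(1) C(1) y C(3)] sub C by simp
    moreover have "C \<noteq> ?B" using C(2) \<open>i \<in> T L\<close> i(5) i'(6) by auto
    ultimately have CB: "C \<subset> ?B" by auto
    have "?B \<subseteq> A" using coset_subsetI[OF C(1) i(2) C(3) yG(2)] L C by simp
    moreover have "?B \<noteq> A" using C(2) notin TA by auto
    ultimately have BA: "?B \<subset> A" by auto
    note cc = coverI[OF C(1) i(2) BA, of i', unfolded C(2), OF notin TA]
    show ?thesis using cc CB lab lt by (intro exI[of _ ?B]) auto
  qed
next
  fix A B assume c: "cover B A" and rk: "rank B = 0" and le: "0 \<le> label A B"
  obtain i where i: "is_coset B" "is_coset A" "B \<subset> A" "i < d" "i \<notin> T (stab B)" "T (stab A) = insert i (T (stab B))"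
    "label A B = (if B = A \<inter> M i then - int i - 1 else int d - int i)" using coverE[OF c(1)] by blast
  show "\<exists>B'. cover B' A \<and> label A B' < label A B"
    using cover_inter_M[OF i(2), of i] i(6) le by (intro exI[of _ "A \<inter> M i"]) auto
next
  fix b m :: nat and c B'
  assume bm: "b < m" and cov: "\<And>k. b \<le> k \<Longrightarrow> k \<le> m \<Longrightarrow> cover (c k) (c (Suc k))"
    and ris: "\<And>j. b \<le> j \<Longrightarrow> j < m \<Longrightarrow> label (c (Suc (Suc j))) (c (Suc j)) < label (c (Suc j)) (c j)"
    and B': "cover B' (c (Suc m))" "c b \<subset> B'" "B' \<noteq> c m"
  have bm': "b \<le> m" "b \<le> Suc m" using bm by auto
  obtain t where t: "\<And>k. b \<le> k \<Longrightarrow> k \<le> Suc m \<Longrightarrow> is_coset (c k)"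
    "\<And>k. b \<le> k \<Longrightarrow> k \<le> m \<Longrightarrow> c k \<subset> c (Suc k)" "\<And>k. b \<le> k \<Longrightarrow> k \<le> m \<Longrightarrow> t k < d"
    "\<And>k. b \<le> k \<Longrightarrow> k \<le> m \<Longrightarrow> t k \<notin> T (stab (c k))"
    "\<And>k. b \<le> k \<Longrightarrow> k \<le> m \<Longrightarrow> T (stab (c (Suc k))) = insert (t k) (T (stab (c k)))"
    "\<And>k. b \<le> k \<Longrightarrow> k \<le> m \<Longrightarrow> label (c (Suc k)) (c k) =
      (if c k = c (Suc k) \<inter> M (t k) then - int (t k) - 1 else int d - int (t k))"
    "\<And>k. b \<le> k \<Longrightarrow> k \<le> Suc m \<Longrightarrow> c b \<subseteq> c k"
    "\<And>k. b \<le> k \<Longrightarrow> k \<le> Suc m \<Longrightarrow> T (stab (c k)) = T (stab (c b)) \<union> t ` {b..<k}"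
    using cover_sequence[of b m c, OF cov bm'(1)] by blast
  define l where "l k = label (c (Suc k)) (c k)" for k
  have l: "l k = (if c k = c (Suc k) \<inter> M (t k) then - int (t k) - 1 else int d - int (t k))" if "b \<le> k" "k \<le> m" for k
    using t(6)[OF that] by (simp add: l_def)
  have l_dec: "l k' < l k" if "b \<le> k" "k < k'" "k' \<le> m" for k k'
    by (rule decreasing_sequence[of b m l, OF _ that]) (use ris in \<open>simp add: l_def\<close>)
  obtain i' where i'0: "is_coset B'" "is_coset (c (Suc m))" "B' \<subset> c (Suc m)" "i' < d" "i' \<notin> T (stab B')"
    "T (stab (c (Suc m))) = insert i' (T (stab B'))"
    "label (c (Suc m)) B' = (if B' = c (Suc m) \<inter> M i' then - int i' - 1 else int d - int i')"
    by (rule coverE[OF B'(1)])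
  note i' = i'0(1,3-7)
  \<comment> \<open>The type by which B' falls short of the top must be gained somewhere along the
    chain, at the step \<open>j\<close>.\<close>
  have "i' \<notin> T (stab (c b))" using T_mono[OF stab_mono[of "c b" B']] B'(2) i'(4) by auto
  moreover have "i' \<in> T (stab (c b)) \<union> t ` {b..<Suc m}"
    using t(8)[OF bm'(2) order_refl] i'(5) by blast
  ultimately obtain j where j: "b \<le> j" "j \<le> m" "i' = t j" by auto
  \<comment> \<open>Below a step with positive label all labels are larger, hence positive too, and
    so they belong to smaller types.\<close>
  have low: "T (stab (c j)) - T (stab (c b)) \<subseteq> {..<t j}" if pos: "l j = int d - int (t j)"
  proof
    fix u assume "u \<in> T (stab (c j)) - T (stab (c b))"
    then obtain k where k: "b \<le> k" "k < j" "u = t k" using t(8)[of j] j by auto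
    have "l j < l k" using l_dec k j by auto
    then show "u \<in> {..<t j}" using pos l[of k] t(3)[of j] k j by (auto split: if_splits)
  qed
  have cb: "is_coset (c b)" "c b \<subseteq> c j" using t(1)[of b] t(7)[of j] bm j by auto
  have cj: "is_coset (c j)" "is_coset (c (Suc j))" "c j \<subseteq> c (Suc j)" using t(1)[of j] t(1)[of "Suc j"] t(2)[of j] j by auto
  show "label (c (Suc m)) (c m) < label (c (Suc m)) B'"
  proof (rule ccontr)
    assume "\<not> ?thesis"
    then have le: "label (c (Suc m)) B' \<le> l m" by (simp add: l_def)
    have lj: "j = m \<or> l m < l j" using l_dec[of j m] j by (cases "j = m") auto
    show False
    \<comment> \<open>If B' is cut out by \<open>M i'\<close>, then so is \<open>c j\<close>: under
      a positive label at \<open>j\<close> all types are smaller, and \<open>c b\<close> lies in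
      \<open>M i'\<close>, so \<open>cover_eq_inter_M\<close> applies. Comparing labels gives j = m
      and B' = \<open>c m\<close>. If B' is not cut out, the label at \<open>m\<close> is positive,
      again j = m, and \<open>cover_unique_low\<close> applies.\<close>
    proof (cases "B' = c (Suc m) \<inter> M i'")
      case True
      show False
      proof (cases "c j = c (Suc j) \<inter> M (t j)")
        case t1: True
        then have "l j \<le> l m" using le i'(6) True l[OF j(1,2)] j by simp
        then have "j = m" using lj by auto
        then show False using t1 True B'(3) j by simp
      next
        case False
        then have lp: "l j = int d - int (t j)" using l[OF j(1,2)] by simp
        have "c b \<subseteq> M (t j)" using B'(2) True j(3) by auto
        then have "c j = c (Suc j) \<inter> M (t j)"
          using cover_eq_inter_M[OF cj(2,1,3) t(5)[OF j(1,2)] t(3)[OF j(1,2)] cb _ low[OF lp]] by simp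
        then show False using False by simp
      qed
    next
      case False
      then have le': "int d - int i' \<le> l m" using le i'(6) by simp
      have lm: "l m = int d - int (t m)" using le' l[of m] bm i'(3) by (auto split: if_splits)
      have jm: "j = m"
      proof (rule ccontr)
        assume "j \<noteq> m"
        then have "l m < l j" using lj by simp
        then show False using l[OF j(1,2)] lm le' j t(3)[of m] bm by (auto split: if_splits)
      qed
      have "c m = B'"
      proof (rule cover_unique_low[of "c (Suc m)" "c m" B' "t m" "c b"])
        show "is_coset (c (Suc m))" "is_coset (c m)" "c m \<subseteq> c (Suc m)" using cj jm by auto
        show "is_coset B'" "B' \<subseteq> c (Suc m)" using i' by auto
        show "T (stab (c (Suc m))) = insert (t m) (T (stab (c m)))" using t(5)[OF j(1,2)] jm by simp
        show "T (stab (c (Suc m))) = insert (t m) (T (stab B'))" using i'(5) j(3) jm by simp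
        show "t m < d" "t m \<notin> T (stab (c m))" using t(3,4)[OF j(1,2)] jm by auto
        show "t m \<notin> T (stab B')" using i'(4) j(3) jm by simp
        show "is_coset (c b)" "c b \<subseteq> c m" using cb jm by auto
        show "c b \<subseteq> B'" using B'(2) by auto
        show "T (stab (c m)) - T (stab (c b)) \<subseteq> {..<t m}" using low lm jm by simp
      qed
      then show False using B'(3) by simp
    qed
  qed
next
  fix m :: nat and c B'
  assume cov: "\<And>k. k \<le> m \<Longrightarrow> cover (c k) (c (Suc k))" and rk: "rank (c 0) = 0"
    and ris: "\<And>j. j < m \<Longrightarrow> label (c (Suc (Suc j))) (c (Suc j)) < label (c (Suc j)) (c j)"
    and neg: "label (c (Suc 0)) (c 0) < 0"
    and B': "cover B' (c (Suc m))" "B' \<noteq> c m"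
  have cov': "\<And>k. 0 \<le> k \<Longrightarrow> k \<le> m \<Longrightarrow> cover (c k) (c (Suc k))" using cov by simp
  obtain t where t0: "\<And>k. 0 \<le> k \<Longrightarrow> k \<le> Suc m \<Longrightarrow> is_coset (c k)"
    "\<And>k. 0 \<le> k \<Longrightarrow> k \<le> m \<Longrightarrow> c k \<subset> c (Suc k)" "\<And>k. 0 \<le> k \<Longrightarrow> k \<le> m \<Longrightarrow> t k < d"
    "\<And>k. 0 \<le> k \<Longrightarrow> k \<le> m \<Longrightarrow> t k \<notin> T (stab (c k))"
    "\<And>k. 0 \<le> k \<Longrightarrow> k \<le> m \<Longrightarrow> T (stab (c (Suc k))) = insert (t k) (T (stab (c k)))"
    "\<And>k. 0 \<le> k \<Longrightarrow> k \<le> m \<Longrightarrow> label (c (Suc k)) (c k) =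
      (if c k = c (Suc k) \<inter> M (t k) then - int (t k) - 1 else int d - int (t k))"
    "\<And>k. 0 \<le> k \<Longrightarrow> k \<le> Suc m \<Longrightarrow> c 0 \<subseteq> c k"
    "\<And>k. 0 \<le> k \<Longrightarrow> k \<le> Suc m \<Longrightarrow> T (stab (c k)) = T (stab (c 0)) \<union> t ` {0..<k}"
    using cover_sequence[of 0 m c, OF cov' le0] by blast
  note t = t0(1,3,6,8)
  define l where "l k = label (c (Suc k)) (c k)" for k
  have l_dec: "l k' < l k" if "k < k'" "k' \<le> m" for k k'
    by (rule decreasing_sequence[of 0 m l, OF _ _ that]) (use ris in \<open>simp_all add: l_def\<close>)
  have l_neg: "l k < 0" if "k \<le> m" for k
    using l_dec[of 0 k] that neg by (cases "k = 0") (auto simp: l_def)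
  have l2: "c k = c (Suc k) \<inter> M (t k)" if "k \<le> m" for k
  proof (rule ccontr)
    assume "\<not> ?thesis"
    then have "l k = int d - int (t k)" using t(3)[of k] that by (simp add: l_def)
    then show False using l_neg[OF that] t(2)[of k] that by simp
  qed
  then have l1: "l k = - int (t k) - 1" if "k \<le> m" for k
    using t(3)[of k] that by (simp add: l_def)
  note l = l1 l2
  obtain i' where i'0: "is_coset B'" "is_coset (c (Suc m))" "B' \<subset> c (Suc m)" "i' < d" "i' \<notin> T (stab B')"
    "T (stab (c (Suc m))) = insert i' (T (stab B'))"
    "label (c (Suc m)) B' = (if B' = c (Suc m) \<inter> M i' then - int i' - 1 else int d - int i')"
    by (rule coverE[OF B'(1)])
  note i' = i'0(1,3-7)
  have "T (stab (c 0)) = {}" using rk finite_T by (simp add: rank_def)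
  moreover have "i' \<in> T (stab (c (Suc m)))" using i'(5) by blast
  ultimately obtain j where j: "j \<le> m" "i' = t j" using t(4)[of "Suc m"] by (auto simp: less_Suc_eq_le)
  \<comment> \<open>All covers are cut out by complements, and the labels fall from the bottom up;
    so the types grow upwards and the last one is the largest.\<close>
  have "t j \<le> t m" using l_dec[of j m] l(1)[of j] l(1)[of m] j by (cases "j = m") auto
  show "label (c (Suc m)) (c m) < label (c (Suc m)) B'"
  proof (rule ccontr)
    assume "\<not> ?thesis"
    then have le: "label (c (Suc m)) B' \<le> - int (t m) - 1" using l(1)[of m] by (simp add: l_def)
    then have "B' = c (Suc m) \<inter> M i'" "t m \<le> i'" using i'(3,6) by (auto split: if_splits)
    then have "B' = c m" using \<open>t j \<le> t m\<close> j l(2)[of m] by simp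
    then show False using B'(2) by simp
  qed
qed

end

theorem shellable_if_elementary_supersolvable:
  assumes "finite_group G" "elementary_supersolvable G" shows "shellable_poset (coset_poset G)"
proof -
  obtain d N M where "complemented_series G d N M" using complemented_series_ex[OF assms] by blast
  then interpret complemented_series G d N M .
  interpret labelled_poset "carrier (coset_poset G)" "carrier G" rank label cover
    by (rule labelled_poset_coset_poset) (rule eq_reflection, simp only: cover_def)
  have "le (coset_poset G) = (\<subseteq>)" by (simp add: coset_poset_def)
  then show ?thesis using shellable_chain_complex by (simp add: shellable_poset_def order_complex_def)
qed

section \<open>Long facets of a shellable complex\<close>

lemma facetsI: "F \<in> \<Delta> \<Longrightarrow> (\<And>F'. F' \<in> \<Delta> \<Longrightarrow> F \<subseteq> F' \<Longrightarrow> F' = F) \<Longrightarrow> F \<in> facets \<Delta>"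
  by (simp add: facets_def)

lemma facetsD: "F \<in> facets \<Delta> \<Longrightarrow> F \<in> \<Delta>" "F \<in> facets \<Delta> \<Longrightarrow> F' \<in> \<Delta> \<Longrightarrow> F \<subseteq> F' \<Longrightarrow> F' = F"
  by (simp_all add: facets_def)

text \<open>
  By this lemma the long facets satisfy the shelling condition among themselves.
\<close>

lemma facet_card_le:
  assumes "F \<in> facets \<Delta>" "F'' \<in> facets \<Delta>" "v \<in> F" "F - {v} \<subseteq> F''" "finite F" "finite F''"
  shows "card F \<le> card F''"
proof -
  have "F'' \<noteq> F - {v}" using assms(1-3) unfolding facets_def by blast
  then have "card (F - {v}) < card F''" using assms(4,6) by (intro psubset_card_mono) auto
  then show ?thesis using assms(3,5) by simp
qed

text \<open>Every long facet but the earliest shares a codimension-one face with an earlier long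
  facet, and this face has a vertex since s \<ge> 2. The function g stands for a labelling by
  connected components.\<close>

lemma shellable_connected:
  assumes "shellable \<Delta>" and fin: "\<And>F. F \<in> facets \<Delta> \<Longrightarrow> finite F" and s: "2 \<le> s"
    and g: "\<And>F u v. F \<in> facets \<Delta> \<Longrightarrow> s \<le> card F \<Longrightarrow> u \<in> F \<Longrightarrow> v \<in> F \<Longrightarrow> g u = g v"
    and F: "F \<in> facets \<Delta>" "s \<le> card F" "u \<in> F" and F': "F' \<in> facets \<Delta>" "s \<le> card F'" "v \<in> F'"
  shows "g u = g v"
proof -
  obtain r :: "'a set \<Rightarrow> nat" where r: "finite (facets \<Delta>)" "inj_on r (facets \<Delta>)"
    and step: "\<And>F F'. F \<in> facets \<Delta> \<Longrightarrow> F' \<in> facets \<Delta> \<Longrightarrow> r F' < r F \<Longrightarrow>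
      \<exists>v\<in>F. \<exists>F''\<in>facets \<Delta>. r F'' < r F \<and> F' \<inter> F \<subseteq> F - {v} \<and> F - {v} \<subseteq> F''"
    using shellableD[OF assms(1)] by blast
  let ?B = "{F \<in> facets \<Delta>. s \<le> card F}"
  have "\<exists>F. F \<in> ?B" using F by auto
  then obtain F0 where F0: "F0 \<in> ?B" "\<And>E. E \<in> ?B \<Longrightarrow> r F0 \<le> r E"
    using ex_has_least_nat[of "\<lambda>F. F \<in> ?B" _ r] by blast
  have "card F0 \<noteq> 0" using F0 s by auto
  then obtain u0 where u0: "u0 \<in> F0" by fastforce
  have *: "\<forall>E w. E \<in> ?B \<longrightarrow> r E = n \<longrightarrow> w \<in> E \<longrightarrow> g w = g u0" for n
  proof (induction n rule: less_induct)
    case (less n)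
    show ?case
    proof (intro allI impI)
      fix E w assume E: "E \<in> ?B" "r E = n" "w \<in> E"
      show "g w = g u0"
      proof (cases "r F0 < r E")
        case False
        then have "r E = r F0" using F0(2)[OF E(1)] by simp
        then have "E = F0" using r(2) E(1) F0(1) by (auto dest: inj_onD)
        then show ?thesis using g[of F0 w u0] F0(1) E(3) u0 by auto
      next
        case True
        then obtain v F'' where v: "v \<in> E" "F'' \<in> facets \<Delta>" "r F'' < r E" "E - {v} \<subseteq> F''"
          using step[of E F0] E F0 by blast
        have "card E \<le> card F''" using facet_card_le[of E \<Delta> F'' v] E v fin by auto
        then have F'': "F'' \<in> ?B" using v E by auto
        have "card (E - {v}) \<noteq> 0" using E(1) s v(1) fin[of E] by auto
        then have "E - {v} \<noteq> {}" by fastforce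
        then obtain w' where w': "w' \<in> E" "w' \<in> F''" using v(4) by blast
        then have "g w' = g u0" using less.IH[of "r F''"] F'' v E by auto
        then show ?thesis using g[of E w w'] E w' by auto
      qed
    qed
  qed
  show ?thesis using *[of "r F"] *[of "r F'"] F F' by auto
qed

text \<open>
  A potential on the earlier facets extends over a new facet \<open>F\<close> because any two faces of codimension
  one of \<open>F\<close> share a vertex if \<open>F\<close> has at least three vertices.
\<close>

lemma shellable_cocycle_trivial:
  assumes "shellable \<Delta>" and fin: "\<And>F. F \<in> facets \<Delta> \<Longrightarrow> finite F" and s: "3 \<le> s" and A: "group A"
    and c: "\<And>F u v. F \<in> facets \<Delta> \<Longrightarrow> s \<le> card F \<Longrightarrow> u \<in> F \<Longrightarrow> v \<in> F \<Longrightarrow> c u v \<in> carrier A"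
    and cc: "\<And>F u v w. F \<in> facets \<Delta> \<Longrightarrow> s \<le> card F \<Longrightarrow> u \<in> F \<Longrightarrow> v \<in> F \<Longrightarrow> w \<in> F \<Longrightarrow>
      c u v \<otimes>\<^bsub>A\<^esub> c v w = c u w"
  shows "\<exists>f. \<forall>F\<in>facets \<Delta>. s \<le> card F \<longrightarrow>
    (\<forall>u\<in>F. f u \<in> carrier A \<and> (\<forall>v\<in>F. f v = f u \<otimes>\<^bsub>A\<^esub> c u v))"
proof -
  interpret A: group A by (rule A)
  obtain r :: "'a set \<Rightarrow> nat" where r: "finite (facets \<Delta>)" "inj_on r (facets \<Delta>)"
    and step: "\<And>F F'. F \<in> facets \<Delta> \<Longrightarrow> F' \<in> facets \<Delta> \<Longrightarrow> r F' < r F \<Longrightarrow>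
      \<exists>v\<in>F. \<exists>F''\<in>facets \<Delta>. r F'' < r F \<and> F' \<inter> F \<subseteq> F - {v} \<and> F - {v} \<subseteq> F''"
    using shellableD[OF assms(1)] by blast
  define B where "B = {F \<in> facets \<Delta>. s \<le> card F}"
  have Bc: "c u v \<in> carrier A" if "F \<in> B" "u \<in> F" "v \<in> F" for F u v using c that by (auto simp: B_def)
  have Bcc: "c u v \<otimes>\<^bsub>A\<^esub> c v w = c u w" if "F \<in> B" "u \<in> F" "v \<in> F" "w \<in> F" for F u v w
    using cc that by (auto simp: B_def)
  have Bstep: "\<exists>v\<in>F. \<exists>F''\<in>B. r F'' < r F \<and> F' \<inter> F \<subseteq> F - {v} \<and> F - {v} \<subseteq> F''"
    if FF': "F \<in> B" "F' \<in> B" "r F' < r F" for F F'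
  proof -
    obtain v F'' where v: "v \<in> F" "F'' \<in> facets \<Delta>" "r F'' < r F" "F' \<inter> F \<subseteq> F - {v}" "F - {v} \<subseteq> F''"
      using step[of F F'] FF' unfolding B_def by blast
    have "card F \<le> card F''" using facet_card_le[of F \<Delta> F'' v] FF' v fin by (auto simp: B_def)
    then have "F'' \<in> B" using v FF' by (auto simp: B_def)
    then show ?thesis using v by blast
  qed
  have third: "\<exists>w. w \<in> F \<and> w \<noteq> a \<and> w \<noteq> b" if "F \<in> B" for F a b
  proof (rule ccontr)
    assume "\<not> ?thesis"
    then have "F \<subseteq> {a, b}" by auto
    then have "card F \<le> card {a, b}" by (intro card_mono) auto
    then show False using that s card_insert_le_m1[of 2 "{b}" a] by (auto simp: B_def card_insert_if split: if_splits)
  qed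
  have "\<exists>f. \<forall>F\<in>B. r F < n \<longrightarrow> (\<forall>u\<in>F. f u \<in> carrier A \<and> (\<forall>v\<in>F. f v = f u \<otimes>\<^bsub>A\<^esub> c u v))" for n
  proof (induction n)
    case 0 then show ?case by simp
  next
    case (Suc n)
    then obtain f where f: "\<And>F u. F \<in> B \<Longrightarrow> r F < n \<Longrightarrow> u \<in> F \<Longrightarrow> f u \<in> carrier A"
      "\<And>F u v. F \<in> B \<Longrightarrow> r F < n \<Longrightarrow> u \<in> F \<Longrightarrow> v \<in> F \<Longrightarrow> f v = f u \<otimes>\<^bsub>A\<^esub> c u v" by blast
    show ?case
    proof (cases "\<exists>F\<in>B. r F = n")
      case False
      then have "\<And>F. F \<in> B \<Longrightarrow> r F < Suc n \<Longrightarrow> r F < n" by (meson less_SucE)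
      then show ?thesis using f by (intro exI[of _ f]) blast
    next
      case True
      then obtain F where F: "F \<in> B" "r F = n" by auto
      have uniq: "E = F" if "E \<in> B" "r E = n" for E
        using r(2) that F by (auto simp: B_def dest: inj_onD)
      have "\<exists>u0 a. u0 \<in> F \<and> a \<in> carrier A \<and> (\<forall>E\<in>B. r E < n \<longrightarrow> (\<forall>w\<in>E \<inter> F. f w = a \<otimes>\<^bsub>A\<^esub> c u0 w))"
      proof (cases "\<exists>E\<in>B. r E < n")
        case False
        obtain u0 where "u0 \<in> F" using third[OF F(1)] by blast
        then show ?thesis using False by (intro exI[of _ u0] exI[of _ "\<one>\<^bsub>A\<^esub>"]) auto
      next
        case True
        then obtain F1 where F1: "F1 \<in> B" "r F1 < n" by auto
        then obtain v1 F2 where F2: "v1 \<in> F" "F2 \<in> B" "r F2 < n" "F - {v1} \<subseteq> F2" using Bstep[OF F(1) F1(1)] F by auto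
        obtain u0 where u0: "u0 \<in> F" "u0 \<noteq> v1" using third[OF F(1)] by blast
        have "f w = f u0 \<otimes>\<^bsub>A\<^esub> c u0 w" if E: "E \<in> B" "r E < n" "w \<in> E" "w \<in> F" for E w
        proof -
          obtain v' F'' where F'': "v' \<in> F" "F'' \<in> B" "r F'' < n" "E \<inter> F \<subseteq> F - {v'}" "F - {v'} \<subseteq> F''"
            using Bstep[OF F(1) E(1)] F E(2) by auto
          \<comment> \<open>\<open>F2\<close> contains \<open>F\<close> without \<open>v1\<close>,
            and \<open>F''\<close> contains \<open>F\<close> without \<open>v'\<close>. So
            \<open>u1\<close> lies in both and links the values at \<open>u0\<close> and
            \<open>w\<close>.\<close>
          obtain u1 where u1: "u1 \<in> F" "u1 \<noteq> v1" "u1 \<noteq> v'" using third[OF F(1)] by blast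
          have "f u1 = f u0 \<otimes>\<^bsub>A\<^esub> c u0 u1" using f(2)[OF F2(2,3), of u0 u1] F2(4) u0 u1 by auto
          moreover have "f w = f u1 \<otimes>\<^bsub>A\<^esub> c u1 w" using f(2)[OF F''(2,3), of u1 w] F''(4,5) u1 E by auto
          moreover have "f u0 \<in> carrier A" using f(1)[OF F2(2,3), of u0] F2(4) u0 by auto
          ultimately have "f w = f u0 \<otimes>\<^bsub>A\<^esub> (c u0 u1 \<otimes>\<^bsub>A\<^esub> c u1 w)"
            using Bc[OF F(1)] u0 u1 E by (simp add: A.m_assoc)
          then show ?thesis using Bcc[OF F(1)] u0 u1 E by simp
        qed
        moreover have "f u0 \<in> carrier A" using f(1)[OF F2(2,3), of u0] F2(4) u0 by auto
        ultimately show ?thesis using u0(1) by (intro exI[of _ u0] exI[of _ "f u0"]) auto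
      qed
      then obtain u0 a where u0: "u0 \<in> F" "a \<in> carrier A"
        "\<And>E w. E \<in> B \<Longrightarrow> r E < n \<Longrightarrow> w \<in> E \<Longrightarrow> w \<in> F \<Longrightarrow> f w = a \<otimes>\<^bsub>A\<^esub> c u0 w" by blast
      define f' where "f' w = (if w \<in> F then a \<otimes>\<^bsub>A\<^esub> c u0 w else f w)" for w
      have old: "f' w = f w" if "E \<in> B" "r E < n" "w \<in> E" for E w using u0(3)[OF that] by (simp add: f'_def)
      show ?thesis
      proof (intro exI[of _ f'] ballI impI)
        fix E u assume E: "E \<in> B" "r E < Suc n" "u \<in> E"
        show "f' u \<in> carrier A \<and> (\<forall>v\<in>E. f' v = f' u \<otimes>\<^bsub>A\<^esub> c u v)"
        proof (cases "r E < n")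
          case True
          show ?thesis
          proof (intro conjI ballI)
            show "f' u \<in> carrier A" unfolding old[OF E(1) True E(3)] by (rule f(1)[OF E(1) True E(3)])
            fix v assume v: "v \<in> E"
            show "f' v = f' u \<otimes>\<^bsub>A\<^esub> c u v"
              unfolding old[OF E(1) True E(3)] old[OF E(1) True v] by (rule f(2)[OF E(1) True E(3) v])
          qed
        next
          case False
          then have "E = F" using uniq E by simp
          then show ?thesis using E u0 Bc[OF F(1)] Bcc[OF F(1)] by (auto simp: f'_def A.m_assoc)
        qed
      qed
    qed
  qed
  from this[of "Suc (Max (r ` facets \<Delta>))"] obtain f where f:
    "\<forall>F\<in>B. r F < Suc (Max (r ` facets \<Delta>)) \<longrightarrow> (\<forall>u\<in>F. f u \<in> carrier A \<and> (\<forall>v\<in>F. f v = f u \<otimes>\<^bsub>A\<^esub> c u v))" by blast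
  have bound: "r F < Suc (Max (r ` facets \<Delta>))" if "F \<in> B" for F
    using that r(1) by (simp add: B_def less_Suc_eq_le)
  show ?thesis
  proof (intro exI[of _ f] ballI impI)
    fix F u assume F: "F \<in> facets \<Delta>" "s \<le> card F" and u: "u \<in> F"
    then have FB: "F \<in> B" by (simp add: B_def)
    show "f u \<in> carrier A \<and> (\<forall>v\<in>F. f v = f u \<otimes>\<^bsub>A\<^esub> c u v)"
      by (rule f[THEN bspec, OF FB, THEN mp, OF bound[OF FB], THEN bspec, OF u])
  qed
qed

section \<open>Long facets of the coset poset\<close>

context finite_group begin

abbreviation "coset_facets \<equiv> facets (order_complex (coset_poset G))"

lemma order_complex_iff:
  "C \<in> order_complex (coset_poset G) \<longleftrightarrow>
    (\<forall>A\<in>C. is_coset A \<and> A \<noteq> carrier G) \<and> (\<forall>A\<in>C. \<forall>B\<in>C. A \<subseteq> B \<or> B \<subseteq> A)"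
proof -
  have le: "le (coset_poset G) = (\<subseteq>)" by (simp add: coset_poset_def)
  show ?thesis
    unfolding order_complex_def mem_Collect_eq le chain_def subset_eq coset_poset_carrier_iff by (rule refl)
qed

lemma facet_chain:
  assumes "F \<in> coset_facets" "A \<in> F" shows "is_coset A" "A \<noteq> carrier G" "B \<in> F \<Longrightarrow> A \<subseteq> B \<or> B \<subseteq> A"
  using facetsD(1)[OF assms(1)] assms(2) unfolding order_complex_iff by simp_all

lemma order_complex_finite: "C \<in> order_complex (coset_poset G) \<Longrightarrow> finite C"
proof -
  assume "C \<in> order_complex (coset_poset G)"
  then have "C \<subseteq> Pow (carrier G)" using order_complex_iff coset_subset by blast
  then show ?thesis using fin finite_subset by blast
qed

lemma facet_finite: "F \<in> coset_facets \<Longrightarrow> finite F"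
  using order_complex_finite facetsD(1) by blast

lemma facet_extend:
  assumes "C \<in> order_complex (coset_poset G)" obtains F where "F \<in> coset_facets" "C \<subseteq> F"
proof -
  let ?D = "order_complex (coset_poset G)"
  have "?D \<subseteq> Pow (Pow (carrier G))" using order_complex_iff coset_subset by blast
  then have "finite ?D" using fin by (simp add: finite_subset)
  then obtain F where F: "F \<in> ?D" "C \<subseteq> F" "\<forall>E\<in>?D. F \<subseteq> E \<longrightarrow> F = E"
    using finite_has_maximal2[of ?D C] assms by blast
  then have "F \<in> coset_facets" by (intro facetsI) auto
  then show thesis using that F(2) by blast
qed

lemma facet_top:
  assumes "F \<in> coset_facets" "F \<noteq> {}" obtains A where "A \<in> F" "\<And>B. B \<in> F \<Longrightarrow> B \<subseteq> A"
proof -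
  obtain A where A: "A \<in> F" "\<forall>B\<in>F. A \<subseteq> B \<longrightarrow> A = B"
    using finite_has_maximal[OF facet_finite[OF assms(1)] assms(2)] by blast
  then have "B \<subseteq> A" if "B \<in> F" for B using facet_chain(3)[OF assms(1) that A(1)] that by auto
  then show thesis using that A(1) by blast
qed

lemma stab_proper: "is_coset A \<Longrightarrow> A \<noteq> carrier G \<Longrightarrow> stab A \<noteq> carrier G"
proof
  assume A: "is_coset A" "A \<noteq> carrier G" "stab A = carrier G"
  obtain y where y: "y \<in> A" using coset_nonempty A by blast
  then show False using coset_eq_stab[OF A(1) y] A coset_join2[OF _ subgroup_self] by auto
qed

text \<open>The trivial subgroup is included so that the translate of the chain by y contains the
  vertex {y}, through which group elements are compared.\<close>

definition subgroup_chain :: "'a set set \<Rightarrow> bool" where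
  "subgroup_chain \<C> \<longleftrightarrow> (\<forall>H\<in>\<C>. subgroup H G \<and> H \<noteq> carrier G) \<and> (\<forall>H\<in>\<C>. \<forall>K\<in>\<C>. H \<subseteq> K \<or> K \<subseteq> H) \<and> {\<one>} \<in> \<C>"

lemma translate_chain:
  assumes C: "subgroup_chain \<C>" and y: "y \<in> carrier G"
  obtains F where "F \<in> coset_facets" "card \<C> \<le> card F" "{y} \<in> F" "\<And>H. H \<in> \<C> \<Longrightarrow> H #> y \<in> F"
proof -
  have s: "subgroup H G" "H \<noteq> carrier G" if "H \<in> \<C>" for H using C that by (auto simp: subgroup_chain_def)
  let ?C = "(\<lambda>H. H #> y) ` \<C>"
  have "?C \<in> order_complex (coset_poset G)" unfolding order_complex_iff
  proof (intro conjI ballI)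
    fix A assume "A \<in> ?C"
    then obtain H where H: "H \<in> \<C>" "A = H #> y" by auto
    show "is_coset A" using is_cosetI[OF s(1)[OF H(1)] y] H by simp
    show "A \<noteq> carrier G"
    proof
      assume "A = carrier G"
      then have "A = carrier G #> \<one>" by simp
      then have "stab A = carrier G" using coset_stab[OF subgroup_self, of \<one>] by simp
      then show False using coset_stab[OF s(1)[OF H(1)] y] H s(2) by simp
    qed
    fix B assume "B \<in> ?C"
    then obtain K where K: "K \<in> \<C>" "B = K #> y" by auto
    have "H \<subseteq> K \<or> K \<subseteq> H" using C H(1) K(1) unfolding subgroup_chain_def by simp
    then show "A \<subseteq> B \<or> B \<subseteq> A" unfolding H(2) K(2) r_coset_def by blast
  qed
  then obtain F where F: "F \<in> coset_facets" "?C \<subseteq> F" using facet_extend by blast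
  have "inj_on (\<lambda>H. H #> y) \<C>"
    by (rule inj_on_inverseI[where g = stab]) (use s coset_stab[OF _ y] in auto)
  then have "card \<C> \<le> card F" using card_mono[OF facet_finite[OF F(1)] F(2)] by (simp add: card_image)
  moreover have "{\<one>} #> y = {y}" using y by (auto simp: r_coset_def)
  then have "{y} \<in> F" using C F(2) by (auto simp: subgroup_chain_def image_iff subset_iff)
  ultimately show thesis using that F by auto
qed

text \<open>On a long facet S A = S y for every y \<in> A, since the stabilizer of A lies in S. This
  coset of S is constant along a facet, and by connectivity it is the same for {y} and for
  {1}.\<close>

theorem generated_by_long_chains:
  assumes sh: "shellable_poset (coset_poset G)" and s: "2 \<le> s" and S: "subgroup S G"
    and stabS: "\<And>F A. F \<in> coset_facets \<Longrightarrow> s \<le> card F \<Longrightarrow> A \<in> F \<Longrightarrow> stab A \<subseteq> S"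
    and C: "subgroup_chain \<C>" "s \<le> card \<C>"
  shows "S = carrier G"
proof -
  have g: "S <#> A = S #> y" if "F \<in> coset_facets" "s \<le> card F" "A \<in> F" "y \<in> A" for F A y
  proof -
    have A: "is_coset A" using facet_chain that by auto
    have yG: "y \<in> carrier G" "A = stab A #> y" using coset_eq_stab[OF A that(4)] by auto
    show ?thesis
    proof
      show "S <#> A \<subseteq> S #> y"
      proof
        fix z assume "z \<in> S <#> A"
        then obtain x a where xa: "x \<in> S" "a \<in> A" "z = x \<otimes> a" using set_mult_iff by auto
        then obtain h where h: "h \<in> stab A" "a = h \<otimes> y" using yG(2) unfolding r_coset_def by blast
        have hS: "h \<in> S" using stabS[OF that(1-3)] h by auto
        have "z = (x \<otimes> h) \<otimes> y" using xa h yG(1) hS subgroup.mem_carrier[OF S] by (simp add: m_assoc)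
        then show "z \<in> S #> y" using subgroup.m_closed[OF S xa(1) hS] unfolding r_coset_def by blast
      qed
      show "S #> y \<subseteq> S <#> A" using that(4) by (auto simp: r_coset_def set_mult_def)
    qed
  qed
  have const: "S <#> A = S <#> B" if F: "F \<in> coset_facets" "s \<le> card F" and AB: "A \<in> F" "B \<in> F" for F A B
  proof -
    have *: "S <#> A = S <#> B" if AB: "A \<in> F" "B \<in> F" "A \<subseteq> B" for A B
    proof -
      obtain y where "y \<in> A" using coset_nonempty[OF facet_chain(1)[OF F(1) AB(1)]] by blast
      then show ?thesis using g[OF F AB(1)] g[OF F AB(2)] AB(3) by auto
    qed
    show ?thesis using facet_chain(3)[OF F(1) AB] *[OF AB] *[OF AB(2,1)] by auto
  qed
  have sh': "shellable (order_complex (coset_poset G))" using sh by (simp add: shellable_poset_def)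
  have "y \<in> S" if y: "y \<in> carrier G" for y
  proof -
    obtain F where F: "F \<in> coset_facets" "card \<C> \<le> card F" "{y} \<in> F" using translate_chain[OF C(1) y] by blast
    obtain F' where F': "F' \<in> coset_facets" "card \<C> \<le> card F'" "{\<one>} \<in> F'" using translate_chain[OF C(1) one_closed] by blast
    have le: "s \<le> card F" "s \<le> card F'" using F F' C(2) by auto
    have "S <#> {y} = S <#> {\<one>}"
      by (rule shellable_connected[OF sh' facet_finite s const F(1) le(1) F(3) F'(1) le(2) F'(3)])
    then have "S #> y = S #> \<one>" using g[OF F(1) le(1) F(3), of y] g[OF F'(1) le(2) F'(3), of \<one>] by simp
    then have "y \<in> S #> \<one>" using rcos_self[OF y S] by simp
    then show ?thesis using subgroup.subset[OF S] by simp
  qed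
  then show ?thesis using subgroup.subset[OF S] by auto
qed

text \<open>A choice x of representatives turns \<phi> into the cocycle c(u, v) = \<phi>(x_u
  x_v^-1): on a facet all arguments lie in the stabilizer of the top vertex, where \<phi> is
  multiplicative. Its potential satisfies f{y} = f{g y} \<phi>(g), and the claim follows by
  comparing {1} with {g h} directly and through {h}.\<close>

theorem hom_if_hom_on_long_chains:
  assumes sh: "shellable_poset (coset_poset G)" and s: "3 \<le> s" and A: "group A"
    and phi: "\<And>g. g \<in> carrier G \<Longrightarrow> \<phi> g \<in> carrier A"
    and loc: "\<And>F B a b. F \<in> coset_facets \<Longrightarrow> s \<le> card F \<Longrightarrow> B \<in> F \<Longrightarrow> a \<in> stab B \<Longrightarrow> b \<in> stab B \<Longrightarrow>
      \<phi> (a \<otimes> b) = \<phi> a \<otimes>\<^bsub>A\<^esub> \<phi> b"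
    and C: "\<And>g. g \<in> carrier G \<Longrightarrow> \<exists>\<C> H. subgroup_chain \<C> \<and> s \<le> card \<C> \<and> H \<in> \<C> \<and> g \<in> H"
    and gh: "g \<in> carrier G" "h \<in> carrier G"
  shows "\<phi> (g \<otimes> h) = \<phi> g \<otimes>\<^bsub>A\<^esub> \<phi> h"
proof -
  interpret A: group A by (rule A)
  define x where "x = (\<lambda>B. SOME y. y \<in> (B :: 'a set))"
  have x: "x B \<in> B" if "is_coset B" for B
    using coset_nonempty[OF that] unfolding x_def by (rule someI_ex)
  have x1: "x {y} = y" for y by (simp add: x_def)
  let ?c = "\<lambda>u v. \<phi> (x u \<otimes> inv (x v))"
  have top: "\<exists>B\<in>F. \<forall>u\<in>F. x u \<in> B \<and> x u \<in> carrier G" if F: "F \<in> coset_facets" "s \<le> card F" for F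
  proof -
    have "F \<noteq> {}" using F s by auto
    then obtain B where B: "B \<in> F" "\<And>u. u \<in> F \<Longrightarrow> u \<subseteq> B" using facet_top[OF F(1)] by blast
    have "x u \<in> B \<and> x u \<in> carrier G" if "u \<in> F" for u
      using x[OF facet_chain(1)[OF F(1) that]] B(2)[OF that] coset_subset[OF facet_chain(1)[OF F(1) that]] by auto
    then show ?thesis using B(1) by blast
  qed
  have c: "?c u v \<in> carrier A" if F: "F \<in> coset_facets" "s \<le> card F" and uv: "u \<in> F" "v \<in> F" for F u v
    using top[OF F] uv by (auto intro!: phi)
  have cc: "?c u v \<otimes>\<^bsub>A\<^esub> ?c v w = ?c u w"
    if F: "F \<in> coset_facets" "s \<le> card F" and uv: "u \<in> F" "v \<in> F" "w \<in> F" for F u v w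
  proof -
    obtain B where B: "B \<in> F" "\<And>u. u \<in> F \<Longrightarrow> x u \<in> B" "\<And>u. u \<in> F \<Longrightarrow> x u \<in> carrier G" using top[OF F] by blast
    have "x u \<otimes> inv (x v) \<in> stab B" "x v \<otimes> inv (x w) \<in> stab B" unfolding stab_def using B uv by blast+
    from loc[OF F B(1) this] show ?thesis using B(3) uv by (simp add: word_simps)
  qed
  have sh': "shellable (order_complex (coset_poset G))" using sh by (simp add: shellable_poset_def)
  have "\<exists>f. \<forall>F\<in>coset_facets. s \<le> card F \<longrightarrow>
      (\<forall>u\<in>F. f u \<in> carrier A \<and> (\<forall>v\<in>F. f v = f u \<otimes>\<^bsub>A\<^esub> ?c u v))"
    by (rule shellable_cocycle_trivial[OF sh' facet_finite s A c cc])
  then obtain f where f0: "\<forall>F\<in>coset_facets. s \<le> card F \<longrightarrow>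
      (\<forall>u\<in>F. f u \<in> carrier A \<and> (\<forall>v\<in>F. f v = f u \<otimes>\<^bsub>A\<^esub> ?c u v))" ..
  have f1: "f u \<in> carrier A" if "F \<in> coset_facets" "s \<le> card F" "u \<in> F" for F u
    by (rule f0[THEN bspec, THEN mp, THEN bspec, THEN conjunct1, OF that])
  have f2: "f v = f u \<otimes>\<^bsub>A\<^esub> ?c u v" if "F \<in> coset_facets" "s \<le> card F" "u \<in> F" "v \<in> F" for F u v
    by (rule f0[THEN bspec, THEN mp, THEN bspec, THEN conjunct2, THEN bspec, OF that])
  note f = f1 f2
  have fc: "f {y} \<in> carrier A" if y: "y \<in> carrier G" for y
  proof -
    obtain \<C> where C': "subgroup_chain \<C>" "s \<le> card \<C>" using C[OF one_closed] by blast
    obtain F where "F \<in> coset_facets" "card \<C> \<le> card F" "{y} \<in> F" using translate_chain[OF C'(1) y] by blast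
    then show ?thesis using f(1)[of F "{y}"] C'(2) by auto
  qed
  \<comment> \<open>The singletons {y} and {g y} are joined through the vertex H y, where H is a
    member of a long chain that contains g.\<close>
  have main: "f {y} = f {g \<otimes> y} \<otimes>\<^bsub>A\<^esub> \<phi> g" if g: "g \<in> carrier G" and y: "y \<in> carrier G" for g y
  proof -
    obtain \<C> H where C': "subgroup_chain \<C>" "s \<le> card \<C>" "H \<in> \<C>" "g \<in> H" using C[OF g] by blast
    have H: "subgroup H G" using C' by (auto simp: subgroup_chain_def)
    have gy: "g \<otimes> y \<in> carrier G" using g y by simp
    obtain F where F: "F \<in> coset_facets" "card \<C> \<le> card F" "{y} \<in> F" "H #> y \<in> F"
      using translate_chain[OF C'(1) y] C'(3) by metis
    obtain F' where F': "F' \<in> coset_facets" "card \<C> \<le> card F'" "{g \<otimes> y} \<in> F'" "H #> (g \<otimes> y) \<in> F'"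
      using translate_chain[OF C'(1) gy] C'(3) by metis
    have le: "s \<le> card F" "s \<le> card F'" using F F' C'(2) by auto
    let ?q = "H #> y"
    have "g \<otimes> y \<in> ?q" using C'(4) by (auto simp: r_coset_def)
    then have q': "H #> (g \<otimes> y) = ?q" using repr_independence[OF _ y H] by simp
    let ?z = "y \<otimes> inv (x ?q)"
    have q: "is_coset ?q" "stab ?q = H" using is_cosetI[OF H y] coset_stab[OF H y] by auto
    have xq: "x ?q \<in> ?q" "x ?q \<in> carrier G" using x[OF q(1)] coset_subset[OF q(1)] by auto
    have zH: "?z \<in> stab ?q" using rcos_self[OF y H] xq(1) unfolding stab_def by blast
    have z: "?z \<in> carrier G" using y xq by simp
    have "f ?q = f {y} \<otimes>\<^bsub>A\<^esub> \<phi> ?z" using f(2)[OF F(1) le(1) F(3,4)] by (simp add: x1)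
    moreover have "f ?q = f {g \<otimes> y} \<otimes>\<^bsub>A\<^esub> \<phi> (g \<otimes> ?z)"
      using f(2)[OF F'(1) le(2) F'(3,4)] g y xq unfolding q' by (simp add: x1 m_assoc)
    moreover have "\<phi> (g \<otimes> ?z) = \<phi> g \<otimes>\<^bsub>A\<^esub> \<phi> ?z"
      by (rule loc[OF F(1) le(1) F(4) _ zH]) (use C'(4) q(2) in simp)
    ultimately have "f {y} \<otimes>\<^bsub>A\<^esub> \<phi> ?z = (f {g \<otimes> y} \<otimes>\<^bsub>A\<^esub> \<phi> g) \<otimes>\<^bsub>A\<^esub> \<phi> ?z"
      using fc[OF gy] phi[OF g] phi[OF z] by (simp add: A.m_assoc)
    then show ?thesis using fc[OF y] fc[OF gy] phi[OF g] phi[OF z] by (simp add: A.right_cancel)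
  qed
  have ghc: "g \<otimes> h \<in> carrier G" using gh by simp
  have "f {\<one>} = f {h} \<otimes>\<^bsub>A\<^esub> \<phi> h" using main[OF gh(2) one_closed] gh by simp
  also have "f {h} = f {g \<otimes> h} \<otimes>\<^bsub>A\<^esub> \<phi> g" using main[OF gh] by simp
  finally have "f {g \<otimes> h} \<otimes>\<^bsub>A\<^esub> \<phi> (g \<otimes> h) = f {g \<otimes> h} \<otimes>\<^bsub>A\<^esub> (\<phi> g \<otimes>\<^bsub>A\<^esub> \<phi> h)"
    using main[OF ghc one_closed] gh ghc fc[OF ghc] phi by (simp add: A.m_assoc)
  then show ?thesis using fc[OF ghc] phi gh ghc by simp
qed

text \<open>The link of the vertex M is the order complex of the coset poset of M: a coset that
  contains M is a subgroup, so by maximality every vertex comparable with M lies below it. The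
  facets through M inherit their ranks. A vertex removed in a shelling step is not M, because both
  facets contain M.\<close>

lemma link_shellable:
  assumes sh: "shellable_poset (coset_poset G)" and M: "maximal_subgroup M"
  shows "shellable_poset (coset_poset (G\<lparr>carrier := M\<rparr>))"
proof -
  have Ms: "subgroup M G" "M \<noteq> carrier G" using M by (auto simp: maximal_subgroup_def)
  let ?M = "G\<lparr>carrier := M\<rparr>"
  interpret M: finite_group ?M by (rule sub_group[OF Ms(1)])
  have cosM: "M.is_coset A \<longleftrightarrow> is_coset A \<and> A \<subseteq> M" for A
  proof
    assume "M.is_coset A"
    then obtain H x where H: "subgroup H ?M" "x \<in> M" "A = H #> x" by (auto simp: M.is_coset_def)
    then have H': "subgroup H G" "H \<subseteq> M" "x \<in> carrier G" using sub_iff[OF Ms(1)] subgroup.mem_carrier[OF Ms(1)] by auto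
    have "A \<subseteq> M" using H H' subgroup.m_closed[OF Ms(1)] by (auto simp: r_coset_def)
    then show "is_coset A \<and> A \<subseteq> M" using is_cosetI[OF H'(1,3)] H by simp
  next
    assume A: "is_coset A \<and> A \<subseteq> M"
    then obtain y where y: "y \<in> A" using coset_nonempty by blast
    have e: "A = stab A #> y" using coset_eq_stab A y by auto
    have "stab A \<subseteq> M" using stab_least[OF Ms(1)] A by auto
    then have "subgroup (stab A) ?M" using sub_iff[OF Ms(1)] stab_subgroup A by auto
    then show "M.is_coset A" unfolding M.is_coset_def using e A y
      by (intro exI[of _ "stab A"] exI[of _ y]) auto
  qed
  have Mc: "is_coset M" using is_cosetI[OF Ms(1) one_closed] subgroup.subset[OF Ms(1)] by simp
  have DM: "C \<in> order_complex (coset_poset ?M) \<longleftrightarrow>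
      (\<forall>A\<in>C. is_coset A \<and> A \<subset> M) \<and> (\<forall>A\<in>C. \<forall>B\<in>C. A \<subseteq> B \<or> B \<subseteq> A)" for C
    unfolding M.order_complex_iff cosM by auto
  have below: "A \<subset> M" if "is_coset A" "A \<noteq> carrier G" "A \<noteq> M" "A \<subseteq> M \<or> M \<subseteq> A" for A
  proof (rule ccontr)
    assume "\<not> A \<subset> M"
    then have MA: "M \<subseteq> A" using that by auto
    then have "\<one> \<in> A" using subgroup.one_closed[OF Ms(1)] by auto
    then have "A = stab A" using coset_eq_stab[OF that(1)] subgroup.subset[OF stab_subgroup[OF that(1)]] by force
    then have "subgroup A G" using stab_subgroup[OF that(1)] by simp
    then show False using M MA that by (auto simp: maximal_subgroup_def)
  qed
  have up: "insert M C \<in> order_complex (coset_poset G)" if "C \<in> order_complex (coset_poset ?M)" for C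
    using that Mc Ms(2) coset_subset[OF Mc] unfolding DM order_complex_iff by blast
  have down: "C - {M} \<in> order_complex (coset_poset ?M)" if "C \<in> order_complex (coset_poset G)" "M \<in> C" for C
    unfolding DM
  proof (intro conjI ballI)
    fix A assume A: "A \<in> C - {M}"
    have AC: "is_coset A" "A \<noteq> carrier G" "A \<noteq> M" "A \<subseteq> M \<or> M \<subseteq> A"
      using that A unfolding order_complex_iff by auto
    then show "is_coset A" "A \<subset> M" using below by auto
    fix B assume "B \<in> C - {M}"
    then show "A \<subseteq> B \<or> B \<subseteq> A" using that A unfolding order_complex_iff by auto
  qed
  have fM: "M \<notin> F \<and> insert M F \<in> coset_facets" if F: "F \<in> facets (order_complex (coset_poset ?M))" for F
  proof -
    note F1 = facetsD(1)[OF F]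
    then have nM: "M \<notin> F" unfolding DM by auto
    have "F' = insert M F" if F': "F' \<in> order_complex (coset_poset G)" "insert M F \<subseteq> F'" for F'
    proof -
      have "F' - {M} \<in> order_complex (coset_poset ?M)" using down F' by auto
      moreover have "F \<subseteq> F' - {M}" using F' nM by auto
      ultimately have "F' - {M} = F" using facetsD(2)[OF F] by simp
      then show ?thesis using F' by auto
    qed
    then have "insert M F \<in> coset_facets" by (intro facetsI up[OF F1])
    then show ?thesis using nM by simp
  qed
  have fG: "F - {M} \<in> facets (order_complex (coset_poset ?M))" if F: "F \<in> coset_facets" "M \<in> F" for F
  proof -
    note F1 = facetsD(1)[OF F(1)]
    have "F' = F - {M}" if F': "F' \<in> order_complex (coset_poset ?M)" "F - {M} \<subseteq> F'" for F'
    proof -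
      have "insert M F' \<in> order_complex (coset_poset G)" using up F' by auto
      moreover have "F \<subseteq> insert M F'" using F' by auto
      ultimately have "insert M F' = F" using facetsD(2)[OF F(1)] by simp
      moreover have "M \<notin> F'" using F'(1) unfolding DM by auto
      ultimately show ?thesis by auto
    qed
    then show ?thesis by (intro facetsI down[OF F1 F(2)])
  qed
  have sh': "shellable (order_complex (coset_poset G))" using sh by (simp add: shellable_poset_def)
  obtain r :: "'a set set \<Rightarrow> nat" where "finite coset_facets" and r: "inj_on r coset_facets"
    and step: "\<And>F F'. F \<in> coset_facets \<Longrightarrow> F' \<in> coset_facets \<Longrightarrow> r F' < r F \<Longrightarrow>
      \<exists>v\<in>F. \<exists>F''\<in>coset_facets. r F'' < r F \<and> F' \<inter> F \<subseteq> F - {v} \<and> F - {v} \<subseteq> F''"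
    using shellableD[OF sh'] by blast
  have "shellable (order_complex (coset_poset ?M))"
  proof (rule shellableI[where key = "\<lambda>F. r (insert M F)"])
    have "order_complex (coset_poset ?M) \<subseteq> Pow (Pow M)" unfolding subset_iff DM by auto
    then have "facets (order_complex (coset_poset ?M)) \<subseteq> Pow (Pow M)" using facetsD(1) by blast
    then show "finite (facets (order_complex (coset_poset ?M)))"
      using sub_finite[OF Ms(1)] by (meson finite_Pow_iff finite_subset)
    fix F F' assume F: "F \<in> facets (order_complex (coset_poset ?M))" and F': "F' \<in> facets (order_complex (coset_poset ?M))"
      and ne: "F \<noteq> F'" and le: "r (insert M F') \<le> r (insert M F)"
    note i = fM[OF F] fM[OF F']
    have "insert M F \<noteq> insert M F'" using i ne by (metis insert_ident)
    then have "r (insert M F') \<noteq> r (insert M F)" using inj_onD[OF r, of "insert M F'" "insert M F"] i by auto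
    then have "r (insert M F') < r (insert M F)" using le by simp
    then obtain v F'' where v: "v \<in> insert M F" "F'' \<in> coset_facets" "r F'' < r (insert M F)"
      "insert M F' \<inter> insert M F \<subseteq> insert M F - {v}" "insert M F - {v} \<subseteq> F''"
      using step[of "insert M F" "insert M F'"] i by blast
    have vM: "v \<noteq> M" using v(4) by auto
    then have "M \<in> F''" using v(5) by auto
    then have "F'' - {M} \<in> facets (order_complex (coset_poset ?M))" "insert M (F'' - {M}) = F''" using fG v(2) by auto
    moreover have "v \<in> F" using v(1) vM by auto
    moreover have "F' \<inter> F \<subseteq> F - {v}" "F - {v} \<subseteq> F'' - {M}" using v(4,5) i by auto
    ultimately show "\<exists>v\<in>F. \<exists>F''\<in>facets (order_complex (coset_poset ?M)). r (insert M F'') < r (insert M F) \<and>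
        F' \<inter> F \<subseteq> F - {v} \<and> F - {v} \<subseteq> F''"
      using v(3) by (intro bexI[of _ v] bexI[of _ "F'' - {M}"]) simp_all
  qed
  then show ?thesis by (simp add: shellable_poset_def)
qed

section \<open>Commutators and long chains\<close>

text \<open>The commutator x y x^-1 y^-1 written as a quotient. For normal C the relation says that
  the images in the factor group commute.\<close>

definition commute_mod :: "'a set \<Rightarrow> 'a \<Rightarrow> 'a \<Rightarrow> bool" where
  "commute_mod C x y \<longleftrightarrow> (x \<otimes> y) \<otimes> inv (y \<otimes> x) \<in> C"

lemma commute_mod_iff:
  assumes C: "C \<lhd> G" and xy: "x \<in> carrier G" "y \<in> carrier G"
  shows "commute_mod C x y \<longleftrightarrow> (C #> x) <#> (C #> y) = (C #> y) <#> (C #> x)"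
proof -
  have Cs: "subgroup C G" using C normal_imp_subgroup by auto
  have "(C #> x) <#> (C #> y) = C #> (x \<otimes> y)" "(C #> y) <#> (C #> x) = C #> (y \<otimes> x)"
    using normal.rcos_sum[OF C] xy by auto
  moreover have "C #> (x \<otimes> y) = C #> (y \<otimes> x) \<longleftrightarrow> x \<otimes> y \<in> C #> (y \<otimes> x)"
    using rcos_self[of "x \<otimes> y" C] repr_independence[of "x \<otimes> y" C "y \<otimes> x"] xy Cs by auto
  moreover have "x \<otimes> y \<in> C #> (y \<otimes> x) \<longleftrightarrow> commute_mod C x y"
    unfolding commute_mod_def using subgroup.rcos_module[OF Cs is_group, of "y \<otimes> x" "x \<otimes> y"] xy by auto
  ultimately show ?thesis by auto
qed

text \<open>It is the preimage of a centralizer in the factor group.\<close>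

lemma commute_mod_subgroup:
  assumes C: "C \<lhd> G" and x: "x \<in> carrier G"
  shows "subgroup {y \<in> carrier G. commute_mod C x y} G"
proof -
  interpret C: normal C G by (rule C)
  interpret Q: group "G Mod C" by (rule C.factorgroup_is_group)
  interpret \<pi>: group_hom G "G Mod C" "\<lambda>a. C #> a"
    by (simp add: group_hom_def group_hom_axioms_def is_group Q.is_group C.r_coset_hom_Mod)
  have fQ: "finite_group (G Mod C)"
    by (simp add: finite_group_def finite_group_axioms_def Q.is_group carrier_FactGroup fin)
  interpret fQ: finite_group "G Mod C" by (rule fQ)
  let ?Z = "{q \<in> carrier (G Mod C). \<forall>r\<in>{C #> x}. q \<otimes>\<^bsub>G Mod C\<^esub> r = r \<otimes>\<^bsub>G Mod C\<^esub> q}"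
  have Z: "subgroup ?Z (G Mod C)" using fQ.centralizer_subgroup[of "{C #> x}"] x by simp
  have eq: "{y \<in> carrier G. commute_mod C x y} = {y \<in> carrier G. C #> y \<in> ?Z}"
    using commute_mod_iff[OF C x] by (auto simp: carrier_FactGroup)
  show ?thesis unfolding eq
  proof (rule subgroupI)
    show "{y \<in> carrier G. C #> y \<in> ?Z} \<noteq> {}"
      using subgroup.one_closed[OF Z] \<pi>.hom_one by (metis (mono_tags, lifting) empty_iff mem_Collect_eq one_closed)
    fix a assume "a \<in> {y \<in> carrier G. C #> y \<in> ?Z}"
    then have a: "a \<in> carrier G" "C #> a \<in> ?Z" by blast+
    have "C #> inv a \<in> ?Z" using subgroup.m_inv_closed[OF Z a(2)] \<pi>.hom_inv[OF a(1)] by simp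
    then show "inv a \<in> {y \<in> carrier G. C #> y \<in> ?Z}" using a by blast
    fix b assume "b \<in> {y \<in> carrier G. C #> y \<in> ?Z}"
    then have b: "b \<in> carrier G" "C #> b \<in> ?Z" by blast+
    have "C #> (a \<otimes> b) \<in> ?Z" using subgroup.m_closed[OF Z a(2) b(2)] \<pi>.hom_mult[OF a(1) b(1)] by simp
    then show "a \<otimes> b \<in> {y \<in> carrier G. C #> y \<in> ?Z}" using a b by blast
  qed blast
qed

lemma commute_mod_sym:
  assumes "C \<lhd> G" "x \<in> carrier G" "y \<in> carrier G" "commute_mod C x y" shows "commute_mod C y x"
  using assms commute_mod_iff by metis

lemma commute_mod_self: "C \<lhd> G \<Longrightarrow> x \<in> carrier G \<Longrightarrow> commute_mod C x x"
  using commute_mod_iff by simp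

lemma commute_mod_mem:
  assumes C: "C \<lhd> G" and x: "x \<in> C" and y: "y \<in> carrier G" shows "commute_mod C x y"
proof -
  have Cs: "subgroup C G" using C normal_imp_subgroup by auto
  have xG: "x \<in> carrier G" using subgroup.mem_carrier[OF Cs x] .
  have "x \<otimes> y \<otimes> inv (y \<otimes> x) = x \<otimes> (y \<otimes> inv x \<otimes> inv y)" using xG y by (simp add: word_simps)
  then show ?thesis unfolding commute_mod_def
    using subgroup.m_closed[OF Cs x conj_closed[OF C y subgroup.m_inv_closed[OF Cs x]]] by simp
qed

text \<open>
  Otherwise let \<open>Z\<close> be the centre modulo \<open>C\<close> and \<open>M\<close> a maximal subgroup containing \<open>V\<close>. Distinct maximal
  subgroups containing \<open>V\<close> intersect in \<open>Z\<close>, so the map that is the projection to \<open>G/Z\<close> on \<open>M\<close> and trivial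
  off \<open>M\<close> is a homomorphism on every subgroup of a long chain, but not on the group.
\<close>

theorem commute_mod_if_proper:
  assumes sh: "shellable_poset (coset_poset G)" and s: "3 \<le> s"
    and V: "V \<lhd> G" and C: "C \<lhd> G" and VC: "V \<subseteq> C"
    and long: "\<And>F B. F \<in> coset_facets \<Longrightarrow> s \<le> card F \<Longrightarrow> B \<in> F \<Longrightarrow> V <#> stab B \<noteq> carrier G"
    and chain: "\<And>g. g \<in> carrier G \<Longrightarrow> \<exists>\<C> H. subgroup_chain \<C> \<and> s \<le> card \<C> \<and> H \<in> \<C> \<and> g \<in> H"
    and proper: "\<And>B x y. subgroup B G \<Longrightarrow> B \<noteq> carrier G \<Longrightarrow> V \<subseteq> B \<Longrightarrow> x \<in> B \<Longrightarrow> y \<in> B \<Longrightarrow> commute_mod C x y"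
    and xy: "x \<in> carrier G" "y \<in> carrier G"
  shows "commute_mod C x y"
proof (rule ccontr)
  assume nxy: "\<not> commute_mod C x y"
  have Vs: "subgroup V G" and Cs: "subgroup C G" using V C normal_imp_subgroup by auto
  define cent where "cent g = {h \<in> carrier G. commute_mod C g h}" for g
  have cent: "subgroup (cent g) G" if "g \<in> carrier G" for g
    unfolding cent_def by (rule commute_mod_subgroup[OF C that])
  define Z where "Z = {g \<in> carrier G. \<forall>h\<in>carrier G. commute_mod C g h}"
  have Z_cent: "g \<in> Z" if "g \<in> carrier G" "cent g = carrier G" for g
    using that unfolding Z_def cent_def by blast
  have Zs: "subgroup Z G"
  proof -
    have "Z = (\<Inter>h\<in>carrier G. cent h)"
      unfolding Z_def cent_def using commute_mod_sym[OF C] one_closed by blast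
    moreover have "subgroup (\<Inter>h\<in>carrier G. cent h) G"
      by (rule subgroups_Inter) (use cent one_closed in auto)
    ultimately show ?thesis by simp
  qed
  have VZ: "V \<subseteq> Z" using VC commute_mod_mem[OF C] subgroup.mem_carrier[OF Vs] unfolding Z_def by blast
  have Zn: "Z \<lhd> G" unfolding normal_iff
  proof (intro conjI Zs ballI)
    fix g z assume g: "g \<in> carrier G" and z: "z \<in> Z"
    have zG: "z \<in> carrier G" using z by (simp add: Z_def)
    have "commute_mod C g z" using z g commute_mod_sym[OF C] by (auto simp: Z_def)
    then have "g \<otimes> z \<otimes> inv (z \<otimes> g) \<in> Z"
      using commute_mod_mem[OF C] subgroup.mem_carrier[OF Cs] unfolding commute_mod_def Z_def by blast
    then have "g \<otimes> z \<otimes> inv (z \<otimes> g) \<otimes> z \<in> Z" using subgroup.m_closed[OF Zs] z by simp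
    moreover have "g \<otimes> z \<otimes> inv (z \<otimes> g) \<otimes> z = g \<otimes> z \<otimes> inv g" using g zG by (simp add: word_simps)
    ultimately show "g \<otimes> z \<otimes> inv g \<in> Z" by simp
  qed
  have Zne: "Z \<noteq> carrier G" using nxy xy by (auto simp: Z_def)
  have "V \<noteq> carrier G" using VZ Zne subgroup.subset[OF Zs] by auto
  then obtain M where M: "maximal_subgroup M" "V \<subseteq> M" using maximal_subgroup_ex[OF Vs] by blast
  have Ms: "subgroup M G" "M \<noteq> carrier G" using M by (auto simp: maximal_subgroup_def)
  \<comment> \<open>The centralizer modulo C contains the maximal subgroup M properly.\<close>
  have cent_top: "cent g = carrier G" if g: "g \<in> carrier G" "M \<subseteq> cent g" "h \<in> cent g" "h \<notin> M" for g h
    using M(1) cent[OF g(1)] g(2-4) unfolding maximal_subgroup_def by blast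
  have M_cent: "M \<subseteq> cent g" if "g \<in> M" for g
    using proper[OF Ms M(2) that] subgroup.mem_carrier[OF Ms(1)] unfolding cent_def by blast
  have MG: "g \<in> carrier G" if "g \<in> M" for g using subgroup.mem_carrier[OF Ms(1) that] .
  have ZM: "Z \<subseteq> M"
  proof (rule ccontr)
    assume "\<not> Z \<subseteq> M"
    then obtain z where z: "z \<in> Z" "z \<notin> M" by auto
    have "M \<subseteq> Z"
    proof
      fix g assume g: "g \<in> M"
      have "z \<in> cent g" using z g MG[OF g] commute_mod_sym[OF C] by (auto simp: Z_def cent_def)
      then show "g \<in> Z" using Z_cent[OF MG[OF g] cent_top[OF MG[OF g] M_cent[OF g] _ z(2)]] by simp
    qed
    then show False using M(1) Zs Zne z unfolding maximal_subgroup_def by blast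
  qed
  obtain t where t: "t \<in> carrier G" "t \<notin> M" using Ms subgroup.subset[OF Ms(1)] by auto
  have "M \<noteq> Z"
  proof
    assume "M = Z"
    then have "M \<subseteq> cent t" using t(1) commute_mod_sym[OF C] by (auto simp: Z_def cent_def)
    moreover have "t \<in> cent t" using commute_mod_self[OF C] t(1) by (simp add: cent_def)
    ultimately have "t \<in> Z" using Z_cent[OF t(1)] cent_top[OF t(1)] t(2) by blast
    then show False using ZM t(2) by auto
  qed
  then obtain m where m: "m \<in> M" "m \<notin> Z" using ZM by auto
  interpret Z: normal Z G by (rule Zn)
  define \<phi> where "\<phi> g = (if g \<in> M then Z #> g else Z)" for g
  have ZZ: "Z <#> Z = Z" using Z.rcos_sum[OF one_closed one_closed] subgroup.subset[OF Zs] by simp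
  have phi_mult: "\<phi> (g \<otimes> h) = \<phi> g \<otimes>\<^bsub>G Mod Z\<^esub> \<phi> h" if gh: "g \<in> carrier G" "h \<in> carrier G" for g h
  proof (rule hom_if_hom_on_long_chains[OF sh s Z.factorgroup_is_group _ _ chain gh])
    fix g assume "g \<in> carrier G"
    then show "\<phi> g \<in> carrier (G Mod Z)"
      using coset_mult_one[OF subgroup.subset[OF Zs]] one_closed unfolding \<phi>_def carrier_FactGroup
      by (metis imageI)
  next
    fix F B a b assume F: "F \<in> coset_facets" "s \<le> card F" "B \<in> F" and ab: "a \<in> stab B" "b \<in> stab B"
    have Bs: "subgroup (stab B) G" using stab_subgroup[OF facet_chain(1)[OF F(1,3)]] .
    have abG: "a \<in> carrier G" "b \<in> carrier G" using subgroup.mem_carrier[OF Bs] ab by auto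
    let ?H = "V <#> stab B"
    have H: "subgroup ?H G" "?H \<noteq> carrier G" using normal_mult_subgroup[OF V Bs] long[OF F] by auto
    have sub: "V \<subseteq> ?H" "stab B \<subseteq> ?H"
      using sub_set_mult1[OF Bs subgroup.subset[OF Vs]] sub_set_mult2[OF Vs subgroup.subset[OF Bs]] by auto
    show "\<phi> (a \<otimes> b) = \<phi> a \<otimes>\<^bsub>G Mod Z\<^esub> \<phi> b"
    proof (cases "?H \<subseteq> M")
      case True
      then have "a \<in> M" "b \<in> M" using sub ab by auto
      then show ?thesis using subgroup.m_closed[OF Ms(1)] Z.rcos_sum[OF abG] by (simp add: \<phi>_def)
    next
      case False
      then obtain h where h: "h \<in> ?H" "h \<notin> M" by auto
      \<comment> \<open>An element g of M in this stabilizer commutes modulo C with M and with h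
        outside M, since M and the proper subgroup \<open>?H\<close> both contain V. So g lies in Z,
        and its image is trivial as well.\<close>
      have triv: "\<phi> g = Z" if g: "g \<in> stab B" for g
      proof (cases "g \<in> M")
        case True
        have hG: "h \<in> carrier G" using subgroup.mem_carrier[OF H(1) h(1)] .
        have "h \<in> cent g" using proper[OF H sub(1) subsetD[OF sub(2) g] h(1)] hG by (simp add: cent_def)
        then have "g \<in> Z" using Z_cent[OF MG[OF True] cent_top[OF MG[OF True] M_cent[OF True] _ h(2)]] by simp
        then show ?thesis using True coset_join2[OF MG[OF True] Zs] by (simp add: \<phi>_def)
      qed (simp add: \<phi>_def)
      show ?thesis using triv[OF ab(1)] triv[OF ab(2)] triv[OF subgroup.m_closed[OF Bs ab]] ZZ by simp
    qed
  qed
  have mG: "m \<in> carrier G" using MG[OF m(1)] .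
  \<comment> \<open>The map is trivial at t and at t m, which are both outside M, while m has a
    nontrivial image.\<close>
  have "t \<otimes> m \<notin> M"
  proof
    assume "t \<otimes> m \<in> M"
    then have "t \<otimes> m \<otimes> inv m \<in> M" using subgroup.m_closed[OF Ms(1)] subgroup.m_inv_closed[OF Ms(1) m(1)] by simp
    then show False using t mG by (simp add: word_simps)
  qed
  then have "Z = Z <#> (Z #> m)" using phi_mult[OF t(1) mG] t(2) m(1) by (simp add: \<phi>_def)
  also have "\<dots> = Z #> m" using Z.rcos_sum[OF one_closed mG] subgroup.subset[OF Zs] mG by simp
  finally have "m \<in> Z" using rcos_self[OF mG Zs] by simp
  then show False using m(2) by simp
qed

section \<open>Groups of prime power order\<close>

lemma abelian_p_group_exponent:
  assumes comm: "\<And>x y. x \<in> carrier G \<Longrightarrow> y \<in> carrier G \<Longrightarrow> x \<otimes> y = y \<otimes> x"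
  shows "subgroup {x \<in> carrier G. x [^] (p::nat) = \<one>} G"
proof -
  interpret comm_group G by (rule group_comm_groupI) (rule comm)
  show ?thesis by (rule subgroupI) (auto simp: pow_mult_distrib nat_pow_inv comm intro: exI[of _ \<one>])
qed

text \<open>A subgroup of order p splits off, and its complement is proper.\<close>

lemma elementary_supersolvable_if_elementary:
  fixes p :: nat
  assumes comm: "\<And>x y. x \<in> carrier G \<Longrightarrow> y \<in> carrier G \<Longrightarrow> x \<otimes> y = y \<otimes> x"
    and p: "prime p" and ex: "\<And>x. x \<in> carrier G \<Longrightarrow> x [^] p = \<one>"
    and proper: "\<And>H. subgroup H G \<Longrightarrow> H \<noteq> carrier G \<Longrightarrow> elementary_supersolvable (G\<lparr>carrier := H\<rparr>)"
  shows "elementary_supersolvable G"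
proof -
  have el: "elementary_p_subgroups G" unfolding elementary_p_subgroups_def
  proof (intro allI impI ballI conjI)
    fix q :: nat and S x assume q: "prime q" "subgroup S G" "\<exists>k. card S = q ^ k" "x \<in> S"
    have xG: "x \<in> carrier G" using subgroup.mem_carrier[OF q(2,4)] .
    show "x \<otimes> y = y \<otimes> x" if "y \<in> S" for y using comm[OF xG] subgroup.mem_carrier[OF q(2) that] by simp
    show "x [^] q = \<one>"
    proof (cases "x = \<one>")
      case False
      obtain k where k: "card S = q ^ k" using q(3) by auto
      have "card (generate G {x}) = p" by (rule card_generate_prime[OF xG False ex[OF xG] p])
      then have "p dvd q ^ k"
        using card_dvd[OF q(2) generate_singleton_subgroup[OF xG] sub_generate[OF q(2,4)]] k by simp
      then have "p = q" using p q(1) by (meson prime_dvd_power primes_dvd_imp_eq)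
      then show ?thesis using ex[OF xG] by simp
    qed simp
  qed
  have "has_prime_series G"
  proof (cases "carrier G = {\<one>}")
    case True
    then show ?thesis using one_is_normal
      by (intro has_prime_series_if_weak_series[of "\<lambda>_. {\<one>}" 0]) auto
  next
    case False
    then obtain x where x: "x \<in> carrier G" "x \<noteq> \<one>" using one_closed by blast
    let ?V = "generate G {x}"
    have V: "subgroup ?V G" "card ?V = p ^ 1"
      using generate_singleton_subgroup[OF x(1)] card_generate_prime[OF x ex[OF x(1)] p] by auto
    have Vn: "?V \<lhd> G" unfolding normal_iff
    proof (intro conjI V(1) ballI)
      fix g h assume g: "g \<in> carrier G" and h: "h \<in> ?V"
      have hG: "h \<in> carrier G" using subgroup.mem_carrier[OF V(1) h] .
      have "g \<otimes> h \<otimes> inv g = h" unfolding comm[OF g hG] using g hG by (simp add: word_simps)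
      then show "g \<otimes> h \<otimes> inv g \<in> ?V" using h by simp
    qed
    obtain K where K: "subgroup K G" "?V \<inter> K = {\<one>}" "?V <#> K = carrier G"
      using normal_p_subgroup_complement[OF el Vn V(2) p] by blast
    have "card (carrier G) = p * card K" using card_set_mult_disjoint[OF V(1) K(1,2)] K(3) V(2) by simp
    then have "K \<noteq> carrier G" using prime_gt_1_nat[OF p] sub_card_pos[OF K(1)] by auto
    then show ?thesis using has_prime_series_extend[OF Vn _ K] proper[OF K(1)] V(2) p by (simp add: elementary_supersolvable_def)
  qed
  then show ?thesis using el by (simp add: elementary_supersolvable_def)
qed

text \<open>Conjugation acts on the nontrivial elements, whose number is -1 modulo p.\<close>

lemma p_group_center:
  assumes p: "prime p" "card (carrier G) = p ^ Suc k"
  obtains e where "e \<in> carrier G" "e \<noteq> \<one>" "\<And>g. g \<in> carrier G \<Longrightarrow> g \<otimes> e = e \<otimes> g"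
proof -
  let ?E = "carrier G - {\<one>}"
  have nd: "\<not> p dvd card ?E"
  proof
    assume "p dvd card ?E"
    moreover have "card (carrier G) = Suc (card ?E)" by (rule card.remove[OF fin one_closed])
    moreover have "p dvd card (carrier G)" using p(2) by simp
    ultimately have "p dvd 1" by (metis dvd_add_right_iff plus_1_eq_Suc add.commute)
    then show False using prime_gt_1_nat[OF p(1)] by simp
  qed
  obtain e where e: "e \<in> ?E" "\<And>g. g \<in> carrier G \<Longrightarrow> g \<otimes> e \<otimes> inv g = e"
  proof (rule p_action_fixed_point[OF finite_group_axioms p(1) p(2) _ _ _ _ nd, where act = "\<lambda>g e. g \<otimes> e \<otimes> inv g"])
    fix g e assume g: "g \<in> carrier G" and e: "e \<in> ?E"
    have "g \<otimes> e \<otimes> inv g \<noteq> \<one>"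
    proof
      assume "g \<otimes> e \<otimes> inv g = \<one>"
      then have "inv g \<otimes> (g \<otimes> e \<otimes> inv g) \<otimes> g = \<one>" using g by simp
      then show False using g e by (simp add: word_simps)
    qed
    then show "g \<otimes> e \<otimes> inv g \<in> ?E" using g e by simp
  qed (use fin in \<open>auto simp: word_simps\<close>)
  have "g \<otimes> e = e \<otimes> g" if g: "g \<in> carrier G" for g
  proof -
    have "g \<otimes> e \<otimes> inv g \<otimes> g = e \<otimes> g" using e(2)[OF g] by simp
    then show ?thesis using g e(1) by (simp add: word_simps)
  qed
  then show thesis using that e(1) by blast
qed

text \<open>Commutativity comes from the cocycle statement with V and C trivial and s = 3, the
  exponent from connectivity with s = 2: the elements of order dividing p form a subgroup that
  contains every proper subgroup. A group without proper nontrivial subgroups is trivial or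
  generated by an element of order p.\<close>

lemma elementary_supersolvable_p_group:
  assumes sh: "shellable_poset (coset_poset G)" and p: "prime p" "card (carrier G) = p ^ k"
    and proper: "\<And>H. subgroup H G \<Longrightarrow> H \<noteq> carrier G \<Longrightarrow> elementary_supersolvable (G\<lparr>carrier := H\<rparr>)"
  shows "elementary_supersolvable G"
proof -
  have pr: "x [^] p = \<one>" "y \<in> H \<Longrightarrow> x \<otimes> y = y \<otimes> x" if H: "subgroup H G" "H \<noteq> carrier G" "x \<in> H" for H x y
  proof -
    interpret H: finite_group "G\<lparr>carrier := H\<rparr>" by (rule sub_group[OF H(1)])
    have "card H dvd p ^ k" using card_dvd_carrier[OF H(1)] p(2) by simp
    then obtain j where j: "card H = p ^ j" using divides_primepow_nat[OF p(1)] by auto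
    have "subgroup H (G\<lparr>carrier := H\<rparr>)" using sub_iff[OF H(1)] H(1) by auto
    note e = H.elementary_p_subgroupsD[OF _ p(1) this j H(3)]
    have el: "elementary_p_subgroups (G\<lparr>carrier := H\<rparr>)" using proper[OF H(1,2)] by (simp add: elementary_supersolvable_def)
    show "x [^] p = \<one>" using e(1)[OF el] nat_pow_consistent[of x p H] by simp
    show "y \<in> H \<Longrightarrow> x \<otimes> y = y \<otimes> x" using e(2)[OF el] by simp
  qed
  have comm: "x \<otimes> y = y \<otimes> x" if xy: "x \<in> carrier G" "y \<in> carrier G" for x y
  proof (rule ccontr)
    assume nxy: "x \<otimes> y \<noteq> y \<otimes> x"
    have "k \<noteq> 0"
    proof
      assume "k = 0"
      then obtain z where "carrier G = {z}" using p(2) card_1_singletonE by auto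
      then show False using nxy xy by auto
    qed
    then obtain k' where "k = Suc k'" by (cases k) auto
    then obtain e where e: "e \<in> carrier G" "e \<noteq> \<one>" "\<And>g. g \<in> carrier G \<Longrightarrow> g \<otimes> e = e \<otimes> g"
      using p_group_center[of p k'] p by metis
    let ?E = "generate G {e}" and ?Z = "{z \<in> carrier G. \<forall>h\<in>carrier G. z \<otimes> h = h \<otimes> z}"
    have Z: "subgroup ?Z G" using centralizer_subgroup[of "carrier G"] by simp
    have Zne: "?Z \<noteq> carrier G" using nxy xy by blast
    have E: "subgroup ?E G" "e \<in> ?E" using generate_singleton_subgroup[OF e(1)] generate.incl[of e "{e}" G] by auto
    have EZ: "?E \<subseteq> ?Z" using sub_generate[OF Z] e by auto
    have En: "?E \<lhd> G" unfolding normal_iff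
    proof (intro conjI E(1) ballI)
      fix g h assume g: "g \<in> carrier G" and h: "h \<in> ?E"
      have hg: "h \<in> carrier G" "h \<otimes> g = g \<otimes> h" using EZ h g by auto
      have "g \<otimes> h \<otimes> inv g = h" unfolding hg(2)[symmetric] using g hg(1) by (simp add: word_simps)
      then show "g \<otimes> h \<otimes> inv g \<in> ?E" using h by simp
    qed
    have Ene: "?E \<noteq> carrier G" using EZ Zne subgroup.subset[OF Z] by auto
    have one_n: "{\<one>} \<lhd> G" by (rule one_is_normal)
    have one_ne: "{\<one>} \<noteq> carrier G"
    proof
      assume c: "{\<one>} = carrier G"
      have "x = \<one>" "y = \<one>" using xy unfolding c[symmetric] by auto
      then show False using nxy by simp
    qed
    \<comment> \<open>The chain 1 < <e> < <e, g> with e central consists of proper subgroups, since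
      <e, g> is abelian and the group is not. It has the three members that s = 3 requires.\<close>
    have chain1: "\<exists>\<C> H. subgroup_chain \<C> \<and> 3 \<le> card \<C> \<and> H \<in> \<C> \<and> g \<in> H \<and> ?E \<subseteq> H" if g: "g \<in> carrier G" "g \<notin> ?E" for g
    proof -
      let ?X = "generate G {g}"
      have X: "subgroup ?X G" "g \<in> ?X" using generate_singleton_subgroup[OF g(1)] generate.incl[of g "{g}" G] by auto
      let ?B = "?E <#> ?X"
      have B: "subgroup ?B G" by (rule normal_mult_subgroup[OF En X(1)])
      have sub: "?E \<subseteq> ?B" "?X \<subseteq> ?B"
        using sub_set_mult1[OF X(1) subgroup.subset[OF E(1)]] sub_set_mult2[OF E(1) subgroup.subset[OF X(1)]] by auto
      have Bne: "?B \<noteq> carrier G"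
      proof
        assume B: "?B = carrier G"
        let ?C = "{z \<in> carrier G. \<forall>h\<in>{g}. z \<otimes> h = h \<otimes> z}"
        have C: "subgroup ?C G" using centralizer_subgroup[of "{g}"] g by simp
        have "e \<in> ?C" "g \<in> ?C" using e g by auto
        then have "?B \<subseteq> ?C" using sub_generate[OF C] by (intro set_mult_least[OF C]) auto
        then have "g \<in> ?Z" using B g(1) by auto
        then have "?B \<subseteq> ?Z" using sub_generate[OF Z] EZ by (intro set_mult_least[OF Z]) auto
        then show False using B Zne by blast
      qed
      have c: "{\<one>} \<noteq> ?E" "{\<one>} \<noteq> ?B" "?E \<noteq> ?B" using E(2) e(2) sub X(2) g(2) by auto
      have "subgroup_chain {{\<one>}, ?E, ?B}" unfolding subgroup_chain_def
        using triv_subgroup E(1) B Bne Ene one_ne sub(1) subgroup.one_closed[OF E(1)] subgroup.one_closed[OF B]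
        by simp
      moreover have "card {{\<one>}, ?E, ?B} = 3" using c by simp
      ultimately show ?thesis using sub X(2) by (intro exI[of _ "{{\<one>}, ?E, ?B}"] exI[of _ ?B]) auto
    qed
    have "commute_mod {\<one>} x y"
    proof (rule commute_mod_if_proper[OF sh, of 3 "{\<one>}"])
      fix F B assume "F \<in> coset_facets" "B \<in> F"
      then have B: "is_coset B" "B \<noteq> carrier G" using facet_chain by auto
      have "{\<one>} <#> stab B = stab B"
        using subgroup.subset[OF stab_subgroup[OF B(1)]] by (force simp: set_mult_def)
      then show "{\<one>} <#> stab B \<noteq> carrier G" using stab_proper[OF B] by simp
    next
      fix g assume g: "g \<in> carrier G"
      show "\<exists>\<C> H. subgroup_chain \<C> \<and> 3 \<le> card \<C> \<and> H \<in> \<C> \<and> g \<in> H"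
      proof (cases "g \<in> ?E")
        case True
        obtain g' where "g' \<in> carrier G" "g' \<notin> ?E" using Ene subgroup.subset[OF E(1)] by auto
        then show ?thesis using chain1[of g'] True by blast
      next
        case False then show ?thesis using chain1[OF g] by blast
      qed
    next
      fix B a b assume B: "subgroup B G" "B \<noteq> carrier G" "a \<in> B" "b \<in> B"
      have "a \<otimes> b = b \<otimes> a" using pr(2)[OF B(1,2,3,4)] .
      then show "commute_mod {\<one>} a b" using subgroup.mem_carrier[OF B(1)] B(3,4) by (simp add: commute_mod_def)
    qed (use one_n xy in auto)
    then have "x \<otimes> y \<otimes> inv (y \<otimes> x) \<otimes> (y \<otimes> x) = y \<otimes> x" using xy by (simp add: commute_mod_def)
    then show False using nxy xy by (simp add: m_assoc)
  qed
  let ?S = "{x \<in> carrier G. x [^] p = \<one>}"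
  have S: "subgroup ?S G" by (rule abelian_p_group_exponent[OF comm])
  have "?S = carrier G"
  proof (cases "\<exists>H. subgroup H G \<and> H \<noteq> carrier G \<and> H \<noteq> {\<one>}")
    case True
    then obtain H where H: "subgroup H G" "H \<noteq> carrier G" "H \<noteq> {\<one>}" by auto
    have H1: "\<one> \<in> H" using subgroup.one_closed[OF H(1)] .
    have "{\<one>} \<noteq> carrier G" using H subgroup.subset[OF H(1)] H1 by auto
    then have "subgroup_chain {{\<one>}, H}" unfolding subgroup_chain_def using triv_subgroup H H1 by auto
    moreover have "2 \<le> card {{\<one>}, H}" using H(3) by simp
    ultimately show ?thesis
    proof (rule generated_by_long_chains[OF sh order_refl S, rotated])
      fix F A assume "F \<in> coset_facets" "A \<in> F"
      then have A: "is_coset A" "A \<noteq> carrier G" using facet_chain by auto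
      show "stab A \<subseteq> ?S"
        using pr(1)[OF stab_subgroup[OF A(1)] stab_proper[OF A]] subgroup.mem_carrier[OF stab_subgroup[OF A(1)]] by auto
    qed
  next
    case False
    show ?thesis
    proof (cases "k = 0")
      case True
      then obtain z where "carrier G = {z}" using p(2) card_1_singletonE by auto
      then have "carrier G = {\<one>}" using one_closed by auto
      then show ?thesis using nat_pow_one by blast
    next
      case k: False
      then have "p dvd card (carrier G)" using p(2) by simp
      then obtain x where x: "x \<in> carrier G" "x \<noteq> \<one>" "x [^] p = \<one>" "card (generate G {x}) = p" using cauchy[OF p(1)] by blast
      have "generate G {x} \<subseteq> ?S" using sub_generate[OF S] x by auto
      moreover have "generate G {x} = carrier G"
        using False generate_singleton_subgroup[OF x(1)] generate.incl[of x "{x}" G] x(2) by auto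
      ultimately show ?thesis using subgroup.subset[OF S] by blast
    qed
  qed
  then have ex: "x [^] p = \<one>" if "x \<in> carrier G" for x using that by blast
  show ?thesis by (rule elementary_supersolvable_if_elementary[OF comm p(1) ex proper])
qed

end

section \<open>Groups with shellable coset poset\<close>

text \<open>The arithmetic function Omega; at the order of a group it bounds the length of subgroup
  chains.\<close>

definition bigomega :: "nat \<Rightarrow> nat" where "bigomega n = size (prime_factorization n)"

lemma bigomega_mult: "0 < a \<Longrightarrow> 0 < b \<Longrightarrow> bigomega (a * b) = bigomega a + bigomega b"
  by (simp add: bigomega_def prime_factorization_mult)

lemma bigomega_prime: "prime p \<Longrightarrow> bigomega p = 1"
  by (simp add: bigomega_def prime_factorization_prime)

lemma bigomega_one: "bigomega 1 = 0"
  by (simp add: bigomega_def)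

lemma bigomega_prime_power: "prime p \<Longrightarrow> bigomega (p ^ n) = n"
  by (induction n) (simp_all add: bigomega_one[simplified] bigomega_mult bigomega_prime prime_gt_0_nat)

lemma bigomega_pos: "1 < n \<Longrightarrow> 0 < bigomega n"
  by (auto simp: bigomega_def prime_factorization_empty_iff nonempty_has_size[symmetric])

lemma bigomega_dvd_less:
  assumes "a dvd b" "a < b" shows "bigomega a < bigomega b"
proof -
  obtain c where c: "b = a * c" using assms by auto
  then have "0 < a" "1 < c" using assms by (cases c; auto)+
  then show ?thesis using bigomega_mult[of a c] bigomega_pos[of c] c by simp
qed

section \<open>Chain lengths and actions on minimal normal subgroups\<close>

context finite_group begin

text \<open>A series with prime factors attains the bound of \<open>facet_card_le_bigomega\<close>.
  Its terms are distinct, because Omega of the order of the i-th term is i.\<close>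

lemma series_chain:
  assumes B: "subgroup B G" "B \<noteq> carrier G" and ss: "has_prime_series (G\<lparr>carrier := B\<rparr>)"
  obtains \<C> where "subgroup_chain \<C>" "card \<C> = Suc (bigomega (card B))" "B \<in> \<C>"
proof -
  obtain d N where N: "N 0 = {\<one>}" "N d = B" "\<And>i. i \<le> d \<Longrightarrow> N i \<lhd> G\<lparr>carrier := B\<rparr>"
    "\<And>i. i < d \<Longrightarrow> N i \<subseteq> N (Suc i) \<and> (\<exists>p. prime p \<and> card (N (Suc i)) = p * card (N i))"
    using ss unfolding has_prime_series_def prime_series_def by auto
  have s: "subgroup (N i) G" "N i \<subseteq> B" if "i \<le> d" for i using N(3)[OF that] normal_sub_iff[OF B(1)] by auto
  have om: "bigomega (card (N i)) = i" if "i \<le> d" for i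
    using that
  proof (induction i)
    case 0 then show ?case using N(1) bigomega_one by simp
  next
    case (Suc i)
    then obtain p where p: "prime p" "card (N (Suc i)) = p * card (N i)" using N(4)[of i] by auto
    show ?case unfolding p(2)
      using Suc bigomega_mult[of p "card (N i)"] prime_gt_0_nat[OF p(1)] sub_card_pos[OF s(1)[of i]] bigomega_prime[OF p(1)]
      by simp
  qed
  have mono: "N i \<subseteq> N j" if "i \<le> j" "j \<le> d" for i j
    using that by (induction j rule: dec_induct) (use N(4) in \<open>auto simp: less_eq_Suc_le\<close>)
  have "subgroup_chain (N ` {..d})" unfolding subgroup_chain_def
  proof (intro conjI ballI)
    fix H K assume "H \<in> N ` {..d}" "K \<in> N ` {..d}"
    then obtain i j where "H = N i" "K = N j" "i \<le> d" "j \<le> d" by auto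
    then show "H \<subseteq> K \<or> K \<subseteq> H" using mono[of i j] mono[of j i] by (cases "i \<le> j") auto
  next
    fix H assume "H \<in> N ` {..d}"
    then obtain i where i: "H = N i" "i \<le> d" by auto
    then show "subgroup H G" "H \<noteq> carrier G" using s[OF i(2)] B subgroup.subset[OF B(1)] by auto
  next
    show "{\<one>} \<in> N ` {..d}" using N(1) by (intro image_eqI[of _ _ 0]) auto
  qed
  moreover have "inj_on N {..d}" by (rule inj_onI) (metis om atMost_iff)
  then have "card (N ` {..d}) = Suc (bigomega (card B))" using om[of d] N(2) by (simp add: card_image)
  ultimately show thesis using that N(2) by blast
qed

lemma conj_pow:
  assumes "g \<in> carrier G" "v \<in> carrier G" shows "g \<otimes> v [^] (n::nat) \<otimes> inv g = (g \<otimes> v \<otimes> inv g) [^] n"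
proof (induction n)
  case (Suc n)
  have "g \<otimes> v [^] Suc n \<otimes> inv g = (g \<otimes> v [^] n \<otimes> inv g) \<otimes> (g \<otimes> v \<otimes> inv g)"
    using assms by (simp add: word_simps)
  then show ?case using Suc by simp
qed (use assms in simp)

lemma prime_normal_conj:
  assumes W: "W \<lhd> G" "prime (card W)" and w: "w \<in> W" "w \<noteq> \<one>" and g: "g \<in> carrier G"
  obtains k :: nat where "g \<otimes> w \<otimes> inv g = w [^] k"
proof -
  have Ws: "subgroup W G" using W normal_imp_subgroup by auto
  have wG: "w \<in> carrier G" using subgroup.mem_carrier[OF Ws w(1)] .
  have "g \<otimes> w \<otimes> inv g \<in> generate G {w}"
    using conj_closed[OF W(1) g w(1)] prime_subgroup_eq_generate[OF Ws W(2) w] by simp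
  then show thesis using that generate_powers[OF wG] by auto
qed

text \<open>Conjugations act on the cyclic group W as power maps, and these commute.\<close>

lemma prime_normal_conj_commute:
  assumes W: "W \<lhd> G" "prime (card W)" and w: "w \<in> W" and xy: "x \<in> carrier G" "y \<in> carrier G"
  shows "(x \<otimes> y) \<otimes> w \<otimes> inv (x \<otimes> y) = (y \<otimes> x) \<otimes> w \<otimes> inv (y \<otimes> x)"
proof (cases "w = \<one>")
  case False
  have wG: "w \<in> carrier G" using subgroup.mem_carrier[OF normal_imp_subgroup[OF W(1)] w] .
  obtain a where a: "x \<otimes> w \<otimes> inv x = w [^] (a::nat)" using prime_normal_conj[OF W w False xy(1)] by blast
  obtain b where b: "y \<otimes> w \<otimes> inv y = w [^] (b::nat)" using prime_normal_conj[OF W w False xy(2)] by blast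
  have "(x \<otimes> y) \<otimes> w \<otimes> inv (x \<otimes> y) = x \<otimes> (y \<otimes> w \<otimes> inv y) \<otimes> inv x" using xy wG by (simp add: word_simps)
  also have "\<dots> = w [^] (a * b)" unfolding b conj_pow[OF xy(1) wG] a using wG by (simp add: nat_pow_pow)
  also have "\<dots> = y \<otimes> (x \<otimes> w \<otimes> inv x) \<otimes> inv y"
    unfolding a conj_pow[OF xy(2) wG] b using wG by (simp add: nat_pow_pow mult.commute)
  also have "\<dots> = (y \<otimes> x) \<otimes> w \<otimes> inv (y \<otimes> x)" using xy wG by (simp add: word_simps)
  finally show ?thesis .
qed (use xy in simp)

text \<open>Conjugations commute on each normal subgroup of prime order in V, so the centralizer of
  all commutators contains these subgroups, and \<open>socle_eq\<close> extends this to V. Thus the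
  group acts on V through an abelian group.\<close>

lemma commutators_centralize:
  assumes X: "elementary_supersolvable G" and V: "V \<lhd> G" "card V = p ^ k" "prime p"
    and xy: "x \<in> carrier G" "y \<in> carrier G" and v: "v \<in> V"
  shows "(x \<otimes> y \<otimes> inv (y \<otimes> x)) \<otimes> v = v \<otimes> (x \<otimes> y \<otimes> inv (y \<otimes> x))"
proof -
  have Vs: "subgroup V G" using V normal_imp_subgroup by auto
  have VG: "v \<in> carrier G" if "v \<in> V" for v using subgroup.mem_carrier[OF Vs that] .
  define S where "S = {x \<otimes> y \<otimes> inv (y \<otimes> x) | x y. x \<in> carrier G \<and> y \<in> carrier G}"
  have SG: "S \<subseteq> carrier G" by (auto simp: S_def)
  define C where "C = {g \<in> carrier G. \<forall>s\<in>S. g \<otimes> s = s \<otimes> g}"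
  have C: "subgroup C G" unfolding C_def by (rule centralizer_subgroup[OF SG])
  have D: "C \<inter> V \<lhd> G" unfolding normal_iff
  proof (intro conjI ballI)
    show "subgroup (C \<inter> V) G" using subgroups_Inter_pair[OF C Vs] .
    fix g v assume g: "g \<in> carrier G" and v: "v \<in> C \<inter> V"
    have vG: "v \<in> carrier G" using v VG by simp
    have "g \<otimes> v \<otimes> inv g \<otimes> s = s \<otimes> (g \<otimes> v \<otimes> inv g)" if s: "s \<in> S" for s
    proof -
      obtain x y where xy: "x \<in> carrier G" "y \<in> carrier G" "s = x \<otimes> y \<otimes> inv (y \<otimes> x)" using s by (auto simp: S_def)
      let ?x = "inv g \<otimes> x \<otimes> g" and ?y = "inv g \<otimes> y \<otimes> g"
      let ?s = "inv g \<otimes> s \<otimes> g"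
      have sG: "s \<in> carrier G" using s SG by auto
      have "?s = ?x \<otimes> ?y \<otimes> inv (?y \<otimes> ?x)" using xy g by (simp add: word_simps)
      then have "?s \<in> S" using xy g unfolding S_def by blast
      then have vs: "v \<otimes> ?s = ?s \<otimes> v" using v by (simp add: C_def)
      have "g \<otimes> v \<otimes> inv g \<otimes> s = g \<otimes> (v \<otimes> ?s) \<otimes> inv g" using g vG sG by (simp add: word_simps)
      also have "\<dots> = s \<otimes> (g \<otimes> v \<otimes> inv g)" unfolding vs using g vG sG by (simp add: word_simps)
      finally show ?thesis .
    qed
    then show "g \<otimes> v \<otimes> inv g \<in> C \<inter> V" using g vG conj_closed[OF V(1) g] v by (simp add: C_def)
  qed
  have "C \<inter> V = V"
  proof (rule socle_eq[OF X V D])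
    fix W assume W: "W \<lhd> G" "W \<subseteq> V" "prime (card W)"
    show "W \<subseteq> C \<inter> V"
    proof
      fix w assume w: "w \<in> W"
      have wG: "w \<in> carrier G" using w W VG by auto
      have "w \<otimes> s = s \<otimes> w" if s: "s \<in> S" for s
      proof -
        obtain x y where xy: "x \<in> carrier G" "y \<in> carrier G" "s = x \<otimes> y \<otimes> inv (y \<otimes> x)" using s by (auto simp: S_def)
        let ?u = "inv (y \<otimes> x) \<otimes> w \<otimes> (y \<otimes> x)"
        have u: "?u \<in> W" using conj_closed'[OF W(1) _ w, of "y \<otimes> x"] xy by simp
        have "s \<otimes> w \<otimes> inv s = (x \<otimes> y) \<otimes> ?u \<otimes> inv (x \<otimes> y)" using xy wG by (simp add: word_simps)
        also have "\<dots> = (y \<otimes> x) \<otimes> ?u \<otimes> inv (y \<otimes> x)" by (rule prime_normal_conj_commute[OF W(1,3) u xy(1,2)])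
        also have "\<dots> = w" using xy(1,2) wG by (simp add: word_simps)
        finally have "s \<otimes> w \<otimes> inv s \<otimes> s = w \<otimes> s" by simp
        then show ?thesis using wG s SG by (auto simp: word_simps)
      qed
      then show "w \<in> C \<inter> V" using wG w W(2) by (auto simp: C_def)
    qed
  qed simp
  then have "v \<in> C" using v by blast
  moreover have "x \<otimes> y \<otimes> inv (y \<otimes> x) \<in> S" using xy unfolding S_def by blast
  ultimately show ?thesis by (simp add: C_def)
qed

text \<open>Take the last proper term U of the series. For x outside U the centralizer of x modulo U
  lies between U and the group, which have prime index, and it contains x; so it is the whole
  group.\<close>

lemma abelian_quotient_ex:
  assumes "has_prime_series G" "carrier G \<noteq> {\<one>}"
  obtains U where "U \<lhd> G" "U \<noteq> carrier G" "\<And>x y. x \<in> carrier G \<Longrightarrow> y \<in> carrier G \<Longrightarrow> commute_mod U x y"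
proof -
  obtain d N where N: "N 0 = {\<one>}" "N d = carrier G" "\<And>i. i \<le> d \<Longrightarrow> N i \<lhd> G"
    "\<And>i. i < d \<Longrightarrow> N i \<subseteq> N (Suc i) \<and> (\<exists>p. prime p \<and> card (N (Suc i)) = p * card (N i))"
    using assms(1) unfolding has_prime_series_def prime_series_def by auto
  define i where "i = (LEAST i. i \<le> d \<and> N i = carrier G)"
  have "d \<le> d \<and> N d = carrier G" using N(2) by simp
  then have i: "i \<le> d \<and> N i = carrier G" unfolding i_def by (rule LeastI)
  have "i \<noteq> 0" using i N(1) assms(2) by auto
  then obtain j where j: "i = Suc j" by (cases i) auto
  have jd: "j < d" "j \<le> d" using i j by auto
  have ne: "N j \<noteq> carrier G" using not_less_Least[of j "\<lambda>i. i \<le> d \<and> N i = carrier G"] jd j by (auto simp: i_def)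
  obtain p where p: "prime p" "card (carrier G) = p * card (N j)" using N(4)[OF jd(1)] j i by auto
  have U: "N j \<lhd> G" "subgroup (N j) G" using N(3)[OF jd(2)] normal_imp_subgroup by auto
  have "commute_mod (N j) x y" if xy: "x \<in> carrier G" "y \<in> carrier G" for x y
  proof (cases "x \<in> N j")
    case True then show ?thesis using commute_mod_mem[OF U(1) _ xy(2)] by simp
  next
    case False
    let ?C = "{y \<in> carrier G. commute_mod (N j) x y}"
    have C: "subgroup ?C G" by (rule commute_mod_subgroup[OF U(1) xy(1)])
    have "N j \<subseteq> ?C"
      using commute_mod_sym[OF U(1) _ xy(1) commute_mod_mem[OF U(1) _ xy(1)]] subgroup.mem_carrier[OF U(2)] by blast
    then have "?C = N j \<or> ?C = carrier G"
      by (rule prime_between[OF U(2) C subgroup_self _ _ p(2,1)]) auto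
    moreover have "x \<in> ?C" using commute_mod_self[OF U(1) xy(1)] xy by simp
    ultimately have "?C = carrier G" using False by blast
    then show ?thesis using xy by blast
  qed
  then show thesis using that U ne by blast
qed

text \<open>The derived subgroup of V is normal in the whole group and proper in V, hence trivial.
  Likewise the elements of order dividing p form a nontrivial normal subgroup, hence all of V; by
  Cauchy no other prime divides the order of V.\<close>

lemma minimal_normal_elementary:
  assumes V: "V \<lhd> G" "V \<noteq> {\<one>}" and min: "\<And>W. W \<lhd> G \<Longrightarrow> W \<subseteq> V \<Longrightarrow> W = {\<one>} \<or> W = V"
    and ss: "has_prime_series (G\<lparr>carrier := V\<rparr>)"
  obtains p n where "prime p" "card V = p ^ n" "\<And>x. x \<in> V \<Longrightarrow> x [^] p = \<one>"
    "\<And>x y. x \<in> V \<Longrightarrow> y \<in> V \<Longrightarrow> x \<otimes> y = y \<otimes> x"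
proof -
  have Vs: "subgroup V G" using V normal_imp_subgroup by auto
  have VG: "v \<in> carrier G" if "v \<in> V" for v using subgroup.mem_carrier[OF Vs that] .
  let ?V = "G\<lparr>carrier := V\<rparr>"
  interpret V: finite_group ?V by (rule sub_group[OF Vs])
  obtain U where U: "U \<lhd> ?V" "U \<noteq> V" "\<And>x y. x \<in> V \<Longrightarrow> y \<in> V \<Longrightarrow> V.commute_mod U x y"
    using V.abelian_quotient_ex[OF ss] V(2) by auto
  have Us: "subgroup U G" "U \<subseteq> V" using U(1) normal_sub_iff[OF Vs] by auto
  have "derived_set G V \<subseteq> U"
  proof
    fix z assume "z \<in> derived_set G V"
    then obtain x y where xy: "x \<in> V" "y \<in> V" "z = x \<otimes> y \<otimes> inv x \<otimes> inv y" by auto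
    have "x \<otimes> y \<otimes> inv (y \<otimes> x) \<in> U"
      using U(3)[OF xy(1,2)] m_inv_consistent[OF Vs subgroup.m_closed[OF Vs xy(2,1)]] by (simp add: V.commute_mod_def)
    then show "z \<in> U" using xy VG by (simp add: word_simps)
  qed
  then have "derived G V \<subseteq> U" unfolding derived_def using generate_subgroup_incl[OF _ Us(1)] by simp
  then have "derived G V = {\<one>}"
    using min[OF derived_is_normal[OF V(1)]] Us(2) U(2) by blast
  moreover have "x \<otimes> y \<otimes> inv x \<otimes> inv y \<in> derived G V" if "x \<in> V" "y \<in> V" for x y
    unfolding derived_def using that by (intro generate.incl) auto
  ultimately have comm1: "x \<otimes> y \<otimes> inv x \<otimes> inv y = \<one>" if "x \<in> V" "y \<in> V" for x y using that by blast
  have comm: "x \<otimes> y = y \<otimes> x" if xy: "x \<in> V" "y \<in> V" for x y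
  proof -
    have "x \<otimes> y \<otimes> inv x \<otimes> inv y \<otimes> (y \<otimes> x) = y \<otimes> x" using comm1[OF xy] VG xy by simp
    then show ?thesis using VG xy by (simp add: word_simps)
  qed
  have "card V \<noteq> 1" using V(2) subgroup.one_closed[OF Vs] card_1_singletonE by (metis singletonD)
  then obtain p where p: "prime p" "p dvd card V" using prime_factor_nat by blast
  let ?W = "{x \<in> V. x [^] p = \<one>}"
  have Wsub: "subgroup ?W G"
  proof -
    have "subgroup {x \<in> carrier ?V. x [^]\<^bsub>?V\<^esub> p = \<one>\<^bsub>?V\<^esub>} ?V"
      by (rule V.abelian_p_group_exponent) (use comm in simp)
    then show ?thesis using sub_iff[OF Vs] nat_pow_consistent by simp
  qed
  have Wn: "?W \<lhd> G" unfolding normal_iff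
  proof (intro conjI Wsub ballI)
    fix g x assume g: "g \<in> carrier G" and x: "x \<in> ?W"
    have "(g \<otimes> x \<otimes> inv g) [^] p = g \<otimes> x [^] p \<otimes> inv g" by (rule conj_pow[OF g, symmetric]) (use x VG in simp)
    then show "g \<otimes> x \<otimes> inv g \<in> ?W" using conj_closed[OF V(1) g] x g by simp
  qed
  obtain x where x: "x \<in> V" "x \<noteq> \<one>" "x [^] p = \<one>"
    using V.cauchy[OF p(1)] p(2) nat_pow_consistent by auto
  have "?W \<noteq> {\<one>}" using x by auto
  then have WV: "?W = V" using min[OF Wn] by blast
  then have ex: "x [^] p = \<one>" if "x \<in> V" for x using that by blast
  have "\<exists>n. card V = p ^ n"
  proof -
    obtain P a where P: "subgroup P ?V" "card P = p ^ a" "\<not> p dvd card (rcosets\<^bsub>?V\<^esub> P)"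
      using V.sylow_subgroup_obtain[OF p(1)] by blast
    have lag: "card (rcosets\<^bsub>?V\<^esub> P) * card P = card V" using V.lagrange[OF P(1)] by (simp add: order_def)
    have "card (rcosets\<^bsub>?V\<^esub> P) = 1"
    proof (rule ccontr)
      assume "card (rcosets\<^bsub>?V\<^esub> P) \<noteq> 1"
      then obtain q where q: "prime q" "q dvd card (rcosets\<^bsub>?V\<^esub> P)" using prime_factor_nat by blast
      have "q dvd card V" unfolding lag[symmetric] by (rule dvd_mult2[OF q(2)])
      then have "q dvd card (carrier ?V)" by simp
      then obtain z where z: "z \<in> V" "z \<noteq> \<one>" "z [^] q = \<one>" using V.cauchy[OF q(1)] nat_pow_consistent by auto
      have "card (generate G {z}) = q" "card (generate G {z}) = p"
        using card_generate_prime[OF VG[OF z(1)] z(2)] z(3) ex[OF z(1)] p(1) q(1) by auto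
      then show False using q(2) P(3) by simp
    qed
    then show ?thesis using lag P(2) by (intro exI[of _ a]) simp
  qed
  then show thesis using that p(1) ex comm by blast
qed

text \<open>Power maps compose by multiplying exponents, and in a finite group the inverse of g is a
  power of g.\<close>

lemma power_automorphisms_subgroup:
  assumes V: "V \<lhd> G"
  shows "subgroup {g \<in> carrier G. \<exists>k::nat. \<forall>v\<in>V. g \<otimes> v \<otimes> inv g = v [^] k} G"
proof -
  let ?S = "{g \<in> carrier G. \<exists>k::nat. \<forall>v\<in>V. g \<otimes> v \<otimes> inv g = v [^] k}"
  have Vs: "subgroup V G" using V normal_imp_subgroup by auto
  have VG: "v \<in> carrier G" if "v \<in> V" for v using subgroup.mem_carrier[OF Vs that] .
  have one: "\<one> \<in> ?S" using VG by (auto intro!: exI[of _ 1])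
  have mult: "g \<otimes> h \<in> ?S" if g: "g \<in> ?S" and h: "h \<in> ?S" for g h
  proof -
    obtain a :: nat where a: "\<forall>v\<in>V. g \<otimes> v \<otimes> inv g = v [^] a" using g by blast
    obtain b :: nat where b: "\<forall>v\<in>V. h \<otimes> v \<otimes> inv h = v [^] b" using h by blast
    have gh: "g \<in> carrier G" "h \<in> carrier G" using g h by auto
    have "g \<otimes> h \<otimes> v \<otimes> inv (g \<otimes> h) = v [^] (a * b)" if v: "v \<in> V" for v
    proof -
      have "g \<otimes> h \<otimes> v \<otimes> inv (g \<otimes> h) = g \<otimes> (h \<otimes> v \<otimes> inv h) \<otimes> inv g" using gh VG[OF v] by (simp add: word_simps)
      also have "h \<otimes> v \<otimes> inv h = v [^] b" using b v by simp
      also have "g \<otimes> v [^] b \<otimes> inv g = (g \<otimes> v \<otimes> inv g) [^] b" by (rule conj_pow[OF gh(1) VG[OF v]])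
      also have "g \<otimes> v \<otimes> inv g = v [^] a" using a v by simp
      finally show ?thesis using VG[OF v] by (simp add: nat_pow_pow)
    qed
    then show ?thesis using gh by auto
  qed
  have pow: "g [^] (n::nat) \<in> ?S" if "g \<in> ?S" for g n
    using that one mult by (induction n) auto
  show ?thesis
  proof (rule subgroupI)
    show "?S \<noteq> {}" using one by blast
    fix g assume g: "g \<in> ?S"
    then have gG: "g \<in> carrier G" by simp
    obtain n where n: "order G = Suc n" using order_gt_0_iff_finite fin by (cases "order G") auto
    have "g [^] n \<otimes> g = \<one>" using pow_order_eq_1[OF gG] n by simp
    then have "inv g = g [^] n" using inv_equality[of "g [^] n" g] gG by simp
    then show "inv g \<in> ?S" using pow[OF g] by simp
    fix h assume "h \<in> ?S" then show "g \<otimes> h \<in> ?S" using mult[OF g] by simp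
  qed blast
qed

text \<open>Omega of the order of the stabilizer increases strictly along the chain and takes values
  from 0 to its value at the top.\<close>

lemma facet_card_le_bigomega:
  assumes F: "F \<in> coset_facets" and A: "A \<in> F" "\<And>B. B \<in> F \<Longrightarrow> B \<subseteq> A"
  shows "card F \<le> Suc (bigomega (card (stab A)))"
proof -
  have c: "is_coset B" if "B \<in> F" for B using facet_chain(1)[OF F that] .
  let ?f = "\<lambda>B. bigomega (card (stab B))"
  have less: "?f B < ?f B'" if B: "B \<in> F" "B' \<in> F" "B \<subset> B'" for B B'
  proof -
    note s = stab_subgroup[OF c[OF B(1)]] stab_subgroup[OF c[OF B(2)]]
    have sub: "stab B \<subseteq> stab B'" using stab_mono B(3) by auto
    have "stab B \<noteq> stab B'" using coset_eqI[OF c[OF B(1)] c[OF B(2)]] B(3) by auto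
    then have "card (stab B) < card (stab B')" using sub sub_finite[OF s(2)] by (intro psubset_card_mono) auto
    then show ?thesis using bigomega_dvd_less[OF card_dvd[OF s(2,1) sub]] by simp
  qed
  have "inj_on ?f F"
  proof (rule inj_onI, rule ccontr)
    fix B B' assume B: "B \<in> F" "B' \<in> F" "?f B = ?f B'" "B \<noteq> B'"
    then have "B \<subset> B' \<or> B' \<subset> B" using facet_chain(3)[OF F B(1,2)] by auto
    then show False using less[OF B(1,2)] less[OF B(2,1)] B(3) by auto
  qed
  moreover have "?f ` F \<subseteq> {..?f A}"
  proof
    fix n assume "n \<in> ?f ` F"
    then obtain B where B: "B \<in> F" "n = ?f B" by auto
    show "n \<in> {..?f A}"
      using A(2)[OF B(1)] less[OF B(1) A(1)] B(2) by (cases "B = A") (simp_all add: psubset_eq)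
  qed
  ultimately show ?thesis using card_inj_on_le[of ?f F "{..?f A}"] by simp
qed

text \<open>The existence of a proper normal subgroup ensures that V, of least order among the
  nontrivial normal subgroups, is proper. So V has a prime series by hypothesis, which makes it
  elementary abelian, and a complement K exists.\<close>

lemma elementary_supersolvable_non_p_group:
  assumes sh: "shellable_poset (coset_poset G)" and np: "\<And>p k. prime p \<Longrightarrow> card (carrier G) \<noteq> p ^ k"
    and proper: "\<And>H. subgroup H G \<Longrightarrow> H \<noteq> carrier G \<Longrightarrow> elementary_supersolvable (G\<lparr>carrier := H\<rparr>)"
  shows "elementary_supersolvable G"
proof -
  have el: "elementary_p_subgroups G"
    using elementary_p_subgroups_if_proper[OF _ np] proper by (simp add: elementary_supersolvable_def)
  obtain N where N: "N \<lhd> G" "N \<noteq> {\<one>}" "N \<noteq> carrier G"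
    using nonsimple_if_proper_elementary_supersolvable[OF proper np] by blast
  let ?Q = "\<lambda>V. V \<lhd> G \<and> V \<noteq> {\<one>}"
  obtain V where V: "?Q V" "\<And>W. ?Q W \<Longrightarrow> card V \<le> card W"
    using ex_has_least_nat[of ?Q N card] N by blast
  have Vn: "V \<lhd> G" and V1: "V \<noteq> {\<one>}" using V(1) by auto
  have Vs: "subgroup V G" using Vn normal_imp_subgroup by auto
  have VG: "v \<in> carrier G" if "v \<in> V" for v using subgroup.mem_carrier[OF Vs that] .
  have "card V < card (carrier G)"
    using V(2)[of N] N sub_card_less[OF normal_imp_subgroup[OF N(1)] N(3)] by simp
  then have Vne: "V \<noteq> carrier G" by auto
  have min: "W = {\<one>} \<or> W = V" if W: "W \<lhd> G" "W \<subseteq> V" for W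
    using V(2)[of W] W sub_eqI[OF Vs normal_imp_subgroup[OF W(1)] W(2)] by blast
  have "has_prime_series (G\<lparr>carrier := V\<rparr>)" using proper[OF Vs Vne] by (simp add: elementary_supersolvable_def)
  then obtain r n where r: "prime r" "card V = r ^ n" and exV: "\<And>x. x \<in> V \<Longrightarrow> x [^] r = \<one>"
    and commV: "\<And>x y. x \<in> V \<Longrightarrow> y \<in> V \<Longrightarrow> x \<otimes> y = y \<otimes> x"
    using minimal_normal_elementary[OF Vn V1 min] by blast
  obtain K where K: "subgroup K G" "V \<inter> K = {\<one>}" "V <#> K = carrier G"
    using normal_p_subgroup_complement[OF el Vn r(2,1)] by blast
  have cG: "card (carrier G) = card V * card K" using card_set_mult_disjoint[OF Vs K(1,2)] K(3) by simp
  have "K \<noteq> carrier G" using K(2) V1 subgroup.subset[OF Vs] by auto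
  then have XK: "elementary_supersolvable (G\<lparr>carrier := K\<rparr>)" using proper[OF K(1)] by simp
  show ?thesis
  proof (cases "prime (card V)")
    case True
    then have "has_prime_series G" using has_prime_series_extend[OF Vn _ K] XK by (simp add: elementary_supersolvable_def)
    then show ?thesis using el by (simp add: elementary_supersolvable_def)
  next
    case nprime: False
    have "n \<noteq> 0"
    proof
      assume "n = 0"
      then obtain z where "V = {z}" using r(2) card_1_singletonE by auto
      then show False using V1 subgroup.one_closed[OF Vs] by auto
    qed
    moreover have "n \<noteq> 1" using nprime r by auto
    ultimately have n2: "2 \<le> n" by simp
    have Kpos: "0 < card K" "0 < card V" using sub_card_pos[OF K(1)] sub_card_pos[OF Vs] by auto
    have "card (carrier G) \<noteq> card V" using np[OF r(1), of n] r(2) by simp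
    then have "card K \<noteq> 1" using cG by auto
    then have omK: "1 \<le> bigomega (card K)" using bigomega_pos[of "card K"] Kpos by simp
  \<comment> \<open>too long for the facets through a complement of \<open>V\<close>, but attained through every maximal subgroup above \<open>V\<close>\<close>
    define s where "s = bigomega (card K) + 2"
    have s: "3 \<le> s" "2 \<le> s" using omK by (auto simp: s_def)
    define C where "C = {g \<in> carrier G. \<forall>x\<in>V. g \<otimes> x = x \<otimes> g}"
    have Cs: "subgroup C G" unfolding C_def by (rule centralizer_subgroup[OF subgroup.subset[OF Vs]])
    have Cn: "C \<lhd> G" unfolding normal_iff
    proof (intro conjI Cs ballI)
      fix g c assume g: "g \<in> carrier G" and c: "c \<in> C"
      have cG: "c \<in> carrier G" using c by (simp add: C_def)
      have "g \<otimes> c \<otimes> inv g \<otimes> x = x \<otimes> (g \<otimes> c \<otimes> inv g)" if x: "x \<in> V" for x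
      proof -
        let ?x = "inv g \<otimes> x \<otimes> g"
        have "?x \<in> V" using conj_closed'[OF Vn g x] .
        then have cx: "c \<otimes> ?x = ?x \<otimes> c" using c by (simp add: C_def)
        have "g \<otimes> c \<otimes> inv g \<otimes> x = g \<otimes> (c \<otimes> ?x) \<otimes> inv g" using g cG VG[OF x] by (simp add: word_simps)
        also have "\<dots> = x \<otimes> (g \<otimes> c \<otimes> inv g)" unfolding cx using g cG VG[OF x] by (simp add: word_simps)
        finally show ?thesis .
      qed
      then show "g \<otimes> c \<otimes> inv g \<in> C" using g cG by (simp add: C_def)
    qed
    have VC: "V \<subseteq> C" using commV VG by (auto simp: C_def)
    \<comment> \<open>Let H be the stabilizer of the top of the facet. If V H were the whole group,
      V \<inter> H would be normal because V is abelian, hence trivial, and H would have the order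
      of K. The facet would then have at most Omega(|K|) + 1 members, one less than s.\<close>
    have long: "V <#> stab B \<noteq> carrier G" if F: "F \<in> coset_facets" "s \<le> card F" "B \<in> F" for F B
    proof
      assume VB: "V <#> stab B = carrier G"
      obtain A where A: "A \<in> F" "\<And>B. B \<in> F \<Longrightarrow> B \<subseteq> A" using facet_top[OF F(1)] F(3) by blast
      have Ac: "is_coset A" "A \<noteq> carrier G" using facet_chain(1,2)[OF F(1) A(1)] by auto
      let ?H = "stab A"
      have H: "subgroup ?H G" "?H \<noteq> carrier G" using stab_subgroup stab_proper Ac by auto
      have "V <#> stab B \<subseteq> V <#> ?H" using stab_mono[OF A(2)[OF F(3)]] by (intro mono_set_mult) auto
      then have VH: "V <#> ?H = carrier G"
        using VB set_mult_closed[OF subgroup.subset[OF Vs] subgroup.subset[OF H(1)]] by auto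
      have "V \<inter> ?H \<lhd> G" unfolding normal_iff
      proof (intro conjI ballI)
        show "subgroup (V \<inter> ?H) G" using subgroups_Inter_pair[OF Vs H(1)] .
        fix g x assume g: "g \<in> carrier G" and x: "x \<in> V \<inter> ?H"
        obtain v h where vh: "v \<in> V" "h \<in> ?H" "g = v \<otimes> h" using g VH set_mult_iff by blast
        have G: "v \<in> carrier G" "h \<in> carrier G" "x \<in> carrier G" using VG vh x subgroup.mem_carrier[OF H(1)] by auto
        let ?y = "h \<otimes> x \<otimes> inv h"
        have y: "?y \<in> V" "?y \<in> ?H"
          using conj_closed[OF Vn G(2)] x subgroup.m_closed[OF H(1)] subgroup.m_inv_closed[OF H(1)] vh by auto
        have "g \<otimes> x \<otimes> inv g = (v \<otimes> ?y) \<otimes> inv v" using G vh(3) by (simp add: word_simps)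
        also have "v \<otimes> ?y = ?y \<otimes> v" by (rule commV[OF vh(1) y(1)])
        also have "?y \<otimes> v \<otimes> inv v = ?y" using G by (simp add: word_simps)
        finally show "g \<otimes> x \<otimes> inv g \<in> V \<inter> ?H" using y by simp
      qed
      then have "V \<inter> ?H = {\<one>} \<or> V \<inter> ?H = V" using min by blast
      moreover have "V \<inter> ?H \<noteq> V"
      proof
        assume "V \<inter> ?H = V"
        then have "V <#> ?H \<subseteq> ?H" by (intro set_mult_least[OF H(1)]) auto
        then show False using VH H subgroup.subset[OF H(1)] by auto
      qed
      ultimately have "card (carrier G) = card V * card ?H" using card_set_mult_disjoint[OF Vs H(1)] VH by simp
      then have "card ?H = card K" using cG Kpos by simp
      then have "card F \<le> Suc (bigomega (card K))" using facet_card_le_bigomega[OF F(1) A] by simp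
      then show False using F(2) by (simp add: s_def)
    qed
    \<comment> \<open>The complemented group B acts on V through an abelian group, so its
      commutators centralize V.\<close>
    have prp: "commute_mod C x y" if B: "subgroup B G" "B \<noteq> carrier G" "V \<subseteq> B" "x \<in> B" "y \<in> B" for B x y
    proof -
      let ?B = "G\<lparr>carrier := B\<rparr>"
      interpret B: finite_group ?B by (rule sub_group[OF B(1)])
      have nB: "V \<lhd> ?B" unfolding normal_sub_iff[OF B(1)]
        using Vs B(3) conj_closed[OF Vn] subgroup.mem_carrier[OF B(1)] by auto
      have xyG: "x \<in> carrier G" "y \<in> carrier G" using subgroup.mem_carrier[OF B(1)] B by auto
      have iv: "inv\<^bsub>?B\<^esub> (y \<otimes> x) = inv (y \<otimes> x)"
        using m_inv_consistent[OF B(1) subgroup.m_closed[OF B(1) B(5,4)]] .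
      have "(x \<otimes> y \<otimes> inv (y \<otimes> x)) \<otimes> v = v \<otimes> (x \<otimes> y \<otimes> inv (y \<otimes> x))" if v: "v \<in> V" for v
        using B.commutators_centralize[OF proper[OF B(1,2)] nB r(2,1), of x y v] B(4,5) v iv by simp
      then show ?thesis using xyG unfolding commute_mod_def C_def by simp
    qed
    \<comment> \<open>A maximal subgroup B above V is V L with L of prime index in K. So Omega(|B|)
      = n + Omega(|K|) - 1, and by n \<ge> 2 a prime series of B gives a chain of at least s
      members.\<close>
    have chains: "\<exists>\<C> H. subgroup_chain \<C> \<and> s \<le> card \<C> \<and> H \<in> \<C> \<and> Y \<subseteq> H"
      if Y: "subgroup Y G" "V \<subseteq> Y" "Y \<noteq> carrier G" for Y
    proof -
      obtain B where B: "maximal_subgroup B" "Y \<subseteq> B" using maximal_subgroup_ex[OF Y(1,3)] by blast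
      have Bs: "subgroup B G" "B \<noteq> carrier G" using B by (auto simp: maximal_subgroup_def)
      have sub: "V \<subseteq> B" using Y(2) B(2) by auto
      let ?K = "G\<lparr>carrier := K\<rparr>"
      interpret K: finite_group ?K by (rule sub_group[OF K(1)])
      have BK: "subgroup (B \<inter> K) G" using subgroups_Inter_pair[OF Bs(1) K(1)] .
      have dec: "\<exists>v\<in>V. \<exists>k\<in>B \<inter> K. b = v \<otimes> k" if b: "b \<in> B" for b
      proof -
        obtain v k where vk: "v \<in> V" "k \<in> K" "b = v \<otimes> k"
          using subgroup.mem_carrier[OF Bs(1) b] K(3) set_mult_iff by blast
        have "k = inv v \<otimes> b" using vk VG subgroup.mem_carrier[OF K(1)] by (simp add: word_simps)
        then have "k \<in> B" using subgroup.m_closed[OF Bs(1) subgroup.m_inv_closed[OF Bs(1)] b] vk(1) sub by auto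
        then show ?thesis using vk by blast
      qed
      have "B \<inter> K \<noteq> K"
      proof
        assume "B \<inter> K = K"
        then have "V <#> K \<subseteq> B" using sub by (intro set_mult_least[OF Bs(1)]) auto
        then show False using K(3) Bs subgroup.subset[OF Bs(1)] by auto
      qed
      then obtain L q where L: "subgroup L ?K" "B \<inter> K \<subseteq> L" "prime q" "card K = q * card L"
        using K.prime_index_supergroup_ex[of "B \<inter> K"] XK sub_iff[OF K(1)] BK by (auto simp: elementary_supersolvable_def)
      have L': "subgroup L G" "L \<subseteq> K" using L(1) sub_iff[OF K(1)] by auto
      have VL: "subgroup (V <#> L) G" by (rule normal_mult_subgroup[OF Vn L'(1)])
      have cVL: "card (V <#> L) = card V * card L"
        using card_set_mult_disjoint[OF Vs L'(1)] L'(2) K(2) subgroup.one_closed[OF Vs] subgroup.one_closed[OF L'(1)] by blast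
      have Lpos: "0 < card L" using sub_card_pos[OF L'(1)] .
      have "V <#> L \<noteq> carrier G"
      proof
        assume "V <#> L = carrier G"
        then have "card K = card L" using cVL cG Kpos by simp
        then show False using L(4) Lpos prime_gt_1_nat[OF L(3)] by simp
      qed
      moreover have "B \<subseteq> V <#> L"
      proof
        fix b assume "b \<in> B"
        then obtain v k where "v \<in> V" "k \<in> B \<inter> K" "b = v \<otimes> k" using dec by blast
        then show "b \<in> V <#> L" using L(2) mult_mem by blast
      qed
      ultimately have "V <#> L = B" using B(1) VL unfolding maximal_subgroup_def by blast
      then have "bigomega (card B) = n + bigomega (card L)"
        using cVL bigomega_mult[OF Kpos(2) Lpos] bigomega_prime_power[OF r(1)] r(2) by simp
      moreover have "bigomega (card K) = 1 + bigomega (card L)"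
        using L(4) bigomega_mult[OF prime_gt_0_nat[OF L(3)] Lpos] bigomega_prime[OF L(3)] by simp
      ultimately have "s \<le> Suc (bigomega (card B))" using n2 by (simp add: s_def)
      moreover obtain \<C> where "subgroup_chain \<C>" "card \<C> = Suc (bigomega (card B))" "B \<in> \<C>"
        using series_chain[OF Bs] proper[OF Bs] by (auto simp: elementary_supersolvable_def)
      ultimately show ?thesis using B(2) by metis
    qed
    \<comment> \<open>If V <g> is the whole group for some g, the factor group by C is cyclic.
      Otherwise each g lies in the proper subgroup V <g>, hence in a member of a long chain, as the
      cocycle statement requires.\<close>
    have all: "commute_mod C x y" if xy: "x \<in> carrier G" "y \<in> carrier G" for x y
    proof (cases "\<exists>g\<in>carrier G. V <#> generate G {g} = carrier G")
      case True
      then obtain g where g: "g \<in> carrier G" "V <#> generate G {g} = carrier G" by blast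
      let ?cent = "\<lambda>x. {y \<in> carrier G. commute_mod C x y}"
      have cs: "subgroup (?cent x) G" if "x \<in> carrier G" for x using commute_mod_subgroup[OF Cn that] .
      have Vc: "V \<subseteq> ?cent x" if "x \<in> carrier G" for x
        using commute_mod_sym[OF Cn _ that commute_mod_mem[OF Cn _ that]] VC VG by blast
      have gen: "?cent x = carrier G" if x: "x \<in> carrier G" "commute_mod C x g" for x
      proof -
        have "V <#> generate G {g} \<subseteq> ?cent x"
          using Vc[OF x(1)] sub_generate[OF cs[OF x(1)], of g] x g by (intro set_mult_least[OF cs[OF x(1)]]) auto
        then show ?thesis using g(2) by blast
      qed
      have "x \<in> ?cent g" using gen[OF g(1) commute_mod_self[OF Cn g(1)]] xy by blast
      then have "?cent x = carrier G" using gen[OF xy(1)] commute_mod_sym[OF Cn g(1) xy(1)] by simp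
      then show ?thesis using xy(2) by blast
    next
      case noncyc: False
      show ?thesis
      proof (rule commute_mod_if_proper[OF sh s(1) Vn Cn VC long _ prp xy])
        fix g assume g: "g \<in> carrier G"
        let ?X = "generate G {g}"
        have X: "subgroup ?X G" "g \<in> ?X" using generate_singleton_subgroup[OF g] generate.incl[of g "{g}" G] by auto
        have VX: "subgroup (V <#> ?X) G" "V <#> ?X \<noteq> carrier G" using normal_mult_subgroup[OF Vn X(1)] noncyc g by auto
        have "V \<subseteq> V <#> ?X" "g \<in> V <#> ?X"
          using sub_set_mult1[OF X(1) subgroup.subset[OF Vs]] sub_set_mult2[OF Vs subgroup.subset[OF X(1)]] X(2) by auto
        then show "\<exists>\<C> H. subgroup_chain \<C> \<and> s \<le> card \<C> \<and> H \<in> \<C> \<and> g \<in> H"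
          using chains[OF VX(1) _ VX(2)] by blast
      qed
    qed
    let ?S = "{g \<in> carrier G. \<exists>k::nat. \<forall>v\<in>V. g \<otimes> v \<otimes> inv g = v [^] k}"
    have S: "subgroup ?S G" by (rule power_automorphisms_subgroup[OF Vn])
    \<comment> \<open>Inside B the element x acts on a normal subgroup of prime order with some
      exponent k. The set of all v \<in> V on which x acts with this exponent is a kind of
      eigenspace. It is normal in the whole group because the action on V is abelian, so it is V by
      minimality.\<close>
    have inS: "x \<in> ?S" if B: "subgroup B G" "B \<noteq> carrier G" "V \<subseteq> B" "x \<in> B" for B x
    proof -
      let ?B = "G\<lparr>carrier := B\<rparr>"
      interpret B: finite_group ?B by (rule sub_group[OF B(1)])
      have xG: "x \<in> carrier G" using subgroup.mem_carrier[OF B(1,4)] .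
      have nB: "V \<lhd> ?B" unfolding normal_sub_iff[OF B(1)]
        using Vs B(3) conj_closed[OF Vn] subgroup.mem_carrier[OF B(1)] by auto
      have ssB: "has_prime_series ?B" using proper[OF B(1,2)] by (simp add: elementary_supersolvable_def)
      obtain W where W: "W \<lhd> ?B" "W \<subseteq> V" "prime (card W)"
        using B.prime_order_normal_ex[OF ssB nB] V1 by auto
      have "W \<noteq> {\<one>}" using W(3) by auto
      moreover have "\<one> \<in> W" using W(1) normal_sub_iff[OF B(1)] subgroup.one_closed by blast
      ultimately obtain w where w: "w \<in> W" "w \<noteq> \<one>" by blast
      obtain k :: nat where "x \<otimes>\<^bsub>?B\<^esub> w \<otimes>\<^bsub>?B\<^esub> inv\<^bsub>?B\<^esub> x = w [^]\<^bsub>?B\<^esub> k"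
        using B.prime_normal_conj[OF W(1,3) w(1), of x] w(2) B(4) by auto
      then have k: "x \<otimes> w \<otimes> inv x = w [^] k"
        using m_inv_consistent[OF B(1,4)] nat_pow_consistent[of w k B] by simp
      let ?E = "{v \<in> V. x \<otimes> v \<otimes> inv x = v [^] k}"
      interpret cV: comm_group "G\<lparr>carrier := V\<rparr>" by (rule sub_comm_group[OF Vs commV])
      have powV: "(u \<otimes> v) [^] k = u [^] k \<otimes> v [^] k" if "u \<in> V" "v \<in> V" for u v
        using cV.pow_mult_distrib[of u v k] cV.m_comm that nat_pow_consistent[of _ k V] by simp
      have E: "subgroup ?E G"
      proof (rule subgroupI)
        show "?E \<noteq> {}" using w k W(2) by auto
        show "?E \<subseteq> carrier G" using VG by auto
        fix u assume u: "u \<in> ?E"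
        then have u': "u \<in> V" "x \<otimes> u \<otimes> inv x = u [^] k" by auto
        have "x \<otimes> inv u \<otimes> inv x = inv (x \<otimes> u \<otimes> inv x)" using xG VG[OF u'(1)] by (simp add: word_simps)
        also have "\<dots> = (inv u) [^] k" unfolding u'(2) using nat_pow_inv[OF VG[OF u'(1)]] by simp
        finally show "inv u \<in> ?E" using subgroup.m_inv_closed[OF Vs u'(1)] by simp
        fix v assume "v \<in> ?E"
        then have v': "v \<in> V" "x \<otimes> v \<otimes> inv x = v [^] k" by auto
        have "x \<otimes> (u \<otimes> v) \<otimes> inv x = (x \<otimes> u \<otimes> inv x) \<otimes> (x \<otimes> v \<otimes> inv x)"
          using xG VG[OF u'(1)] VG[OF v'(1)] by (simp add: word_simps)
        then show "u \<otimes> v \<in> ?E" using u' v' powV subgroup.m_closed[OF Vs] by simp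
      qed
      have En: "?E \<lhd> G" unfolding normal_iff
      proof (intro conjI E ballI)
        fix g v assume g: "g \<in> carrier G" and v: "v \<in> ?E"
        then have v': "v \<in> V" "x \<otimes> v \<otimes> inv x = v [^] k" by auto
        \<comment> \<open>With this commutator x g = g x c holds, and c centralizes V.\<close>
        let ?c = "inv x \<otimes> inv g \<otimes> x \<otimes> g"
        have "commute_mod C (inv x) (inv g)" using all xG g by simp
        then have cC: "?c \<in> C" using xG g by (simp add: commute_mod_def word_simps)
        then have cG: "?c \<in> carrier G" and cv: "?c \<otimes> v = v \<otimes> ?c" using v' by (auto simp: C_def)
        have "x \<otimes> (g \<otimes> v \<otimes> inv g) \<otimes> inv x = g \<otimes> x \<otimes> (?c \<otimes> v) \<otimes> inv ?c \<otimes> inv x \<otimes> inv g"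
          using xG g VG[OF v'(1)] by (simp add: word_simps)
        also have "\<dots> = g \<otimes> (x \<otimes> v \<otimes> inv x) \<otimes> inv g" unfolding cv using xG g VG[OF v'(1)] by (simp add: word_simps)
        also have "\<dots> = (g \<otimes> v \<otimes> inv g) [^] k" unfolding v'(2) by (rule conj_pow[OF g VG[OF v'(1)]])
        finally show "g \<otimes> v \<otimes> inv g \<in> ?E" using conj_closed[OF Vn g v'(1)] by simp
      qed
      have "?E \<noteq> {\<one>}" using w k W(2) by auto
      then have "?E = V" using min[OF En] by blast
      then show ?thesis using xG by blast
    qed
    obtain \<C> where C: "subgroup_chain \<C>" "s \<le> card \<C>" using chains[OF Vs subset_refl Vne] by blast
    \<comment> \<open>Every stabilizer in a long facet lies in the proper subgroup V stab A, to
      which the eigenspace argument applies.\<close>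
    have "?S = carrier G"
    proof (rule generated_by_long_chains[OF sh s(2) S _ C])
      fix F A assume F: "F \<in> coset_facets" "s \<le> card F" "A \<in> F"
      have As: "subgroup (stab A) G" using stab_subgroup[OF facet_chain(1)[OF F(1,3)]] .
      have "V \<subseteq> V <#> stab A" "stab A \<subseteq> V <#> stab A"
        using sub_set_mult1[OF As subgroup.subset[OF Vs]] sub_set_mult2[OF Vs subgroup.subset[OF As]] by auto
      then show "stab A \<subseteq> ?S" using inS[OF normal_mult_subgroup[OF Vn As] long[OF F]] by blast
    qed
    then have Sall: "g \<in> ?S" if "g \<in> carrier G" for g using that by blast
    obtain x where x: "x \<in> V" "x \<noteq> \<one>" using V1 subgroup.one_closed[OF Vs] by blast
    have xG: "x \<in> carrier G" using VG[OF x(1)] .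
    let ?X = "generate G {x}"
    have X: "subgroup ?X G" "x \<in> ?X" using generate_singleton_subgroup[OF xG] generate.incl[of x "{x}" G] by auto
    \<comment> \<open>Power maps preserve every subgroup of V.\<close>
    have "?X \<lhd> G" unfolding normal_iff
    proof (intro conjI X(1) ballI)
      fix g h assume g: "g \<in> carrier G" and h: "h \<in> ?X"
      have "h \<in> V" using sub_generate[OF Vs x(1)] h by auto
      then obtain k :: nat where "g \<otimes> h \<otimes> inv g = h [^] k" using Sall[OF g] by blast
      then show "g \<otimes> h \<otimes> inv g \<in> ?X" using sub_pow_closed[OF X(1) h] by simp
    qed
    then have "?X = V" using min[OF _ sub_generate[OF Vs x(1)]] X(2) x(2) by blast
    then have "card V = r" using card_generate_prime[OF xG x(2) exV[OF x(1)] r(1)] by simp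
    then show ?thesis using nprime r(1) by simp
  qed
qed

end

theorem elementary_supersolvable_if_shellable:
  assumes "finite_group G" "shellable_poset (coset_poset G)" shows "elementary_supersolvable G"
  using assms
proof (induction "card (carrier G)" arbitrary: G rule: less_induct)
  case less
  interpret finite_group G by (rule less.prems(1))
  have proper: "elementary_supersolvable (G\<lparr>carrier := H\<rparr>)" if H: "subgroup H G" "H \<noteq> carrier G" for H
  proof -
    obtain M where M: "maximal_subgroup M" "H \<subseteq> M" using maximal_subgroup_ex[OF H] by blast
    have Ms: "subgroup M G" "M \<noteq> carrier G" using M(1) by (auto simp: maximal_subgroup_def)
    interpret M: finite_group "G\<lparr>carrier := M\<rparr>" by (rule sub_group[OF Ms(1)])
    have "elementary_supersolvable (G\<lparr>carrier := M\<rparr>)"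
      using less.hyps[OF _ M.finite_group_axioms link_shellable[OF less.prems(2) M(1)]] sub_card_less[OF Ms] by simp
    then show ?thesis using M.elementary_supersolvable_sub[of H] sub_iff[OF Ms(1)] H(1) M(2) by simp
  qed
  show ?case
  proof (cases "\<exists>p k. prime p \<and> card (carrier G) = p ^ k")
    case True
    then show ?thesis using elementary_supersolvable_p_group[OF less.prems(2) _ _ proper] by blast
  next
    case False
    then show ?thesis using elementary_supersolvable_non_p_group[OF less.prems(2) _ proper] by blast
  qed
qed

section \<open>Translation to chief series and Sylow subgroups\<close>

context finite_group begin

lemma card_quotient:
  assumes "subgroup B G" "subgroup A G" "A \<subseteq> B"
  shows "order ((G\<lparr>carrier := B\<rparr>) Mod A) * card A = card B"
proof -
  interpret B: finite_group "G\<lparr>carrier := B\<rparr>" by (rule sub_group[OF assms(1)])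
  have "subgroup A (G\<lparr>carrier := B\<rparr>)" using sub_iff[OF assms(1)] assms by simp
  then show ?thesis using B.lagrange[of A] by (simp add: order_def FactGroup_def)
qed

text \<open>A factor of prime order leaves no room for a further normal subgroup, so a series with
  prime factors is already a chief series.\<close>

lemma supersolvable_iff: "supersolvable G \<longleftrightarrow> has_prime_series G"
proof
  assume "supersolvable G"
  then obtain Ns where cs: "chief_series G Ns"
    and pr: "\<forall>i. Suc i < length Ns \<longrightarrow> prime (order ((G\<lparr>carrier := Ns ! Suc i\<rparr>) Mod (Ns ! i)))"
    unfolding supersolvable_def by (elim exE conjE)
  have Ns: "Ns \<noteq> []" "hd Ns = {\<one>}" "last Ns = carrier G" "\<And>N. N \<in> set Ns \<Longrightarrow> N \<lhd> G"
    "\<And>i. Suc i < length Ns \<Longrightarrow> Ns ! i \<subset> Ns ! Suc i"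
    "\<And>i. Suc i < length Ns \<Longrightarrow> prime (order ((G\<lparr>carrier := Ns ! Suc i\<rparr>) Mod (Ns ! i)))"
    using cs pr unfolding chief_series_def by simp_all
  let ?d = "length Ns - 1"
  have "prime_series G ?d (\<lambda>i. Ns ! i)" unfolding prime_series_def
  proof (intro conjI allI impI)
    show "Ns ! 0 = {\<one>}" "Ns ! ?d = carrier G" using Ns(1-3) by (simp_all add: hd_conv_nth last_conv_nth)
    fix i assume i: "i < ?d"
    then have i': "Suc i < length Ns" by simp
    then have n: "Ns ! i \<lhd> G" "Ns ! Suc i \<lhd> G" using Ns(4) by (simp_all add: nth_mem)
    show "Ns ! i \<subseteq> Ns ! Suc i" using Ns(5)[OF i'] by auto
    show "\<exists>p. prime p \<and> card (Ns ! Suc i) = p * card (Ns ! i)"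
      using Ns(6)[OF i'] card_quotient[OF normal_imp_subgroup[OF n(2)] normal_imp_subgroup[OF n(1)]] Ns(5)[OF i']
      by (metis psubset_imp_subset)
  next
    fix i assume "i \<le> ?d"
    then show "Ns ! i \<lhd> G" using Ns(1,4) by (metis Suc_pred' le_imp_less_Suc length_greater_0_conv nth_mem)
  qed
  then show "has_prime_series G" by (auto simp: has_prime_series_def)
next
  assume "has_prime_series G"
  then obtain d N where N: "N 0 = {\<one>}" "N d = carrier G" "\<And>i. i \<le> d \<Longrightarrow> N i \<lhd> G"
    "\<And>i. i < d \<Longrightarrow> N i \<subseteq> N (Suc i) \<and> (\<exists>p. prime p \<and> card (N (Suc i)) = p * card (N i))"
    unfolding has_prime_series_def prime_series_def by auto
  let ?Ns = "map N [0..<Suc d]"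
  have nth: "?Ns ! i = N i" if "i \<le> d" for i using that by (simp del: upt_Suc)
  have Ns: "subgroup (N i) G" if "i \<le> d" for i using N(3)[OF that] normal_imp_subgroup by auto
  have step: "\<exists>p. N i \<subseteq> N (Suc i) \<and> prime p \<and> card (N (Suc i)) = p * card (N i) \<and> i \<le> d \<and> Suc i \<le> d"
    if "Suc i < length ?Ns" for i using that N(4)[of i] by auto
  have "chief_series G ?Ns" unfolding chief_series_def
  proof (intro conjI allI impI ballI)
    show "?Ns \<noteq> []" by simp
    show "hd ?Ns = {\<one>}" using N(1) by (simp add: hd_map del: upt_Suc)
    show "last ?Ns = carrier G" using N(2) by simp
    show "A \<lhd> G" if "A \<in> set ?Ns" for A using that N(3) by (auto simp del: upt_Suc)
  next
    fix i assume i: "Suc i < length ?Ns"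
    obtain p where p: "N i \<subseteq> N (Suc i)" "prime p" "card (N (Suc i)) = p * card (N i)" "i \<le> d" "Suc i \<le> d"
      using step[OF i] by blast
    have "N i \<noteq> N (Suc i)" using p(3) prime_gt_1_nat[OF p(2)] sub_card_pos[OF Ns[OF p(4)]] by auto
    then show "?Ns ! i \<subset> ?Ns ! Suc i" unfolding nth[OF p(4)] nth[OF p(5)] using p(1) by auto
    show "\<not> (\<exists>M. M \<lhd> G \<and> ?Ns ! i \<subset> M \<and> M \<subset> ?Ns ! Suc i)" unfolding nth[OF p(4)] nth[OF p(5)]
    proof
      assume "\<exists>M. M \<lhd> G \<and> N i \<subset> M \<and> M \<subset> N (Suc i)"
      then obtain M where M: "M \<lhd> G" "N i \<subset> M" "M \<subset> N (Suc i)" by auto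
      have "M = N i \<or> M = N (Suc i)"
        by (rule prime_between[OF Ns[OF p(4)] normal_imp_subgroup[OF M(1)] Ns[OF p(5)] _ _ p(3,2)]) (use M in auto)
      then show False using M by auto
    qed
  qed
  moreover have "prime (order ((G\<lparr>carrier := ?Ns ! Suc i\<rparr>) Mod (?Ns ! i)))" if i: "Suc i < length ?Ns" for i
  proof -
    obtain p where p: "N i \<subseteq> N (Suc i)" "prime p" "card (N (Suc i)) = p * card (N i)" "i \<le> d" "Suc i \<le> d"
      using step[OF i] by blast
    have "order ((G\<lparr>carrier := N (Suc i)\<rparr>) Mod (N i)) = p"
      using card_quotient[OF Ns[OF p(5)] Ns[OF p(4)] p(1)] p(3) sub_card_pos[OF Ns[OF p(4)]] by simp
    then show ?thesis unfolding nth[OF p(4)] nth[OF p(5)] using p(2) by simp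
  qed
  ultimately show "supersolvable G" unfolding supersolvable_def by blast
qed

text \<open>Every p-subgroup is conjugate into a given Sylow subgroup, and both parts of the
  condition are invariant under conjugation.\<close>

lemma elementary_p_subgroups_iff:
  "elementary_p_subgroups G \<longleftrightarrow> (\<forall>p S. sylow_subgroup p S G \<longrightarrow> elementary_abelian (G\<lparr>carrier := S\<rparr>))"
proof (intro iffI allI impI)
  fix p S assume el: "elementary_p_subgroups G" and "sylow_subgroup p S G"
  then have S: "prime p" "subgroup S G" "card S = p ^ multiplicity p (order G)" by (auto simp: sylow_subgroup_def)
  note e = elementary_p_subgroupsD[OF el S]
  have "comm_group (G\<lparr>carrier := S\<rparr>)" by (rule sub_comm_group[OF S(2) e(2)])
  moreover have "\<forall>x\<in>S. x [^]\<^bsub>G\<lparr>carrier := S\<rparr>\<^esub> p = \<one>" using e(1) nat_pow_consistent[of _ p S] by simp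
  ultimately show "elementary_abelian (G\<lparr>carrier := S\<rparr>)" unfolding elementary_abelian_def using S(1) by auto
next
  assume syl: "\<forall>p S. sylow_subgroup p S G \<longrightarrow> elementary_abelian (G\<lparr>carrier := S\<rparr>)"
  show "elementary_p_subgroups G" unfolding elementary_p_subgroups_def
  proof (intro allI impI ballI conjI)
    fix p :: nat and S x assume S: "prime p" "subgroup S G" "\<exists>k. card S = p ^ k" "x \<in> S"
    obtain k where k: "card S = p ^ k" using S(3) by auto
    have SG: "x \<in> carrier G" if "x \<in> S" for x using subgroup.mem_carrier[OF S(2) that] .
    obtain P where P: "subgroup P G" "\<not> p dvd card (rcosets P)" "card P = p ^ multiplicity p (order G)"
      using sylow_subgroup_obtain[OF S(1)] by blast
    then have "elementary_abelian (G\<lparr>carrier := P\<rparr>)" using syl S(1) by (auto simp: sylow_subgroup_def)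
    then obtain q :: nat where cP: "comm_group (G\<lparr>carrier := P\<rparr>)" and q: "prime q" "\<And>x. x \<in> P \<Longrightarrow> x [^] q = \<one>"
      using nat_pow_consistent unfolding elementary_abelian_def by auto
    interpret P: comm_group "G\<lparr>carrier := P\<rparr>" by (rule cP)
    obtain t where t: "t \<in> carrier G" "\<And>z. z \<in> S \<Longrightarrow> t \<otimes> z \<otimes> inv t \<in> P"
      using sylow_contains[OF P(1,2) S(2) k S(1)] by blast
    show "x \<otimes> y = y \<otimes> x" if y: "y \<in> S" for y
    proof -
      have "(t \<otimes> x \<otimes> inv t) \<otimes> (t \<otimes> y \<otimes> inv t) = (t \<otimes> y \<otimes> inv t) \<otimes> (t \<otimes> x \<otimes> inv t)"
        using P.m_comm t(2)[OF S(4)] t(2)[OF y] by simp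
      then have "inv t \<otimes> ((t \<otimes> x \<otimes> inv t) \<otimes> (t \<otimes> y \<otimes> inv t)) \<otimes> t = inv t \<otimes> ((t \<otimes> y \<otimes> inv t) \<otimes> (t \<otimes> x \<otimes> inv t)) \<otimes> t"
        by simp
      then show ?thesis using t(1) SG[OF S(4)] SG[OF y] by (simp add: word_simps)
    qed
    have xG: "x \<in> carrier G" using SG[OF S(4)] .
    have "t \<otimes> x [^] q \<otimes> inv t = \<one>" using conj_pow[OF t(1) xG] q(2)[OF t(2)[OF S(4)]] by simp
    then have "inv t \<otimes> (t \<otimes> x [^] q \<otimes> inv t) \<otimes> t = \<one>" using t(1) by simp
    then have xq: "x [^] q = \<one>" using t(1) xG by (simp add: word_simps)
    \<comment> \<open>The prime q from \<open>elementary_abelian\<close> is not tied to p by the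
      definition. An element x \<noteq> 1 of the p-subgroup S has order q, which forces q =
      p.\<close>
    show "x [^] p = \<one>"
    proof (cases "x = \<one>")
      case False
      have "card (generate G {x}) = q" by (rule card_generate_prime[OF xG False xq q(1)])
      then have "q dvd p ^ k"
        using card_dvd[OF S(2) generate_singleton_subgroup[OF xG] sub_generate[OF S(2,4)]] k by simp
      then have "q = p" using S(1) q(1) by (meson prime_dvd_power primes_dvd_imp_eq)
      then show ?thesis using xq by simp
    qed simp
  qed
qed

end

theorem theorem1p4:
  fixes G :: "('a, 'b) monoid_scheme"
  assumes "group G" and "finite (carrier G)"
  shows "shellable_poset (coset_poset G) \<longleftrightarrow>
    supersolvable G \<and> (\<forall>p S. sylow_subgroup p S G \<longrightarrow> elementary_abelian (G\<lparr>carrier := S\<rparr>))"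
proof -
  interpret finite_group G using assms by (simp add: finite_group_def finite_group_axioms_def)
  show ?thesis
    unfolding supersolvable_iff elementary_p_subgroups_iff[symmetric] elementary_supersolvable_def[symmetric]
    using shellable_if_elementary_supersolvable elementary_supersolvable_if_shellable finite_group_axioms by blast
qed

end
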